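(* Let $M$ be a matroid on a finite set $E$ with circuits $\mathfrak C$ and cocircuits $\mathfrak C^*$, and let $\mathbb H$ be a hyperfield with an involution $\tau$. For a homomorphism $\Phi$ into $\mathbb H^*$ defined on one of the groups $\mathbb T_M^{(0)}\subseteq\mathbb T_M\subseteq\mathbb T_M^{\mathfrak C,\mathfrak C^*}$ consider the condition ($\mathcal S$) for any $C\in\mathfrak C$ and $D\in\mathfrak C^*$ with $C\cap D=\{x_0,x_1,\dots,x_k\}$, $k\ge2$ (the $x_i$ distinct), and any circuits $C_j\in\mathfrak C$ with $C_j\cap D=\{x_0,x_j\}$, $1\le j\le k$, $$1\in\boxplus_{j=1}^{k}\Phi\left(\frac{C(x_j)\,C_j(x_0)}{C(x_0)\,C_j(x_j)}\right).$$ (1) Any pair $(\gamma,\delta)$ of $\mathbb H^*$-circuit and $\mathbb H^*$-cocircuit signatures of $M$ that are strong orthogonal with respect to $\tau$ defines a homomorphism $\Phi:\mathbb T_M^{\mathfrak C,\mathfrak C^*}\to\mathbb H^*$ that satisfies ($\mathcal S$), by setting $\Phi(C(x))=\gamma C(x)$ for all $C\in\mathfrak C$, $x\in C$, and $\Phi(D(y))=\tau(\delta D(y))$ for all $D\in\mathfrak C^*$, $y\in D$. (2) Conversely, any homomorphism $\Phi:\mathbb T_M^{\mathfrak C,\mathfrak C^*}\to\mathbb H^*$ that satisfies ($\mathcal S$) defines a pair $(\gamma,\delta)$ of $\mathbb H^*$-circuit and $\mathbb H^*$-cocircuit signatures of $M$ that are strong orthogonal with respect to $\tau$, by setting $\gamma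 C(x)=\Phi(C(x))$ for all $C\in\mathfrak C$, $x\in C$, and $\delta D(y)=\tau(\Phi(D(y)))$ for all $D\in\mathfrak C^*$, $y\in D$. (3) Two such homomorphisms define the same strong $\mathbb H$-matroid with underlying matroid $M$ if and only if they coincide on the Tutte group $\mathbb T_M$, while they define the same strong rescaling class of $M$ if and only if they coincide on the inner Tutte group $\mathbb T_M^{(0)}$. (4) In particular, there exist one-to-one correspondences between: $\mathcal N^{\tau,s}_{\mathbb H}(M)$ and the homomorphisms $\mathbb T_M^{\mathfrak C,\mathfrak C^*}\to\mathbb H^*$ that satisfy ($\mathcal S$); $\mathcal M^{s}_{\mathbb H}(M)$ and the homomorphisms $\mathbb T_M\to\mathbb H^*$ that satisfy ($\mathcal S$); $\mathcal R^{s}_{\mathbb H}(M)$ and the homomorphisms $\mathbb T_M^{(0)}\to\mathbb H^*$ that satisfy ($\mathcal S$). (5) The same results (1)–(4) hold in the weak case, i.e. with "strong" replaced by "weak", superscripts $s$ by $w$, and ($\mathcal S$) replaced by the condition ($\mathcal W$), which is the same statement as ($\mathcal S$) but with the condition $k\le2$ (so that it is required only for $k=2$).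
   Context: A hyperfield is $(\mathbb H,\boxplus,\odot,0,1)$ with $0\ne1$ where: $\boxplus$ is a commutative, associative hyperoperation (each $a\boxplus b$ is a nonempty subset of $\mathbb H$; for subsets, $A\boxplus B=\bigcup_{a\in A,b\in B}a\boxplus b$) with $0\boxplus x=\{x\}$, each $x$ has a unique $-x$ with $0\in x\boxplus -x$, and $x\in y\boxplus z\iff z\in x\boxplus -y$; $(\mathbb H,\odot,1)$ is a commutative monoid, $0\odot x=0$, $a\odot(x\boxplus y)=(a\odot x)\boxplus(a\odot y)$; and $\mathbb H^*=\mathbb H\setminus\{0\}$ is a group under $\odot$. An involution is a map $\tau:\mathbb H\to\mathbb H$ with $\tau(0)=0$, $\tau(1)=1$, $\tau(x\odot y)=\tau(x)\odot\tau(y)$, $\tau(x\boxplus y)\subseteq\tau(x)\boxplus\tau(y)$ and $\tau\circ\tau=\mathrm{id}$. Tutte groups. $\mathbb T_M^{\mathfrak C,\mathfrak C^*}$ is the multiplicative abelian group with generators $\epsilon_M$, $C(x)$ ($C\in\mathfrak C$, $x\in C$), $D(y)$ ($D\in\mathfrak C^*$, $y\in D$) and relations $\epsilon_M^2=1$ and $C(x)D(x)=\epsilon_MC(y)D(y)$ whenever $C\in\mathfrak C$, $D\in\mathfrak C^*$, $C\cap D=\{x,y\}$ with $x\neq y$. The Tutte group $\mathbb T_M$ is the subgroup generated by $\epsilon_M$, all $C(x)C(y)^{-1}$ ($x,y\in C\in\mathfrak C$) and all $D(x)D(y)^{-1}$ ($x,y\in D\in\mathfrak C^*$). The inner Tutte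 group $\mathbb T_M^{(0)}$ is the kernel of the homomorphism $\mathbb T_M^{\mathfrak C,\mathfrak C^*}\to\mathbb Z^E\times\mathbb Z^{\mathfrak C}\times\mathbb Z^{\mathfrak C^*}$ given by $\epsilon_M\mapsto0$, $C(x)\mapsto(\mathbf 1_x,\mathbf 1_C,0)$, $D(y)\mapsto(-\mathbf 1_y,0,\mathbf 1_D)$; one has $\mathbb T_M^{(0)}\subseteq\mathbb T_M$. Signatures. An $\mathbb H^*$-circuit signature is a family $\gamma=\{\gamma C:C\to\mathbb H^*\}_{C\in\mathfrak C}$; an $\mathbb H^*$-cocircuit signature is a family $\delta=\{\delta D:D\to\mathbb H^*\}_{D\in\mathfrak C^*}$. They are strong orthogonal with respect to $\tau$ if $0\in\boxplus_{x\in C\cap D}\gamma C(x)\odot\tau(\delta D(x))$ for all $C\in\mathfrak C$, $D\in\mathfrak C^*$ (empty sum $=0$), and weak orthogonal if this holds whenever $|C\cap D|\le3$. $\mathcal N^{\tau,s}_{\mathbb H}(M)$ (resp. $\mathcal N^{\tau,w}_{\mathbb H}(M)$) is the set of strong (resp. weak) orthogonal pairs. $(\gamma_1,\delta_1)\sim_\tau(\gamma_2,\delta_2)$ if there are $b_C,l_D\in\mathbb H^*$ with $\gamma_1C(x)=b_C\odot\gamma_2C(x)$, $\delta_1D(y)=l_D\odot\delta_2D(y)$ for all $C\in\mathfrak C$, $x\in C$, $D\in\mathfrak C^*$, $y\in D$. A strong (weak) $\mathbb H$-matroid with underlying matroid $M$ is a $\sim_\tau$-class in $\mathcal N^{\tau,s}_{\mathbb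 H}(M)$ ($\mathcal N^{\tau,w}_{\mathbb H}(M)$); the set of these is $\mathcal M^s_{\mathbb H}(M)$ ($\mathcal M^w_{\mathbb H}(M)$). $(\gamma_1,\delta_1)\approx_\tau(\gamma_2,\delta_2)$ if there is $h:E\to\mathbb H^*$ with $\gamma_1C(x)=h(x)\odot\gamma_2C(x)$ and $\delta_1D(y)=\tau(h(y)^{-1})\odot\delta_2D(y)$ for all $C$, $x\in C$, $D$, $y\in D$. Two $\sim_\tau$-classes are $\cong_\tau$-equivalent if they have $\approx_\tau$-equivalent representatives. A strong (weak) rescaling class is a $\cong_\tau$-class; the set of these is $\mathcal R^s_{\mathbb H}(M)$ ($\mathcal R^w_{\mathbb H}(M)$).
   Formalization: Homomorphisms from each of the three Tutte groups to H^* are additionally required to send ε_M to −1; without this, (2)–(4) fail, e.g. for U_{1,2} over the reals with the trivial homomorphism, where (S) is vacuous but 1+1≠0. *)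

theory Defs
  imports "HOL-Algebra.Free_Abelian_Groups"
begin

section \<open>Hyperfields and involutions\<close>

record 'h hyperstructure = "'h monoid" +
  hzero :: "'h"
  hplus :: "'h \<Rightarrow> 'h \<Rightarrow> 'h set"

definition set_hplus :: "'h hyperstructure \<Rightarrow> 'h set \<Rightarrow> 'h set \<Rightarrow> 'h set" where
  "set_hplus H A B = (\<Union>a\<in>A. \<Union>b\<in>B. hplus H a b)"

definition hneg :: "'h hyperstructure \<Rightarrow> 'h \<Rightarrow> 'h" where
  "hneg H x = (THE y. y \<in> carrier H \<and> hzero H \<in> hplus H x y)"

definition hunits :: "'h hyperstructure \<Rightarrow> 'h monoid" where
  "hunits H = \<lparr>carrier = carrier H - {hzero H}, monoid.mult = monoid.mult H, one = \<one>\<^bsub>H\<^esub>\<rparr>"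

locale hyperfield = comm_monoid H for H :: "'h hyperstructure" (structure) +
  assumes hzero_closed: "hzero H \<in> carrier H"
    and hzero_not_one: "hzero H \<noteq> \<one>"
    and hplus_closed: "\<lbrakk>a \<in> carrier H; b \<in> carrier H\<rbrakk> \<Longrightarrow> hplus H a b \<subseteq> carrier H"
    and hplus_nonempty: "\<lbrakk>a \<in> carrier H; b \<in> carrier H\<rbrakk> \<Longrightarrow> hplus H a b \<noteq> {}"
    and hplus_comm: "\<lbrakk>a \<in> carrier H; b \<in> carrier H\<rbrakk> \<Longrightarrow> hplus H a b = hplus H b a"
    and hplus_assoc: "\<lbrakk>a \<in> carrier H; b \<in> carrier H; c \<in> carrier H\<rbrakk>
      \<Longrightarrow> set_hplus H (hplus H a b) {c} = set_hplus H {a} (hplus H b c)"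
    and hplus_zero: "a \<in> carrier H \<Longrightarrow> hplus H (hzero H) a = {a}"
    and hneg_ex1: "a \<in> carrier H \<Longrightarrow> \<exists>!b. b \<in> carrier H \<and> hzero H \<in> hplus H a b"
    and hplus_reversible: "\<lbrakk>a \<in> carrier H; b \<in> carrier H; c \<in> carrier H\<rbrakk>
      \<Longrightarrow> a \<in> hplus H b c \<longleftrightarrow> c \<in> hplus H a (hneg H b)"
    and hzero_mult: "a \<in> carrier H \<Longrightarrow> hzero H \<otimes> a = hzero H"
    and hplus_distrib: "\<lbrakk>a \<in> carrier H; b \<in> carrier H; c \<in> carrier H\<rbrakk>
      \<Longrightarrow> (\<lambda>z. a \<otimes> z) ` hplus H b c = hplus H (a \<otimes> b) (a \<otimes> c)"
    and hunits_group: "group (hunits H)"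

locale hyperfield_involution = hyperfield H for H :: "'h hyperstructure" (structure) +
  fixes \<tau> :: "'h \<Rightarrow> 'h"
  assumes inv_closed: "a \<in> carrier H \<Longrightarrow> \<tau> a \<in> carrier H"
    and inv_zero: "\<tau> (hzero H) = hzero H"
    and inv_one: "\<tau> \<one> = \<one>"
    and inv_mult: "\<lbrakk>a \<in> carrier H; b \<in> carrier H\<rbrakk> \<Longrightarrow> \<tau> (a \<otimes> b) = \<tau> a \<otimes> \<tau> b"
    and inv_hplus: "\<lbrakk>a \<in> carrier H; b \<in> carrier H\<rbrakk> \<Longrightarrow> \<tau> ` hplus H a b \<subseteq> hplus H (\<tau> a) (\<tau> b)"
    and inv_inv: "a \<in> carrier H \<Longrightarrow> \<tau> (\<tau> a) = a"

text \<open>Finite hypersums are products in the commutative monoid of subsets of the hyperfield;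
  the neutral element \<open>{0}\<close> is the empty hypersum.\<close>

definition hsum_monoid :: "'h hyperstructure \<Rightarrow> 'h set monoid" where
  "hsum_monoid H = \<lparr>carrier = Pow (carrier H), monoid.mult = set_hplus H, one = {hzero H}\<rparr>"

definition hsum :: "'h hyperstructure \<Rightarrow> ('i \<Rightarrow> 'h) \<Rightarrow> 'i set \<Rightarrow> 'h set" where
  "hsum H f I = finprod (hsum_monoid H) (\<lambda>i. {f i}) I"

lemma (in hyperfield) comm_monoid_hsum_monoid: "comm_monoid (hsum_monoid H)"
proof (rule comm_monoidI)
  fix A B
  assume "A \<in> carrier (hsum_monoid H)" "B \<in> carrier (hsum_monoid H)"
  then have AB: "A \<subseteq> carrier H" "B \<subseteq> carrier H" by (auto simp: hsum_monoid_def)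
  show "A \<otimes>\<^bsub>hsum_monoid H\<^esub> B \<in> carrier (hsum_monoid H)"
    using AB hplus_closed by (simp add: hsum_monoid_def set_hplus_def UN_subset_iff subset_iff) blast
  have "set_hplus H A B = (\<Union>a\<in>A. \<Union>b\<in>B. hplus H b a)"
    unfolding set_hplus_def using AB by (intro SUP_cong refl hplus_comm) auto
  also have "\<dots> = set_hplus H B A"
    unfolding set_hplus_def by (rule SUP_commute)
  finally show "A \<otimes>\<^bsub>hsum_monoid H\<^esub> B = B \<otimes>\<^bsub>hsum_monoid H\<^esub> A"
    by (simp add: hsum_monoid_def)
next
  fix A B C
  assume "A \<in> carrier (hsum_monoid H)" "B \<in> carrier (hsum_monoid H)" "C \<in> carrier (hsum_monoid H)"
  then have ABC: "A \<subseteq> carrier H" "B \<subseteq> carrier H" "C \<subseteq> carrier H" by (auto simp: hsum_monoid_def)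
  have "set_hplus H (set_hplus H A B) C = (\<Union>a\<in>A. \<Union>b\<in>B. \<Union>c\<in>C. set_hplus H (hplus H a b) {c})"
    by (auto simp: set_hplus_def)
  also have "\<dots> = (\<Union>a\<in>A. \<Union>b\<in>B. \<Union>c\<in>C. set_hplus H {a} (hplus H b c))"
    using ABC by (intro SUP_cong refl hplus_assoc) auto
  also have "\<dots> = set_hplus H A (set_hplus H B C)"
    by (auto simp: set_hplus_def)
  finally show "A \<otimes>\<^bsub>hsum_monoid H\<^esub> B \<otimes>\<^bsub>hsum_monoid H\<^esub> C = A \<otimes>\<^bsub>hsum_monoid H\<^esub> (B \<otimes>\<^bsub>hsum_monoid H\<^esub> C)"
    by (simp add: hsum_monoid_def)
next
  fix A
  assume "A \<in> carrier (hsum_monoid H)"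
  then have A: "A \<subseteq> carrier H" by (auto simp: hsum_monoid_def)
  have "set_hplus H {hzero H} A = (\<Union>a\<in>A. hplus H (hzero H) a)"
    by (simp add: set_hplus_def)
  also have "\<dots> = (\<Union>a\<in>A. {a})"
    using A by (intro SUP_cong refl hplus_zero) auto
  finally have "set_hplus H {hzero H} A = A"
    by simp
  then show "\<one>\<^bsub>hsum_monoid H\<^esub> \<otimes>\<^bsub>hsum_monoid H\<^esub> A = A"
    by (simp add: hsum_monoid_def)
qed (simp add: hsum_monoid_def hzero_closed)


section \<open>Matroids\<close>

record 'e indep_system =
  ground :: "'e set"
  indep :: "'e set \<Rightarrow> bool"

locale matroid =
  fixes M :: "'e indep_system"
  assumes ground_finite: "finite (ground M)"
    and indep_subset_ground: "indep M X \<Longrightarrow> X \<subseteq> ground M"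
    and indep_empty: "indep M {}"
    and indep_subset: "\<lbrakk>indep M X; Y \<subseteq> X\<rbrakk> \<Longrightarrow> indep M Y"
    and indep_augment: "\<lbrakk>indep M X; indep M Y; card X < card Y\<rbrakk>
      \<Longrightarrow> \<exists>y\<in>Y - X. indep M (insert y X)"

definition bases :: "'e indep_system \<Rightarrow> 'e set set" where
  "bases M = {B. indep M B \<and> (\<forall>X. indep M X \<and> B \<subseteq> X \<longrightarrow> X = B)}"

definition circuits :: "'e indep_system \<Rightarrow> 'e set set" where
  "circuits M = {C. C \<subseteq> ground M \<and> \<not> indep M C \<and> (\<forall>X. X \<subset> C \<longrightarrow> indep M X)}"

definition dual_matroid :: "'e indep_system \<Rightarrow> 'e indep_system" where
  "dual_matroid M =
     \<lparr>ground = ground M, indep = (\<lambda>X. X \<subseteq> ground M \<and> (\<exists>B\<in>bases M. X \<inter> B = {}))\<rparr>"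

definition cocircuits :: "'e indep_system \<Rightarrow> 'e set set" where
  "cocircuits M = circuits (dual_matroid M)"


section \<open>Tutte groups\<close>

text \<open>A set may be both a circuit and a cocircuit, so the generators are tagged.\<close>

datatype 'e tutte_gen = Epsilon | Circ "'e set" 'e | Cocirc "'e set" 'e

definition tutte_gens :: "'e indep_system \<Rightarrow> 'e tutte_gen set" where
  "tutte_gens M = {Epsilon} \<union> {Circ C x |C x. C \<in> circuits M \<and> x \<in> C}
     \<union> {Cocirc D y |D y. D \<in> cocircuits M \<and> y \<in> D}"

text \<open>The relations and the normal closure are written in the additive notation of
  \<^const>\<open>free_Abelian_group\<close>; the groups below are multiplicative.\<close>

definition tutte_rels :: "'e indep_system \<Rightarrow> ('e tutte_gen \<Rightarrow>\<^sub>0 int) set" where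
  "tutte_rels M = {frag_of Epsilon + frag_of Epsilon} \<union>
     {frag_of (Circ C x) + frag_of (Cocirc D x)
        - (frag_of Epsilon + frag_of (Circ C y) + frag_of (Cocirc D y)) |C D x y.
        C \<in> circuits M \<and> D \<in> cocircuits M \<and> C \<inter> D = {x, y} \<and> x \<noteq> y}"

definition tutte_rel_subgroup :: "'e indep_system \<Rightarrow> ('e tutte_gen \<Rightarrow>\<^sub>0 int) set" where
  "tutte_rel_subgroup M = generate (free_Abelian_group (tutte_gens M)) (tutte_rels M)"

definition ext_tutte_group :: "'e indep_system \<Rightarrow> ('e tutte_gen \<Rightarrow>\<^sub>0 int) set monoid" where
  "ext_tutte_group M = free_Abelian_group (tutte_gens M) Mod tutte_rel_subgroup M"

definition tutte_class :: "'e indep_system \<Rightarrow> 'e tutte_gen \<Rightarrow> ('e tutte_gen \<Rightarrow>\<^sub>0 int) set" where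
  "tutte_class M g = tutte_rel_subgroup M #>\<^bsub>free_Abelian_group (tutte_gens M)\<^esub> frag_of g"

abbreviation t_eps :: "'e indep_system \<Rightarrow> ('e tutte_gen \<Rightarrow>\<^sub>0 int) set" where
  "t_eps M \<equiv> tutte_class M Epsilon"

abbreviation t_circ :: "'e indep_system \<Rightarrow> 'e set \<Rightarrow> 'e \<Rightarrow> ('e tutte_gen \<Rightarrow>\<^sub>0 int) set" where
  "t_circ M C x \<equiv> tutte_class M (Circ C x)"

abbreviation t_cocirc :: "'e indep_system \<Rightarrow> 'e set \<Rightarrow> 'e \<Rightarrow> ('e tutte_gen \<Rightarrow>\<^sub>0 int) set" where
  "t_cocirc M D y \<equiv> tutte_class M (Cocirc D y)"

definition tutte_group :: "'e indep_system \<Rightarrow> ('e tutte_gen \<Rightarrow>\<^sub>0 int) set monoid" where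
  "tutte_group M = (ext_tutte_group M)\<lparr>carrier := generate (ext_tutte_group M)
     ({t_eps M}
      \<union> {t_circ M C x \<otimes>\<^bsub>ext_tutte_group M\<^esub> inv\<^bsub>ext_tutte_group M\<^esub> t_circ M C y |C x y.
           C \<in> circuits M \<and> x \<in> C \<and> y \<in> C}
      \<union> {t_cocirc M D x \<otimes>\<^bsub>ext_tutte_group M\<^esub> inv\<^bsub>ext_tutte_group M\<^esub> t_cocirc M D y |D x y.
           D \<in> cocircuits M \<and> x \<in> D \<and> y \<in> D})\<rparr>"

text \<open>As the ground set is finite, the product of the groups of integer vectors indexed by the
  ground set, the circuits and the cocircuits is the free abelian group on the disjoint union of
  these three index sets.\<close>

definition degree_group :: "'e indep_system \<Rightarrow> ('e + 'e set + 'e set \<Rightarrow>\<^sub>0 int) monoid" where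
  "degree_group M = free_Abelian_group (ground M <+> (circuits M <+> cocircuits M))"

fun gen_degree :: "'e tutte_gen \<Rightarrow> ('e + 'e set + 'e set \<Rightarrow>\<^sub>0 int)" where
  "gen_degree Epsilon = 0"
| "gen_degree (Circ C x) = frag_of (Inl x) + frag_of (Inr (Inl C))"
| "gen_degree (Cocirc D y) = - frag_of (Inl y) + frag_of (Inr (Inr D))"

text \<open>Elements of the extended Tutte group are cosets, on which the linear extension of
  \<^const>\<open>gen_degree\<close> is constant (\<open>tutte_degree_hom\<close> and \<open>tutte_degree_gen\<close> below).\<close>

definition tutte_degree ::
    "('e tutte_gen \<Rightarrow>\<^sub>0 int) set \<Rightarrow> ('e + 'e set + 'e set \<Rightarrow>\<^sub>0 int)" where
  "tutte_degree K = the_elem (frag_extend gen_degree ` K)"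

definition inner_tutte_group :: "'e indep_system \<Rightarrow> ('e tutte_gen \<Rightarrow>\<^sub>0 int) set monoid" where
  "inner_tutte_group M = (ext_tutte_group M)
     \<lparr>carrier := kernel (ext_tutte_group M) (degree_group M) tutte_degree\<rparr>"

lemma circuits_subset_ground: "C \<in> circuits M \<Longrightarrow> C \<subseteq> ground M"
  by (simp add: circuits_def)

lemma cocircuits_subset_ground: "D \<in> cocircuits M \<Longrightarrow> D \<subseteq> ground M"
  by (simp add: cocircuits_def circuits_def dual_matroid_def)

lemma tutte_rels_subset: "tutte_rels M \<subseteq> carrier (free_Abelian_group (tutte_gens M))"
proof
  fix r
  assume "r \<in> tutte_rels M"
  then consider "r = frag_of Epsilon + frag_of Epsilon"
    | C D x y where "r = frag_of (Circ C x) + frag_of (Cocirc D x)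
        - (frag_of Epsilon + frag_of (Circ C y) + frag_of (Cocirc D y))"
        "C \<in> circuits M" "D \<in> cocircuits M" "C \<inter> D = {x, y}"
    by (auto simp: tutte_rels_def)
  then show "r \<in> carrier (free_Abelian_group (tutte_gens M))"
  proof cases
    case 1
    then show ?thesis
      using keys_add[of "frag_of Epsilon" "frag_of Epsilon"] by (auto simp: tutte_gens_def)
  next
    case 2
    then have "{Epsilon, Circ C x, Circ C y, Cocirc D x, Cocirc D y} \<subseteq> tutte_gens M"
      by (auto simp: tutte_gens_def)
    moreover have "Poly_Mapping.keys r \<subseteq> {Epsilon, Circ C x, Circ C y, Cocirc D x, Cocirc D y}"
      unfolding 2(1) by (rule order.trans[OF keys_diff] Un_least order.trans[OF keys_add] | simp)+
    ultimately show ?thesis by auto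
  qed
qed

lemma tutte_rel_subgroup_normal:
  "tutte_rel_subgroup M \<lhd> free_Abelian_group (tutte_gens M)"
  unfolding tutte_rel_subgroup_def
  by (intro comm_group.subgroup_imp_normal abelian_free_Abelian_group
      group.generate_is_subgroup group_free_Abelian_group tutte_rels_subset)

lemma comm_group_ext_tutte_group: "comm_group (ext_tutte_group M)"
  unfolding ext_tutte_group_def
  by (intro comm_group.abelian_FactGroup abelian_free_Abelian_group
      normal_imp_subgroup tutte_rel_subgroup_normal)

lemma frag_extend_gen_degree_rel:
  assumes "r \<in> tutte_rel_subgroup M"
  shows "frag_extend gen_degree r = 0"
proof -
  have carr: "a \<in> carrier (free_Abelian_group (tutte_gens M))" if "a \<in> tutte_rels M" for a
    using tutte_rels_subset that by blast
  show ?thesis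
    using assms unfolding tutte_rel_subgroup_def
  proof (induction rule: generate.induct)
    case (incl h)
    then show ?case by (auto simp: tutte_rels_def frag_extend_add frag_extend_diff)
  next
    case (inv h)
    then have "frag_extend gen_degree h = 0"
      by (auto simp: tutte_rels_def frag_extend_add frag_extend_diff)
    then show ?case
      using carr[OF inv] by (simp add: frag_extend_minus)
  qed (auto simp: frag_extend_add)
qed

lemma tutte_degree_coset:
  "tutte_degree (tutte_rel_subgroup M #>\<^bsub>free_Abelian_group (tutte_gens M)\<^esub> c)
     = frag_extend gen_degree c"
proof -
  have "0 \<in> tutte_rel_subgroup M"
    unfolding tutte_rel_subgroup_def
    using generate.one[of "free_Abelian_group (tutte_gens M)"] by simp
  then have "frag_extend gen_degree ` (tutte_rel_subgroup M #>\<^bsub>free_Abelian_group (tutte_gens M)\<^esub> c)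
      = {frag_extend gen_degree c}"
    by (auto simp: r_coset_def frag_extend_add frag_extend_gen_degree_rel)
  then show ?thesis by (simp add: tutte_degree_def)
qed

lemma tutte_degree_gen: "tutte_degree (tutte_class M g) = gen_degree g"
  by (simp add: tutte_class_def tutte_degree_coset)

lemma gen_degree_closed:
  assumes "g \<in> tutte_gens M"
  shows "gen_degree g \<in> carrier (degree_group M)"
proof -
  have "Poly_Mapping.keys (gen_degree g) \<subseteq>
      (case g of Epsilon \<Rightarrow> {} | Circ C x \<Rightarrow> {Inl x, Inr (Inl C)} | Cocirc D y \<Rightarrow> {Inl y, Inr (Inr D)})"
    by (cases g) (auto dest: subsetD[OF keys_add] simp del: add_uminus_conv_diff uminus_add_conv_diff)
  also have "\<dots> \<subseteq> ground M <+> (circuits M <+> cocircuits M)"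
    using assms circuits_subset_ground cocircuits_subset_ground
    by (fastforce simp: tutte_gens_def split: tutte_gen.splits)
  finally show ?thesis by (simp add: degree_group_def)
qed

lemma tutte_degree_hom: "tutte_degree \<in> hom (ext_tutte_group M) (degree_group M)"
proof (rule homI)
  fix K
  assume "K \<in> carrier (ext_tutte_group M)"
  then obtain c where c: "Poly_Mapping.keys c \<subseteq> tutte_gens M"
    "K = tutte_rel_subgroup M #>\<^bsub>free_Abelian_group (tutte_gens M)\<^esub> c"
    by (auto simp: ext_tutte_group_def FactGroup_def RCOSETS_def)
  have "Poly_Mapping.keys (frag_extend gen_degree c)
      \<subseteq> (\<Union>g\<in>Poly_Mapping.keys c. Poly_Mapping.keys (gen_degree g))"
    by (rule keys_frag_extend)
  also have "\<dots> \<subseteq> ground M <+> (circuits M <+> cocircuits M)"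
    using c gen_degree_closed by (fastforce simp: degree_group_def)
  finally show "tutte_degree K \<in> carrier (degree_group M)"
    by (simp add: c tutte_degree_coset degree_group_def)
next
  fix K L
  assume "K \<in> carrier (ext_tutte_group M)" "L \<in> carrier (ext_tutte_group M)"
  then obtain c d where cd: "Poly_Mapping.keys c \<subseteq> tutte_gens M" "Poly_Mapping.keys d \<subseteq> tutte_gens M"
    "K = tutte_rel_subgroup M #>\<^bsub>free_Abelian_group (tutte_gens M)\<^esub> c"
    "L = tutte_rel_subgroup M #>\<^bsub>free_Abelian_group (tutte_gens M)\<^esub> d"
    by (auto simp: ext_tutte_group_def FactGroup_def RCOSETS_def)
  have "K \<otimes>\<^bsub>ext_tutte_group M\<^esub> L
      = tutte_rel_subgroup M #>\<^bsub>free_Abelian_group (tutte_gens M)\<^esub> (c + d)"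
    using normal.rcos_sum[OF tutte_rel_subgroup_normal, of c M d] cd
    by (simp add: ext_tutte_group_def FactGroup_def)
  then show "tutte_degree (K \<otimes>\<^bsub>ext_tutte_group M\<^esub> L)
      = tutte_degree K \<otimes>\<^bsub>degree_group M\<^esub> tutte_degree L"
    by (simp add: cd tutte_degree_coset frag_extend_add degree_group_def)
qed


section \<open>Signatures, matroids over hyperfields and rescaling classes\<close>

datatype strength = Strong | Weak

text \<open>Signatures, and the homomorphisms counted in \<open>tutte_homs\<close> below, are extensional functions
  (\<^const>\<open>undefined\<close> off their domain), so that equality is equality of maps.\<close>

definition circuit_signatures ::
    "'e indep_system \<Rightarrow> 'h hyperstructure \<Rightarrow> ('e set \<Rightarrow> 'e \<Rightarrow> 'h) set" where
  "circuit_signatures M H = (\<Pi>\<^sub>E C\<in>circuits M. C \<rightarrow>\<^sub>E carrier (hunits H))"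

definition cocircuit_signatures ::
    "'e indep_system \<Rightarrow> 'h hyperstructure \<Rightarrow> ('e set \<Rightarrow> 'e \<Rightarrow> 'h) set" where
  "cocircuit_signatures M H = (\<Pi>\<^sub>E D\<in>cocircuits M. D \<rightarrow>\<^sub>E carrier (hunits H))"

type_synonym ('e, 'h) signature_pair = "('e set \<Rightarrow> 'e \<Rightarrow> 'h) \<times> ('e set \<Rightarrow> 'e \<Rightarrow> 'h)"

definition orthogonal_pairs ::
    "'e indep_system \<Rightarrow> 'h hyperstructure \<Rightarrow> ('h \<Rightarrow> 'h) \<Rightarrow> strength
      \<Rightarrow> ('e, 'h) signature_pair set" where
  "orthogonal_pairs M H \<tau> s = {(\<gamma>, \<delta>).
     \<gamma> \<in> circuit_signatures M H \<and> \<delta> \<in> cocircuit_signatures M H \<and>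
     (\<forall>C\<in>circuits M. \<forall>D\<in>cocircuits M. (s = Weak \<longrightarrow> card (C \<inter> D) \<le> 3) \<longrightarrow>
        hzero H \<in> hsum H (\<lambda>x. \<gamma> C x \<otimes>\<^bsub>H\<^esub> \<tau> (\<delta> D x)) (C \<inter> D))}"

definition sim_rel ::
    "'e indep_system \<Rightarrow> 'h hyperstructure \<Rightarrow> ('h \<Rightarrow> 'h) \<Rightarrow> strength
      \<Rightarrow> (('e, 'h) signature_pair \<times> ('e, 'h) signature_pair) set" where
  "sim_rel M H \<tau> s = {((\<gamma>1, \<delta>1), (\<gamma>2, \<delta>2)).
     (\<gamma>1, \<delta>1) \<in> orthogonal_pairs M H \<tau> s \<and> (\<gamma>2, \<delta>2) \<in> orthogonal_pairs M H \<tau> s \<and>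
     (\<exists>b \<in> circuits M \<rightarrow> carrier (hunits H). \<exists>l \<in> cocircuits M \<rightarrow> carrier (hunits H).
        (\<forall>C\<in>circuits M. \<forall>x\<in>C. \<gamma>1 C x = b C \<otimes>\<^bsub>H\<^esub> \<gamma>2 C x) \<and>
        (\<forall>D\<in>cocircuits M. \<forall>y\<in>D. \<delta>1 D y = l D \<otimes>\<^bsub>H\<^esub> \<delta>2 D y))}"

definition approx_rel ::
    "'e indep_system \<Rightarrow> 'h hyperstructure \<Rightarrow> ('h \<Rightarrow> 'h) \<Rightarrow> strength
      \<Rightarrow> (('e, 'h) signature_pair \<times> ('e, 'h) signature_pair) set" where
  "approx_rel M H \<tau> s = {((\<gamma>1, \<delta>1), (\<gamma>2, \<delta>2)).
     (\<gamma>1, \<delta>1) \<in> orthogonal_pairs M H \<tau> s \<and> (\<gamma>2, \<delta>2) \<in> orthogonal_pairs M H \<tau> s \<and>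
     (\<exists>h \<in> ground M \<rightarrow> carrier (hunits H).
        (\<forall>C\<in>circuits M. \<forall>x\<in>C. \<gamma>1 C x = h x \<otimes>\<^bsub>H\<^esub> \<gamma>2 C x) \<and>
        (\<forall>D\<in>cocircuits M. \<forall>y\<in>D. \<delta>1 D y = \<tau> (inv\<^bsub>hunits H\<^esub> (h y)) \<otimes>\<^bsub>H\<^esub> \<delta>2 D y))}"

definition hyperfield_matroids ::
    "'e indep_system \<Rightarrow> 'h hyperstructure \<Rightarrow> ('h \<Rightarrow> 'h) \<Rightarrow> strength
      \<Rightarrow> ('e, 'h) signature_pair set set" where
  "hyperfield_matroids M H \<tau> s = orthogonal_pairs M H \<tau> s // sim_rel M H \<tau> s"

definition cong_rel ::
    "'e indep_system \<Rightarrow> 'h hyperstructure \<Rightarrow> ('h \<Rightarrow> 'h) \<Rightarrow> strength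
      \<Rightarrow> (('e, 'h) signature_pair set \<times> ('e, 'h) signature_pair set) set" where
  "cong_rel M H \<tau> s = {(X, Y). X \<in> hyperfield_matroids M H \<tau> s \<and> Y \<in> hyperfield_matroids M H \<tau> s \<and>
     (\<exists>p\<in>X. \<exists>q\<in>Y. (p, q) \<in> approx_rel M H \<tau> s)}"

definition rescaling_classes ::
    "'e indep_system \<Rightarrow> 'h hyperstructure \<Rightarrow> ('h \<Rightarrow> 'h) \<Rightarrow> strength
      \<Rightarrow> ('e, 'h) signature_pair set set set" where
  "rescaling_classes M H \<tau> s = hyperfield_matroids M H \<tau> s // cong_rel M H \<tau> s"

definition matroid_of_pair ::
    "'e indep_system \<Rightarrow> 'h hyperstructure \<Rightarrow> ('h \<Rightarrow> 'h) \<Rightarrow> strength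
      \<Rightarrow> ('e, 'h) signature_pair \<Rightarrow> ('e, 'h) signature_pair set" where
  "matroid_of_pair M H \<tau> s p = sim_rel M H \<tau> s `` {p}"

definition rescaling_class_of_pair ::
    "'e indep_system \<Rightarrow> 'h hyperstructure \<Rightarrow> ('h \<Rightarrow> 'h) \<Rightarrow> strength
      \<Rightarrow> ('e, 'h) signature_pair \<Rightarrow> ('e, 'h) signature_pair set set" where
  "rescaling_class_of_pair M H \<tau> s p = cong_rel M H \<tau> s `` {matroid_of_pair M H \<tau> s p}"


section \<open>Homomorphisms from Tutte groups\<close>

text \<open>The argument of \<open>\<Phi>\<close> lies in the inner Tutte group, so the condition makes sense for
  homomorphisms on each of the three Tutte groups.\<close>

definition tutte_condition ::
    "'e indep_system \<Rightarrow> 'h hyperstructure \<Rightarrow> strength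
      \<Rightarrow> (('e tutte_gen \<Rightarrow>\<^sub>0 int) set \<Rightarrow> 'h) \<Rightarrow> bool" where
  "tutte_condition M H s \<Phi> \<longleftrightarrow>
     (\<forall>C\<in>circuits M. \<forall>D\<in>cocircuits M. \<forall>(k::nat) x Cs.
        k \<ge> 2 \<and> (s = Weak \<longrightarrow> k \<le> 2) \<and>
        inj_on x {0..k} \<and> C \<inter> D = x ` {0..k} \<and>
        (\<forall>j\<in>{1..k}. Cs j \<in> circuits M \<and> Cs j \<inter> D = {x 0, x j}) \<longrightarrow>
        \<one>\<^bsub>H\<^esub> \<in> hsum H
          (\<lambda>j. \<Phi> ((t_circ M C (x j) \<otimes>\<^bsub>ext_tutte_group M\<^esub> t_circ M (Cs j) (x 0))
             \<otimes>\<^bsub>ext_tutte_group M\<^esub> inv\<^bsub>ext_tutte_group M\<^esub>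
                 (t_circ M C (x 0) \<otimes>\<^bsub>ext_tutte_group M\<^esub> t_circ M (Cs j) (x j))))
          {1..k})"

text \<open>Homomorphisms from a Tutte group to the units of a hyperfield are understood to send
  \<open>\<epsilon>\<^sub>M\<close> to \<open>-1\<close>. This does not follow from \<^const>\<open>tutte_condition\<close>, which says nothing
  about circuits and cocircuits meeting in two elements: for the uniform matroid of rank 1 on two
  elements it is vacuous, and over the reals the trivial homomorphism then yields signatures that
  are not orthogonal.\<close>

definition tutte_hom ::
    "'e indep_system \<Rightarrow> 'h hyperstructure \<Rightarrow> strength \<Rightarrow> ('e tutte_gen \<Rightarrow>\<^sub>0 int) set monoid
      \<Rightarrow> (('e tutte_gen \<Rightarrow>\<^sub>0 int) set \<Rightarrow> 'h) \<Rightarrow> bool" where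
  "tutte_hom M H s T \<Phi> \<longleftrightarrow>
     \<Phi> \<in> hom T (hunits H) \<and> \<Phi> (t_eps M) = hneg H \<one>\<^bsub>H\<^esub> \<and> tutte_condition M H s \<Phi>"

definition tutte_homs ::
    "'e indep_system \<Rightarrow> 'h hyperstructure \<Rightarrow> strength \<Rightarrow> ('e tutte_gen \<Rightarrow>\<^sub>0 int) set monoid
      \<Rightarrow> (('e tutte_gen \<Rightarrow>\<^sub>0 int) set \<Rightarrow> 'h) set" where
  "tutte_homs M H s T = {\<Phi> \<in> extensional (carrier T). tutte_hom M H s T \<Phi>}"

definition pair_of_hom ::
    "'e indep_system \<Rightarrow> ('h \<Rightarrow> 'h) \<Rightarrow> (('e tutte_gen \<Rightarrow>\<^sub>0 int) set \<Rightarrow> 'h)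
      \<Rightarrow> ('e, 'h) signature_pair" where
  "pair_of_hom M \<tau> \<Phi> =
     ((\<lambda>C\<in>circuits M. \<lambda>x\<in>C. \<Phi> (t_circ M C x)),
      (\<lambda>D\<in>cocircuits M. \<lambda>y\<in>D. \<tau> (\<Phi> (t_cocirc M D y))))"

end

(* The Tutte group and the inner Tutte group are direct factors of the extended Tutte group: a
   homomorphism w from the degree group back to the extended Tutte group gives the endomorphism
   t \<mapsto> t w(deg t), which is the identity in degree 0, and w can be chosen so that the image is
   either of the two groups. Hence homomorphisms extend, and two homomorphisms agree on the inner
   Tutte group iff they differ by a homomorphism of the degree, that is, by rescaling elements,
   circuits and cocircuits; agreement on the Tutte group means that elements are not rescaled.

   A pair of signatures is a family of values on the generators. Orthogonality on C \<inter> D = {x, y} is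
   the defining relation of the group. On a larger C \<inter> D, dividing 0 \<in> \<boxplus> C(x) D(x) by
   -C(x0) D(x0) and eliminating the cocircuit values by means of circuits meeting D in {x0, xj} gives
   the condition on cross ratios. Such circuits always exist, and C \<inter> D is never a singleton. *)

theory Submission
  imports Defs
begin

section \<open>Homomorphisms\<close>

text \<open>The degree map is not onto: in every degree the element coordinates add up to the
  circuit sum minus the cocircuit sum, so the unit vector of an element is never a degree. A section
  over the image alone would split off the inner Tutte group, but rescaling needs a scalar for each
  element, circuit and cocircuit, and a homomorphism from a subgroup of the degree group into the
  units need not extend. Hence \<open>w\<close> lives on the whole degree group, and the scalars are
  read off at the unit vectors. The value of \<open>w\<close> at an element cannot cancel its unit
  vector, only trade it for that of a representative, which has to be constant along circuits and
  cocircuits. The condition on cross ratios evaluates a homomorphism only inside the inner Tutte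
  group, so it survives restriction and extension. Agreement on a subgroup is evidently transitive;
  for \<open>cong_rel\<close> this is not clear from the definition, where representatives may
  change at each step.\<close>

lemma hom_eq_on_generate:
  assumes "group_hom G H f" "group_hom G H g" "A \<subseteq> carrier G" "\<And>a. a \<in> A \<Longrightarrow> f a = g a"
    and "t \<in> generate G A"
  shows "f t = g t"
proof -
  interpret f: group_hom G H f by fact
  interpret g: group_hom G H g by fact
  from assms(5) show ?thesis
  proof (induction rule: generate.induct)
    case (eng a b)
    then show ?case
      using f.G.generate_in_carrier[OF assms(3)] by simp
  qed (use assms(3,4) in auto)
qed

lemma hom_mult_pointwise:
  assumes "comm_group H" "f \<in> hom G H" "g \<in> hom G H"
  shows "(\<lambda>x. f x \<otimes>\<^bsub>H\<^esub> g x) \<in> hom G H"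
proof -
  interpret comm_group H by fact
  show ?thesis
    using assms(2,3) by (intro homI) (auto simp: hom_in_carrier hom_mult m_ac)
qed

lemma hom_inv_pointwise:
  assumes "comm_group H" "f \<in> hom G H"
  shows "(\<lambda>x. inv\<^bsub>H\<^esub> f x) \<in> hom G H"
proof -
  interpret comm_group H by fact
  show ?thesis
    using assms(2) by (intro homI) (auto simp: hom_in_carrier hom_mult inv_mult)
qed

lemma restrict_eq_iff:
  "restrict f A = restrict g A \<longleftrightarrow> (\<forall>t\<in>A. f t = g t)"
  by (metis restrict_apply' restrict_ext)

text \<open>Meant for the correspondences with hyperfield matroids and rescaling classes:
  \<open>A\<close> will be the homomorphisms on the extended Tutte group, \<open>f\<close> the
  restriction to a smaller Tutte group and \<open>g\<close> the passage to the class. Equal fibres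
  make \<open>h\<close> both well defined and injective.\<close>

lemma ex_bij_betw_common_cover:
  assumes "f ` A = B" "g ` A = C" "\<And>x y. x \<in> A \<Longrightarrow> y \<in> A \<Longrightarrow> f x = f y \<longleftrightarrow> g x = g y"
  shows "\<exists>h. bij_betw h B C \<and> (\<forall>x\<in>A. h (f x) = g x)"
proof (intro exI conjI ballI)
  define h where "h b = g (inv_into A f b)" for b
  show h: "h (f x) = g x" if "x \<in> A" for x
    unfolding h_def using assms(3) that inv_into_into[of "f x" f A] f_inv_into_f[of "f x" f A] by blast
  show "bij_betw h B C"
    unfolding bij_betw_def inj_on_def using h assms by (auto simp: image_iff)
qed

lemma free_Abelian_group_hom_diff:
  assumes "group_hom (free_Abelian_group S) U h" "Poly_Mapping.keys a \<subseteq> S" "Poly_Mapping.keys b \<subseteq> S"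
  shows "h (a - b) = h a \<otimes>\<^bsub>U\<^esub> inv\<^bsub>U\<^esub> h b"
proof -
  interpret group_hom "free_Abelian_group S" U h by fact
  have "h (a + - b) = h a \<otimes>\<^bsub>U\<^esub> inv\<^bsub>U\<^esub> h b"
    using hom_mult[of a "- b"] hom_inv[of b] assms(2,3) by (simp del: add_uminus_conv_diff)
  then show ?thesis by simp
qed

section \<open>Generators, relations and gradings of the Tutte groups\<close>

abbreviation free_tutte_group :: "'e indep_system \<Rightarrow> ('e tutte_gen \<Rightarrow>\<^sub>0 int) monoid" where
  "free_tutte_group M \<equiv> free_Abelian_group (tutte_gens M)"

lemma tutte_projection_hom:
  "(\<lambda>c. tutte_rel_subgroup M #>\<^bsub>free_tutte_group M\<^esub> c) \<in> hom (free_tutte_group M) (ext_tutte_group M)"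
  using normal.r_coset_hom_Mod[OF tutte_rel_subgroup_normal] by (simp add: ext_tutte_group_def)

lemma carrier_ext_tutte_group:
  "carrier (ext_tutte_group M)
     = (\<lambda>c. tutte_rel_subgroup M #>\<^bsub>free_tutte_group M\<^esub> c) ` carrier (free_tutte_group M)"
  by (simp add: ext_tutte_group_def carrier_FactGroup)

lemma group_hom_tutte_projection:
  "group_hom (free_tutte_group M) (ext_tutte_group M)
     (\<lambda>c. tutte_rel_subgroup M #>\<^bsub>free_tutte_group M\<^esub> c)"
  by (intro group_hom.intro group_hom_axioms.intro tutte_projection_hom group_free_Abelian_group
      comm_group.axioms(2) comm_group_ext_tutte_group)

lemma tutte_class_closed: "g \<in> tutte_gens M \<Longrightarrow> tutte_class M g \<in> carrier (ext_tutte_group M)"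
  by (auto simp: tutte_class_def carrier_ext_tutte_group)

lemma t_eps_closed: "t_eps M \<in> carrier (ext_tutte_group M)"
  by (intro tutte_class_closed) (simp add: tutte_gens_def)

lemma t_circ_closed: "C \<in> circuits M \<Longrightarrow> x \<in> C \<Longrightarrow> t_circ M C x \<in> carrier (ext_tutte_group M)"
  by (intro tutte_class_closed) (simp add: tutte_gens_def)

lemma t_cocirc_closed:
  "D \<in> cocircuits M \<Longrightarrow> x \<in> D \<Longrightarrow> t_cocirc M D x \<in> carrier (ext_tutte_group M)"
  by (intro tutte_class_closed) (simp add: tutte_gens_def)

lemmas tutte_closed = t_eps_closed t_circ_closed t_cocirc_closed

lemma ext_tutte_group_eq_generate:
  "carrier (ext_tutte_group M) = generate (ext_tutte_group M) (tutte_class M ` tutte_gens M)"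
proof
  interpret \<pi>: group_hom "free_tutte_group M" "ext_tutte_group M"
    "\<lambda>c. tutte_rel_subgroup M #>\<^bsub>free_tutte_group M\<^esub> c"
    by (rule group_hom_tutte_projection)
  have sub: "tutte_class M ` tutte_gens M \<subseteq> carrier (ext_tutte_group M)"
    using tutte_class_closed by blast
  show "generate (ext_tutte_group M) (tutte_class M ` tutte_gens M) \<subseteq> carrier (ext_tutte_group M)"
    using \<pi>.H.generate_incl[OF sub] .
  interpret S: subgroup "generate (ext_tutte_group M) (tutte_class M ` tutte_gens M)" "ext_tutte_group M"
    by (rule \<pi>.H.generate_is_subgroup[OF sub])
  have "tutte_rel_subgroup M #>\<^bsub>free_tutte_group M\<^esub> c
      \<in> generate (ext_tutte_group M) (tutte_class M ` tutte_gens M)"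
    if "Poly_Mapping.keys c \<subseteq> tutte_gens M" for c
    using that
  proof (induction rule: free_Abelian_group_induct[consumes 1, case_names zero diff one])
    case zero
    then show ?case
      using \<pi>.hom_one S.one_closed by simp
  next
    case (diff a b)
    then show ?case
      by (simp add: free_Abelian_group_hom_diff[OF \<pi>.group_hom_axioms])
  next
    case (one g)
    then show ?case
      by (auto simp flip: tutte_class_def intro: generate.incl)
  qed
  then show "carrier (ext_tutte_group M) \<subseteq> generate (ext_tutte_group M) (tutte_class M ` tutte_gens M)"
    by (auto simp: carrier_ext_tutte_group)
qed

lemma tutte_relation:
  assumes "C \<in> circuits M" "D \<in> cocircuits M" "C \<inter> D = {x, y}" "x \<noteq> y"
  shows "t_circ M C x \<otimes>\<^bsub>ext_tutte_group M\<^esub> t_cocirc M D x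
    = t_eps M \<otimes>\<^bsub>ext_tutte_group M\<^esub> t_circ M C y \<otimes>\<^bsub>ext_tutte_group M\<^esub> t_cocirc M D y"
proof -
  interpret \<pi>: group_hom "free_tutte_group M" "ext_tutte_group M"
    "\<lambda>c. tutte_rel_subgroup M #>\<^bsub>free_tutte_group M\<^esub> c"
    by (rule group_hom_tutte_projection)
  let ?a = "frag_of (Circ C x) + frag_of (Cocirc D x)"
  let ?b = "frag_of Epsilon + frag_of (Circ C y) + frag_of (Cocirc D y)"
  have gens: "{Epsilon, Circ C x, Circ C y, Cocirc D x, Cocirc D y} \<subseteq> tutte_gens M"
    using assms by (auto simp: tutte_gens_def)
  then have keys: "?a \<in> carrier (free_tutte_group M)" "?b \<in> carrier (free_tutte_group M)"
    "frag_of Epsilon + frag_of (Circ C y) \<in> carrier (free_tutte_group M)"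
    by (auto dest!: subsetD[OF keys_add])
  have "?a - ?b \<in> tutte_rels M"
    using assms by (auto simp: tutte_rels_def)
  then have "?a - ?b \<in> tutte_rel_subgroup M"
    by (auto simp: tutte_rel_subgroup_def intro: generate.incl)
  then have "tutte_rel_subgroup M #>\<^bsub>free_tutte_group M\<^esub> (?a - ?b) = \<one>\<^bsub>ext_tutte_group M\<^esub>"
    using subgroup.rcos_const[OF normal_imp_subgroup[OF tutte_rel_subgroup_normal]
        group_free_Abelian_group, of "?a - ?b" M]
    by (simp only: ext_tutte_group_def one_FactGroup)
  then have "tutte_rel_subgroup M #>\<^bsub>free_tutte_group M\<^esub> ?a
      = tutte_rel_subgroup M #>\<^bsub>free_tutte_group M\<^esub> ?b"
    using free_Abelian_group_hom_diff[OF \<pi>.group_hom_axioms, of ?a ?b] keys(1,2)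
      \<pi>.hom_closed[OF keys(1)] \<pi>.hom_closed[OF keys(2)]
    by (metis \<pi>.H.inv_solve_right' \<pi>.H.one_closed \<pi>.H.l_one carrier_free_Abelian_group_iff)
  then show ?thesis
    using gens keys \<pi>.hom_mult[of "frag_of (Circ C x)" "frag_of (Cocirc D x)"]
      \<pi>.hom_mult[of "frag_of Epsilon + frag_of (Circ C y)" "frag_of (Cocirc D y)"]
      \<pi>.hom_mult[of "frag_of Epsilon" "frag_of (Circ C y)"]
    by (simp add: tutte_class_def)
qed

text \<open>Universal property of the presentation: the linear extension of \<open>f\<close> to the
  free abelian group kills the relators, hence the subgroup they generate, and so factors through
  the quotient.\<close>

lemma ext_tutte_group_universal:
  assumes U: "comm_group U" and f: "\<And>g. g \<in> tutte_gens M \<Longrightarrow> f g \<in> carrier U"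
    and eps: "f Epsilon \<otimes>\<^bsub>U\<^esub> f Epsilon = \<one>\<^bsub>U\<^esub>"
    and rel: "\<And>C D x y. C \<in> circuits M \<Longrightarrow> D \<in> cocircuits M \<Longrightarrow> C \<inter> D = {x, y} \<Longrightarrow> x \<noteq> y \<Longrightarrow>
      f (Circ C x) \<otimes>\<^bsub>U\<^esub> f (Cocirc D x) = f Epsilon \<otimes>\<^bsub>U\<^esub> f (Circ C y) \<otimes>\<^bsub>U\<^esub> f (Cocirc D y)"
  obtains \<phi> where "\<phi> \<in> hom (ext_tutte_group M) U"
    "\<And>g. g \<in> tutte_gens M \<Longrightarrow> \<phi> (tutte_class M g) = f g"
proof -
  interpret U: comm_group U by fact
  obtain h where h: "h \<in> hom (free_tutte_group M) U"
    and hf: "\<And>g. g \<in> tutte_gens M \<Longrightarrow> h (frag_of g) = f g"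
    using U.free_Abelian_group_universal[of f "tutte_gens M"] f by blast
  interpret h: group_hom "free_tutte_group M" U h
    using h by (simp add: group_hom_def group_hom_axioms_def U.is_group)
  have "h r = \<one>\<^bsub>U\<^esub>" if r: "r \<in> tutte_rels M" for r
  proof -
    from r consider "r = frag_of Epsilon + frag_of Epsilon"
      | C D x y where "r = frag_of (Circ C x) + frag_of (Cocirc D x)
          - (frag_of Epsilon + frag_of (Circ C y) + frag_of (Cocirc D y))"
          "C \<in> circuits M" "D \<in> cocircuits M" "C \<inter> D = {x, y}" "x \<noteq> y"
      by (auto simp: tutte_rels_def)
    then show ?thesis
    proof cases
      case 1
      have "Epsilon \<in> tutte_gens M" by (simp add: tutte_gens_def)
      then show ?thesis
        using 1 eps hf h.hom_mult[of "frag_of Epsilon" "frag_of Epsilon"] by simp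
    next
      case 2
      let ?a = "frag_of (Circ C x) + frag_of (Cocirc D x)"
      let ?b = "frag_of Epsilon + frag_of (Circ C y) + frag_of (Cocirc D y)"
      have gens: "{Epsilon, Circ C x, Circ C y, Cocirc D x, Cocirc D y} \<subseteq> tutte_gens M"
        using 2 by (auto simp: tutte_gens_def)
      then have keys: "Poly_Mapping.keys ?a \<subseteq> tutte_gens M" "Poly_Mapping.keys ?b \<subseteq> tutte_gens M"
        "Poly_Mapping.keys (frag_of Epsilon + frag_of (Circ C y)) \<subseteq> tutte_gens M"
        by (auto dest!: subsetD[OF keys_add])
      have "h ?a = f (Circ C x) \<otimes>\<^bsub>U\<^esub> f (Cocirc D x)"
        using gens hf h.hom_mult[of "frag_of (Circ C x)" "frag_of (Cocirc D x)"] by simp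
      moreover have "h ?b = f Epsilon \<otimes>\<^bsub>U\<^esub> f (Circ C y) \<otimes>\<^bsub>U\<^esub> f (Cocirc D y)"
        using gens keys hf h.hom_mult[of "frag_of Epsilon" "frag_of (Circ C y)"]
          h.hom_mult[of "frag_of Epsilon + frag_of (Circ C y)" "frag_of (Cocirc D y)"] by simp
      ultimately have "h ?a = h ?b" using rel[OF 2(2-5)] by simp
      moreover have "h r = h ?a \<otimes>\<^bsub>U\<^esub> inv\<^bsub>U\<^esub> h ?b"
        unfolding 2(1) by (rule free_Abelian_group_hom_diff[OF h.group_hom_axioms keys(1,2)])
      moreover have "h ?b \<in> carrier U"
        using keys by (intro h.hom_closed) simp
      ultimately show ?thesis by simp
    qed
  qed
  then have "tutte_rels M \<subseteq> kernel (free_tutte_group M) U h"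
    using tutte_rels_subset by (auto simp: kernel_def subset_iff)
  then have "tutte_rel_subgroup M \<subseteq> kernel (free_tutte_group M) U h"
    unfolding tutte_rel_subgroup_def
    by (intro h.G.generate_subgroup_incl h.subgroup_kernel)
  then obtain \<phi> where "\<phi> \<in> hom (free_tutte_group M Mod tutte_rel_subgroup M) U"
    "\<And>c. c \<in> carrier (free_tutte_group M) \<Longrightarrow> \<phi> (tutte_rel_subgroup M #>\<^bsub>free_tutte_group M\<^esub> c) = h c"
    using h.FactGroup_universal_kernel[OF tutte_rel_subgroup_normal] by blast
  then show ?thesis
    using that[of \<phi>] hf by (simp add: ext_tutte_group_def tutte_class_def)
qed

lemma ext_tutte_hom_eqI:
  assumes "group U" "\<phi> \<in> hom (ext_tutte_group M) U" "\<psi> \<in> hom (ext_tutte_group M) U"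
    and "\<phi> (t_eps M) = \<psi> (t_eps M)"
    and "\<And>C x. C \<in> circuits M \<Longrightarrow> x \<in> C \<Longrightarrow> \<phi> (t_circ M C x) = \<psi> (t_circ M C x)"
    and "\<And>D y. D \<in> cocircuits M \<Longrightarrow> y \<in> D \<Longrightarrow> \<phi> (t_cocirc M D y) = \<psi> (t_cocirc M D y)"
    and "t \<in> carrier (ext_tutte_group M)"
  shows "\<phi> t = \<psi> t"
proof (rule hom_eq_on_generate[where f = \<phi> and g = \<psi> and t = t])
  show "group_hom (ext_tutte_group M) U \<phi>" "group_hom (ext_tutte_group M) U \<psi>"
    using assms(1-3) comm_group_ext_tutte_group
    by (auto simp: group_hom_def group_hom_axioms_def comm_group_def)
  show "t \<in> generate (ext_tutte_group M) (tutte_class M ` tutte_gens M)"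
    using assms(7) ext_tutte_group_eq_generate by blast
qed (use assms in \<open>auto simp: tutte_gens_def tutte_closed\<close>)

section \<open>The degree homomorphism and the two smaller Tutte groups\<close>

lemma group_hom_tutte_degree: "group_hom (ext_tutte_group M) (degree_group M) tutte_degree"
  using comm_group_ext_tutte_group tutte_degree_hom
  by (auto simp: group_hom_def group_hom_axioms_def comm_group_def degree_group_def)

lemma carrier_inner_tutte_group:
  "carrier (inner_tutte_group M) = {t \<in> carrier (ext_tutte_group M). tutte_degree t = 0}"
  by (simp add: inner_tutte_group_def kernel_def degree_group_def)

lemma t_eps_inner: "t_eps M \<in> carrier (inner_tutte_group M)"
  by (simp add: carrier_inner_tutte_group t_eps_closed tutte_degree_gen)

lemma tutte_degree_mult:
  "t \<in> carrier (ext_tutte_group M) \<Longrightarrow> u \<in> carrier (ext_tutte_group M) \<Longrightarrow>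
    tutte_degree (t \<otimes>\<^bsub>ext_tutte_group M\<^esub> u) = tutte_degree t + tutte_degree u"
  using group_hom.hom_mult[OF group_hom_tutte_degree, of t M u] by (simp add: degree_group_def)

lemma tutte_degree_keys:
  "t \<in> carrier (ext_tutte_group M) \<Longrightarrow>
    Poly_Mapping.keys (tutte_degree t) \<subseteq> ground M <+> (circuits M <+> cocircuits M)"
  using group_hom.hom_closed[OF group_hom_tutte_degree, of t M] by (simp add: degree_group_def)

lemma tutte_degree_inv:
  assumes "t \<in> carrier (ext_tutte_group M)"
  shows "tutte_degree (inv\<^bsub>ext_tutte_group M\<^esub> t) = - tutte_degree t"
  using group_hom.hom_inv[OF group_hom_tutte_degree assms] tutte_degree_keys[OF assms]
  by (simp add: degree_group_def)

text \<open>Numerator and denominator have the same degree, with coordinate vectors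
  \<open>x\<close>, \<open>y\<close>, \<open>C\<close> and \<open>C'\<close> each counted once. This
  is why \<open>tutte_condition\<close> makes sense on all three groups.\<close>

lemma cross_ratio_inner:
  assumes "C \<in> circuits M" "C' \<in> circuits M" "x \<in> C \<inter> C'" "y \<in> C \<inter> C'"
  shows "(t_circ M C x \<otimes>\<^bsub>ext_tutte_group M\<^esub> t_circ M C' y) \<otimes>\<^bsub>ext_tutte_group M\<^esub>
      inv\<^bsub>ext_tutte_group M\<^esub> (t_circ M C y \<otimes>\<^bsub>ext_tutte_group M\<^esub> t_circ M C' x)
    \<in> carrier (inner_tutte_group M)"
proof -
  interpret T: comm_group "ext_tutte_group M" by (rule comm_group_ext_tutte_group)
  show ?thesis
    using assms by (simp add: carrier_inner_tutte_group tutte_degree_mult tutte_degree_inv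
        tutte_degree_gen tutte_closed)
qed

definition tutte_group_gens where
  "tutte_group_gens M = {t_eps M}
      \<union> {t_circ M C x \<otimes>\<^bsub>ext_tutte_group M\<^esub> inv\<^bsub>ext_tutte_group M\<^esub> t_circ M C y |C x y.
           C \<in> circuits M \<and> x \<in> C \<and> y \<in> C}
      \<union> {t_cocirc M D x \<otimes>\<^bsub>ext_tutte_group M\<^esub> inv\<^bsub>ext_tutte_group M\<^esub> t_cocirc M D y |D x y.
           D \<in> cocircuits M \<and> x \<in> D \<and> y \<in> D}"

lemma carrier_tutte_group: "carrier (tutte_group M) = generate (ext_tutte_group M) (tutte_group_gens M)"
  by (simp add: tutte_group_def tutte_group_gens_def)

lemma tutte_group_gens_subset: "tutte_group_gens M \<subseteq> carrier (ext_tutte_group M)"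
proof -
  interpret T: comm_group "ext_tutte_group M" by (rule comm_group_ext_tutte_group)
  show ?thesis
    by (auto simp: tutte_group_gens_def tutte_closed)
qed

lemma subgroup_tutte_group: "subgroup (carrier (tutte_group M)) (ext_tutte_group M)"
  unfolding carrier_tutte_group
  by (intro group.generate_is_subgroup tutte_group_gens_subset comm_group.axioms(2)
      comm_group_ext_tutte_group)

lemma subgroup_inner_tutte_group: "subgroup (carrier (inner_tutte_group M)) (ext_tutte_group M)"
  using group_hom.subgroup_kernel[OF group_hom_tutte_degree] by (simp add: inner_tutte_group_def)

lemma ext_hom_into_subgroup:
  assumes "\<pi> \<in> hom (ext_tutte_group M) (ext_tutte_group M)" "subgroup S (ext_tutte_group M)"
    and "\<And>g. g \<in> tutte_gens M \<Longrightarrow> \<pi> (tutte_class M g) \<in> S"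
    and "t \<in> carrier (ext_tutte_group M)"
  shows "\<pi> t \<in> S"
proof -
  interpret T: comm_group "ext_tutte_group M" by (rule comm_group_ext_tutte_group)
  interpret \<pi>: group_hom "ext_tutte_group M" "ext_tutte_group M" \<pi>
    using assms(1) by unfold_locales
  have "\<pi> ` carrier (ext_tutte_group M) = generate (ext_tutte_group M) (\<pi> ` tutte_class M ` tutte_gens M)"
    unfolding ext_tutte_group_eq_generate
    by (rule \<pi>.generate_img[symmetric]) (use tutte_class_closed in blast)
  also have "\<dots> \<subseteq> S"
    using assms(2,3) by (intro T.generate_subgroup_incl) auto
  finally show ?thesis using assms(4) by blast
qed

section \<open>Homomorphisms that agree on a Tutte group\<close>

definition tutte_shift where
  "tutte_shift M w t = t \<otimes>\<^bsub>ext_tutte_group M\<^esub> w (tutte_degree t)"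

lemma tutte_degree_pullback:
  "\<chi> \<in> hom (degree_group M) U \<Longrightarrow> (\<lambda>t. \<chi> (tutte_degree t)) \<in> hom (ext_tutte_group M) U"
  using hom_compose[OF tutte_degree_hom, of \<chi> M U] by (simp add: comp_def)

lemma tutte_shift_hom:
  assumes "w \<in> hom (degree_group M) (ext_tutte_group M)"
  shows "tutte_shift M w \<in> hom (ext_tutte_group M) (ext_tutte_group M)"
  unfolding tutte_shift_def[abs_def]
  by (intro hom_mult_pointwise comm_group_ext_tutte_group tutte_degree_pullback assms)
    (auto intro: homI)

lemma hom_degree_zero:
  assumes "\<chi> \<in> hom (degree_group M) U" "group U"
  shows "\<chi> 0 = \<one>\<^bsub>U\<^esub>"
proof -
  interpret group_hom "degree_group M" U \<chi>
    using assms by (simp add: group_hom_def group_hom_axioms_def degree_group_def)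
  show ?thesis using hom_one by (simp add: degree_group_def)
qed

lemma degree_group_universal:
  assumes "comm_group U" "\<And>x. x \<in> ground M \<Longrightarrow> a x \<in> carrier U"
    "\<And>C. C \<in> circuits M \<Longrightarrow> b C \<in> carrier U" "\<And>D. D \<in> cocircuits M \<Longrightarrow> c D \<in> carrier U"
  obtains \<chi> where "\<chi> \<in> hom (degree_group M) U"
    "\<And>x. x \<in> ground M \<Longrightarrow> \<chi> (frag_of (Inl x)) = a x"
    "\<And>C. C \<in> circuits M \<Longrightarrow> \<chi> (frag_of (Inr (Inl C))) = b C"
    "\<And>D. D \<in> cocircuits M \<Longrightarrow> \<chi> (frag_of (Inr (Inr D))) = c D"
proof -
  interpret comm_group U by fact
  let ?f = "case_sum a (case_sum b c)"
  have "?f ` (ground M <+> (circuits M <+> cocircuits M)) \<subseteq> carrier U"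
    using assms(2-4) by auto
  then obtain \<chi> where "\<chi> \<in> hom (degree_group M) U"
    "\<And>i. i \<in> ground M <+> (circuits M <+> cocircuits M) \<Longrightarrow> \<chi> (frag_of i) = ?f i"
    unfolding degree_group_def by (rule free_Abelian_group_universal) blast
  then show ?thesis by (intro that) (auto simp: InlI InrI)
qed

lemma hom_degree_circ:
  assumes "\<chi> \<in> hom (degree_group M) U" "C \<in> circuits M" "x \<in> C"
  shows "\<chi> (tutte_degree (t_circ M C x)) = \<chi> (frag_of (Inl x)) \<otimes>\<^bsub>U\<^esub> \<chi> (frag_of (Inr (Inl C)))"
proof -
  have "x \<in> ground M" using assms circuits_subset_ground by blast
  then show ?thesis
    using hom_mult[OF assms(1), of "frag_of (Inl x)" "frag_of (Inr (Inl C))"] assms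
    by (simp add: tutte_degree_gen degree_group_def InlI InrI)
qed

lemma hom_degree_cocirc:
  assumes "\<chi> \<in> hom (degree_group M) U" "group U" "D \<in> cocircuits M" "y \<in> D"
  shows "\<chi> (tutte_degree (t_cocirc M D y))
    = inv\<^bsub>U\<^esub> \<chi> (frag_of (Inl y)) \<otimes>\<^bsub>U\<^esub> \<chi> (frag_of (Inr (Inr D)))"
proof -
  interpret group_hom "degree_group M" U \<chi>
    using assms by (simp add: group_hom_def group_hom_axioms_def degree_group_def)
  have "y \<in> ground M" using assms cocircuits_subset_ground by blast
  then show ?thesis
    using hom_mult[of "- frag_of (Inl y)" "frag_of (Inr (Inr D))"] hom_inv[of "frag_of (Inl y)"] assms
    by (simp add: tutte_degree_gen degree_group_def InlI InrI)
qed

lemma hom_degree_frag_closed: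
  assumes "\<chi> \<in> hom (degree_group M) U"
  shows "x \<in> ground M \<Longrightarrow> \<chi> (frag_of (Inl x)) \<in> carrier U"
    "C \<in> circuits M \<Longrightarrow> \<chi> (frag_of (Inr (Inl C))) \<in> carrier U"
    "D \<in> cocircuits M \<Longrightarrow> \<chi> (frag_of (Inr (Inr D))) \<in> carrier U"
  by (rule hom_in_carrier[OF assms]; simp add: degree_group_def InlI InrI)+

text \<open>When \<chi> ignores elements, its value at the degree of \<open>t_circ M C x\<close> or
  \<open>t_cocirc M D x\<close> no longer depends on \<open>x\<close>. It therefore cancels in the
  quotients that generate the Tutte group, and \<epsilon> has degree zero.\<close>

lemma hom_degree_trivial_on_tutte_group:
  assumes U: "group U" and \<chi>: "\<chi> \<in> hom (degree_group M) U"
    and triv: "\<And>x. x \<in> ground M \<Longrightarrow> \<chi> (frag_of (Inl x)) = \<one>\<^bsub>U\<^esub>"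
    and t: "t \<in> carrier (tutte_group M)"
  shows "\<chi> (tutte_degree t) = \<one>\<^bsub>U\<^esub>"
proof -
  interpret T: comm_group "ext_tutte_group M" by (rule comm_group_ext_tutte_group)
  interpret U: group U by fact
  define \<phi> where "\<phi> t = \<chi> (tutte_degree t)" for t
  interpret \<phi>: group_hom "ext_tutte_group M" U \<phi>
    unfolding \<phi>_def[abs_def] by unfold_locales (rule tutte_degree_pullback[OF \<chi>])
  have circ: "\<phi> (t_circ M C x) = \<chi> (frag_of (Inr (Inl C)))" if "C \<in> circuits M" "x \<in> C" for C x
    using that circuits_subset_ground[of C M] hom_degree_frag_closed[OF \<chi>]
    by (auto simp: \<phi>_def hom_degree_circ[OF \<chi>] triv)
  have cocirc: "\<phi> (t_cocirc M D y) = \<chi> (frag_of (Inr (Inr D)))" if "D \<in> cocircuits M" "y \<in> D" for D y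
    using that cocircuits_subset_ground[of D M] hom_degree_frag_closed[OF \<chi>]
    by (auto simp: \<phi>_def hom_degree_cocirc[OF \<chi> U] triv)
  have "tutte_group_gens M \<subseteq> kernel (ext_tutte_group M) U \<phi>"
    using hom_degree_frag_closed[OF \<chi>] hom_degree_zero[OF \<chi> U]
    by (auto simp: tutte_group_gens_def kernel_def tutte_closed circ cocirc)
      (simp add: \<phi>_def tutte_degree_gen)
  then have "carrier (tutte_group M) \<subseteq> kernel (ext_tutte_group M) U \<phi>"
    unfolding carrier_tutte_group by (intro T.generate_subgroup_incl \<phi>.subgroup_kernel)
  then show ?thesis using t by (auto simp: kernel_def \<phi>_def)
qed

section \<open>Retractions onto the Tutte group and the inner Tutte group\<close>

lemma tutte_shift_inner:
  assumes "w \<in> hom (degree_group M) (ext_tutte_group M)" "t \<in> carrier (inner_tutte_group M)"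
  shows "tutte_shift M w t = t"
proof -
  interpret T: comm_group "ext_tutte_group M" by (rule comm_group_ext_tutte_group)
  show ?thesis
    using assms by (simp add: tutte_shift_def carrier_inner_tutte_group hom_degree_zero)
qed

text \<open>Choose a point \<open>r A\<close> in each circuit and cocircuit, possible since none is
  empty, and let \<open>w\<close> divide by the generator at that point: the shift then turns every
  circuit or cocircuit generator into one of the quotients generating the Tutte group. That
  \<open>w\<close> is trivial on elements is recorded because it makes the shift fix the Tutte group
  pointwise.\<close>

lemma tutte_group_shift:
  assumes "{} \<notin> circuits M" "{} \<notin> cocircuits M"
  obtains w where "w \<in> hom (degree_group M) (ext_tutte_group M)"
    "\<And>x. x \<in> ground M \<Longrightarrow> w (frag_of (Inl x)) = \<one>\<^bsub>ext_tutte_group M\<^esub>"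
    "\<And>t. t \<in> carrier (ext_tutte_group M) \<Longrightarrow> tutte_shift M w t \<in> carrier (tutte_group M)"
proof -
  interpret T: comm_group "ext_tutte_group M" by (rule comm_group_ext_tutte_group)
  define r where "r A = (SOME x. x \<in> A)" for A :: "'a set"
  have r: "r A \<in> A" if "A \<in> circuits M \<or> A \<in> cocircuits M" for A
    using that assms some_in_eq[of A] by (auto simp: r_def)
  obtain w where w: "w \<in> hom (degree_group M) (ext_tutte_group M)"
    "\<And>x. x \<in> ground M \<Longrightarrow> w (frag_of (Inl x)) = \<one>\<^bsub>ext_tutte_group M\<^esub>"
    "\<And>C. C \<in> circuits M \<Longrightarrow> w (frag_of (Inr (Inl C))) = inv\<^bsub>ext_tutte_group M\<^esub> t_circ M C (r C)"
    "\<And>D. D \<in> cocircuits M \<Longrightarrow> w (frag_of (Inr (Inr D))) = inv\<^bsub>ext_tutte_group M\<^esub> t_cocirc M D (r D)"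
    using degree_group_universal[OF comm_group_ext_tutte_group[of M], where M = M
        and a = "\<lambda>_. \<one>\<^bsub>ext_tutte_group M\<^esub>"
        and b = "\<lambda>C. inv\<^bsub>ext_tutte_group M\<^esub> t_circ M C (r C)"
        and c = "\<lambda>D. inv\<^bsub>ext_tutte_group M\<^esub> t_cocirc M D (r D)"] r
    by (auto simp: tutte_closed)
  show ?thesis
  proof (rule that[OF w(1,2)])
    fix t
    assume t: "t \<in> carrier (ext_tutte_group M)"
    show "tutte_shift M w t \<in> carrier (tutte_group M)"
    proof (rule ext_hom_into_subgroup[OF tutte_shift_hom[OF w(1)] subgroup_tutte_group _ t])
      fix g
      assume "g \<in> tutte_gens M"
      then consider "g = Epsilon" | C x where "g = Circ C x" "C \<in> circuits M" "x \<in> C"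
        | D y where "g = Cocirc D y" "D \<in> cocircuits M" "y \<in> D"
        by (auto simp: tutte_gens_def)
      then have "tutte_shift M w (tutte_class M g) \<in> tutte_group_gens M"
      proof cases
        case 1
        then show ?thesis
          using tutte_shift_inner[OF w(1) t_eps_inner] by (simp add: tutte_group_gens_def)
      next
        case 2
        then have "x \<in> ground M" using circuits_subset_ground by blast
        then have "tutte_shift M w (tutte_class M g)
            = t_circ M C x \<otimes>\<^bsub>ext_tutte_group M\<^esub> inv\<^bsub>ext_tutte_group M\<^esub> t_circ M C (r C)"
          using 2 r[of C] by (simp add: tutte_shift_def hom_degree_circ[OF w(1)] w tutte_closed)
        then show ?thesis
          unfolding tutte_group_gens_def using 2 r[of C] by blast
      next
        case 3
        then have "y \<in> ground M" using cocircuits_subset_ground by blast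
        then have "tutte_shift M w (tutte_class M g)
            = t_cocirc M D y \<otimes>\<^bsub>ext_tutte_group M\<^esub> inv\<^bsub>ext_tutte_group M\<^esub> t_cocirc M D (r D)"
          using 3 r[of D] by (simp add: tutte_shift_def hom_degree_cocirc[OF w(1)] w tutte_closed)
        then show ?thesis
          unfolding tutte_group_gens_def using 3 r[of D] by blast
      qed
      then show "tutte_shift M w (tutte_class M g) \<in> carrier (tutte_group M)"
        unfolding carrier_tutte_group by (rule generate.incl)
    qed
  qed
qed

text \<open>Call two elements of the ground set linked if the difference of their unit vectors is a
  degree. All elements of a circuit, and all elements of a cocircuit, are linked. The shift
  corrects every generator by a path to a chosen representative of its linkage class.\<close>

lemma inner_tutte_group_shift:
  assumes "{} \<notin> circuits M" "{} \<notin> cocircuits M"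
  obtains w where "w \<in> hom (degree_group M) (ext_tutte_group M)"
    "\<And>t. t \<in> carrier (ext_tutte_group M) \<Longrightarrow> tutte_shift M w t \<in> carrier (inner_tutte_group M)"
proof -
  let ?T = "ext_tutte_group M"
  interpret T: comm_group ?T by (rule comm_group_ext_tutte_group)
  define r where "r A = (SOME x. x \<in> A)" for A :: "'a set"
  have r: "r A \<in> A" if "A \<in> circuits M \<or> A \<in> cocircuits M" for A
    using that assms some_in_eq[of A] by (auto simp: r_def)
  define linked where
    "linked x y \<longleftrightarrow> (\<exists>t\<in>carrier ?T. tutte_degree t = frag_of (Inl x) - frag_of (Inl y))" for x y
  have linked_trans: "linked x z" if "linked x y" "linked y z" for x y z
  proof -
    from that obtain t u where "t \<in> carrier ?T" "u \<in> carrier ?T"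
      "tutte_degree t = frag_of (Inl x) - frag_of (Inl y)"
      "tutte_degree u = frag_of (Inl y) - frag_of (Inl z)"
      by (auto simp: linked_def)
    then show ?thesis
      unfolding linked_def
      by (intro bexI[of _ "t \<otimes>\<^bsub>?T\<^esub> u"]) (simp_all add: tutte_degree_mult)
  qed
  have linked_sym: "linked y x" if xy: "linked x y" for x y
  proof -
    from xy obtain t where "t \<in> carrier ?T" "tutte_degree t = frag_of (Inl x) - frag_of (Inl y)"
      by (auto simp: linked_def)
    then show ?thesis
      unfolding linked_def
      by (intro bexI[of _ "inv\<^bsub>?T\<^esub> t"]) (simp_all add: tutte_degree_inv)
  qed
  have linked_refl: "linked x x" for x
    unfolding linked_def
    using group_hom.hom_one[OF group_hom_tutte_degree, of M]
    by (intro bexI[of _ "\<one>\<^bsub>?T\<^esub>"]) (simp_all add: degree_group_def)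
  have linked_circ: "linked x y" if "C \<in> circuits M" "x \<in> C" "y \<in> C" for C x y
    unfolding linked_def using that
    by (intro bexI[of _ "t_circ M C x \<otimes>\<^bsub>?T\<^esub> inv\<^bsub>?T\<^esub> t_circ M C y"])
      (simp_all add: tutte_degree_mult tutte_degree_inv tutte_degree_gen tutte_closed)
  \<comment> \<open>Here the quotient is taken in the opposite order, since the degree of
    \<open>t_cocirc M D y\<close> contains the unit vector of \<open>y\<close> with sign -1.\<close>
  have linked_cocirc: "linked x y" if "D \<in> cocircuits M" "x \<in> D" "y \<in> D" for D x y
    unfolding linked_def using that
    by (intro bexI[of _ "t_cocirc M D y \<otimes>\<^bsub>?T\<^esub> inv\<^bsub>?T\<^esub> t_cocirc M D x"])
      (simp_all add: tutte_degree_mult tutte_degree_inv tutte_degree_gen tutte_closed)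
  define root where "root x = (SOME y. linked x y)" for x
  have root: "linked x (root x)" for x
    unfolding root_def by (rule someI[of _ x]) (rule linked_refl)
  have root_eq: "root x = root y" if xy: "linked x y" for x y
  proof -
    \<comment> \<open>\<open>SOME\<close> depends only on the predicate \<open>linked x\<close>.
      Linked elements have equal predicates, hence the same root.\<close>
    have "linked x = linked y" using linked_trans linked_sym xy by blast
    then show ?thesis by (simp add: root_def)
  qed
  define p where "p x = (SOME t. t \<in> carrier ?T \<and>
      tutte_degree t = frag_of (Inl x) - frag_of (Inl (root x)))" for x
  have "p x \<in> carrier ?T \<and> tutte_degree (p x) = frag_of (Inl x) - frag_of (Inl (root x))" for x
    unfolding p_def by (rule someI_ex) (use root[of x] in \<open>auto simp: linked_def\<close>)
  then have p: "p x \<in> carrier ?T"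
    and deg_p: "tutte_degree (p x) = frag_of (Inl x) - frag_of (Inl (root x))" for x by auto
  \<comment> \<open>\<open>w\<close> trades an element for its root, by dividing by
    \<open>p x\<close>. The value at \<open>C\<close> has to undo the unit vectors of
    \<open>C\<close> and of \<open>r C\<close> in the degree of \<open>t_circ M C (r C)\<close>, and
    \<open>p (r C)\<close> puts back the difference between \<open>r C\<close> and its root. For
    cocircuits this factor is inverted because elements enter their degrees with sign -1.\<close>
  obtain w where w: "w \<in> hom (degree_group M) ?T"
    "\<And>x. x \<in> ground M \<Longrightarrow> w (frag_of (Inl x)) = inv\<^bsub>?T\<^esub> p x"
    "\<And>C. C \<in> circuits M \<Longrightarrow> w (frag_of (Inr (Inl C))) = inv\<^bsub>?T\<^esub> t_circ M C (r C) \<otimes>\<^bsub>?T\<^esub> p (r C)"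
    "\<And>D. D \<in> cocircuits M \<Longrightarrow>
      w (frag_of (Inr (Inr D))) = inv\<^bsub>?T\<^esub> t_cocirc M D (r D) \<otimes>\<^bsub>?T\<^esub> inv\<^bsub>?T\<^esub> p (r D)"
    using degree_group_universal[OF comm_group_ext_tutte_group[of M], where M = M
        and a = "\<lambda>x. inv\<^bsub>?T\<^esub> p x"
        and b = "\<lambda>C. inv\<^bsub>?T\<^esub> t_circ M C (r C) \<otimes>\<^bsub>?T\<^esub> p (r C)"
        and c = "\<lambda>D. inv\<^bsub>?T\<^esub> t_cocirc M D (r D) \<otimes>\<^bsub>?T\<^esub> inv\<^bsub>?T\<^esub> p (r D)"] r
    by (auto simp: tutte_closed p)
  show ?thesis
  proof (rule that[OF w(1)])
    fix t
    assume t: "t \<in> carrier ?T"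
    show "tutte_shift M w t \<in> carrier (inner_tutte_group M)"
    proof (rule ext_hom_into_subgroup[OF tutte_shift_hom[OF w(1)] subgroup_inner_tutte_group _ t])
      fix g
      assume "g \<in> tutte_gens M"
      then consider "g = Epsilon" | C x where "g = Circ C x" "C \<in> circuits M" "x \<in> C"
        | D y where "g = Cocirc D y" "D \<in> cocircuits M" "y \<in> D"
        by (auto simp: tutte_gens_def)
      then show "tutte_shift M w (tutte_class M g) \<in> carrier (inner_tutte_group M)"
      proof cases
        case 1
        then show ?thesis
          using tutte_shift_inner[OF w(1) t_eps_inner] t_eps_inner by simp
      next
        case 2
        then have "x \<in> ground M" using circuits_subset_ground by blast
        \<comment> \<open>In the degree of the shifted generator only the unit vectors of
          \<open>root x\<close> and \<open>root (r C)\<close> survive, with opposite signs.\<close>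
        moreover have "root x = root (r C)"
          using 2 r[of C] by (intro root_eq linked_circ) auto
        moreover have "tutte_shift M w (tutte_class M g)
            = t_circ M C x \<otimes>\<^bsub>?T\<^esub> (inv\<^bsub>?T\<^esub> p x \<otimes>\<^bsub>?T\<^esub> (inv\<^bsub>?T\<^esub> t_circ M C (r C) \<otimes>\<^bsub>?T\<^esub> p (r C)))"
          using 2 \<open>x \<in> ground M\<close> by (simp add: tutte_shift_def hom_degree_circ[OF w(1)] w)
        ultimately show ?thesis
          using 2 r[of C]
          by (simp add: tutte_closed p
              carrier_inner_tutte_group tutte_degree_mult tutte_degree_inv deg_p tutte_degree_gen)
      next
        case 3
        then have "y \<in> ground M" using cocircuits_subset_ground by blast
        moreover have "root y = root (r D)"
          using 3 r[of D] by (intro root_eq linked_cocirc) auto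
        moreover have "tutte_shift M w (tutte_class M g)
            = t_cocirc M D y \<otimes>\<^bsub>?T\<^esub>
              (p y \<otimes>\<^bsub>?T\<^esub> (inv\<^bsub>?T\<^esub> t_cocirc M D (r D) \<otimes>\<^bsub>?T\<^esub> inv\<^bsub>?T\<^esub> p (r D)))"
          using 3 \<open>y \<in> ground M\<close> p by (simp add: tutte_shift_def hom_degree_cocirc[OF w(1)] w)
        ultimately show ?thesis
          using 3 r[of D]
          by (simp add: tutte_closed p
              carrier_inner_tutte_group tutte_degree_mult tutte_degree_inv deg_p tutte_degree_gen)
      qed
    qed
  qed
qed

lemma tutte_shift_tutte_group:
  assumes "w \<in> hom (degree_group M) (ext_tutte_group M)"
    and "\<And>x. x \<in> ground M \<Longrightarrow> w (frag_of (Inl x)) = \<one>\<^bsub>ext_tutte_group M\<^esub>"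
    and "t \<in> carrier (tutte_group M)"
  shows "tutte_shift M w t = t"
proof -
  interpret T: comm_group "ext_tutte_group M" by (rule comm_group_ext_tutte_group)
  have "t \<in> carrier (ext_tutte_group M)"
    using assms(3) subgroup.subset[OF subgroup_tutte_group] by blast
  then show ?thesis
    using hom_degree_trivial_on_tutte_group[OF T.is_group assms] by (simp add: tutte_shift_def)
qed

text \<open>The shift into the Tutte group fixes every element of degree zero, so such an element is
  its own image and lies in the Tutte group.\<close>

lemma inner_subset_tutte_group:
  assumes "{} \<notin> circuits M" "{} \<notin> cocircuits M"
  shows "carrier (inner_tutte_group M) \<subseteq> carrier (tutte_group M)"
proof
  fix t
  assume t: "t \<in> carrier (inner_tutte_group M)"
  obtain w where w: "w \<in> hom (degree_group M) (ext_tutte_group M)"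
    "\<And>t. t \<in> carrier (ext_tutte_group M) \<Longrightarrow> tutte_shift M w t \<in> carrier (tutte_group M)"
    using tutte_group_shift[OF assms] by metis
  then show "t \<in> carrier (tutte_group M)"
    using tutte_shift_inner[OF w(1) t] w(2)[of t] t by (simp add: carrier_inner_tutte_group)
qed

text \<open>Each \<open>t\<close> is the quotient of \<open>tutte_shift M w t\<close> by
  \<open>w (tutte_degree t)\<close>. The two homomorphisms agree on the first factor, so their ratio
  at \<open>t\<close> depends only on the degree. As \<open>w\<close> accepts arbitrary degree
  vectors, so does \<chi>, including the unit vectors that are not degrees of any
  \<open>t\<close>.\<close>

lemma hom_differ_by_degree:
  assumes U: "comm_group U"
    and \<Phi>: "\<Phi> \<in> hom (ext_tutte_group M) U" and \<Psi>: "\<Psi> \<in> hom (ext_tutte_group M) U"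
    and w: "w \<in> hom (degree_group M) (ext_tutte_group M)"
    and eq: "\<And>t. t \<in> carrier (ext_tutte_group M) \<Longrightarrow> \<Phi> (tutte_shift M w t) = \<Psi> (tutte_shift M w t)"
  defines "\<chi> \<equiv> \<lambda>d. \<Psi> (w d) \<otimes>\<^bsub>U\<^esub> inv\<^bsub>U\<^esub> \<Phi> (w d)"
  shows "\<chi> \<in> hom (degree_group M) U"
    and "t \<in> carrier (ext_tutte_group M) \<Longrightarrow> \<Phi> t = \<Psi> t \<otimes>\<^bsub>U\<^esub> \<chi> (tutte_degree t)"
proof -
  interpret U: comm_group U by fact
  interpret T: comm_group "ext_tutte_group M" by (rule comm_group_ext_tutte_group)
  show "\<chi> \<in> hom (degree_group M) U"
    unfolding \<chi>_def
    using hom_compose[OF w \<Phi>] hom_compose[OF w \<Psi>]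
    by (intro hom_mult_pointwise hom_inv_pointwise U) (simp_all add: comp_def)
  assume t: "t \<in> carrier (ext_tutte_group M)"
  let ?d = "w (tutte_degree t)"
  have d: "?d \<in> carrier (ext_tutte_group M)"
    using hom_in_carrier[OF tutte_degree_pullback[OF w] t] .
  have "\<Phi> t \<otimes>\<^bsub>U\<^esub> \<Phi> ?d = \<Psi> t \<otimes>\<^bsub>U\<^esub> \<Psi> ?d"
    using eq[OF t] by (simp add: tutte_shift_def hom_mult[OF \<Phi>] hom_mult[OF \<Psi>] t d)
  moreover have "\<Phi> t \<in> carrier U" "\<Phi> ?d \<in> carrier U" "\<Psi> t \<in> carrier U" "\<Psi> ?d \<in> carrier U"
    using t d \<Phi> \<Psi> by (auto intro: hom_in_carrier)
  ultimately show "\<Phi> t = \<Psi> t \<otimes>\<^bsub>U\<^esub> \<chi> (tutte_degree t)"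
    unfolding \<chi>_def by (metis U.inv_closed U.m_assoc U.m_closed U.r_inv U.r_one)
qed

lemma agree_on_inner_iff:
  assumes ne: "{} \<notin> circuits M" "{} \<notin> cocircuits M" and U: "comm_group U"
    and \<Phi>: "\<Phi> \<in> hom (ext_tutte_group M) U" and \<Psi>: "\<Psi> \<in> hom (ext_tutte_group M) U"
  shows "(\<forall>t\<in>carrier (inner_tutte_group M). \<Phi> t = \<Psi> t) \<longleftrightarrow>
    (\<exists>\<chi>\<in>hom (degree_group M) U. \<forall>t\<in>carrier (ext_tutte_group M). \<Phi> t = \<Psi> t \<otimes>\<^bsub>U\<^esub> \<chi> (tutte_degree t))"
proof
  assume eq: "\<forall>t\<in>carrier (inner_tutte_group M). \<Phi> t = \<Psi> t"
  obtain w where w: "w \<in> hom (degree_group M) (ext_tutte_group M)"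
    "\<And>t. t \<in> carrier (ext_tutte_group M) \<Longrightarrow> tutte_shift M w t \<in> carrier (inner_tutte_group M)"
    using inner_tutte_group_shift[OF ne] by metis
  show "\<exists>\<chi>\<in>hom (degree_group M) U. \<forall>t\<in>carrier (ext_tutte_group M). \<Phi> t = \<Psi> t \<otimes>\<^bsub>U\<^esub> \<chi> (tutte_degree t)"
    using hom_differ_by_degree[OF U \<Phi> \<Psi> w(1)] eq w(2)
    by (intro bexI[of _ "\<lambda>d. \<Psi> (w d) \<otimes>\<^bsub>U\<^esub> inv\<^bsub>U\<^esub> \<Phi> (w d)"]) blast+
next
  interpret U: comm_group U by fact
  assume "\<exists>\<chi>\<in>hom (degree_group M) U. \<forall>t\<in>carrier (ext_tutte_group M). \<Phi> t = \<Psi> t \<otimes>\<^bsub>U\<^esub> \<chi> (tutte_degree t)"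
  then show "\<forall>t\<in>carrier (inner_tutte_group M). \<Phi> t = \<Psi> t"
    using hom_in_carrier[OF \<Psi>] by (auto simp: carrier_inner_tutte_group hom_degree_zero)
qed

lemma agree_on_tutte_group_iff:
  assumes ne: "{} \<notin> circuits M" "{} \<notin> cocircuits M" and U: "comm_group U"
    and \<Phi>: "\<Phi> \<in> hom (ext_tutte_group M) U" and \<Psi>: "\<Psi> \<in> hom (ext_tutte_group M) U"
  shows "(\<forall>t\<in>carrier (tutte_group M). \<Phi> t = \<Psi> t) \<longleftrightarrow>
    (\<exists>\<chi>\<in>hom (degree_group M) U. (\<forall>x\<in>ground M. \<chi> (frag_of (Inl x)) = \<one>\<^bsub>U\<^esub>) \<and>
      (\<forall>t\<in>carrier (ext_tutte_group M). \<Phi> t = \<Psi> t \<otimes>\<^bsub>U\<^esub> \<chi> (tutte_degree t)))"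
    (is "_ \<longleftrightarrow> ?R")
proof
  interpret U: comm_group U by fact
  interpret T: comm_group "ext_tutte_group M" by (rule comm_group_ext_tutte_group)
  interpret \<Phi>: group_hom "ext_tutte_group M" U \<Phi> using \<Phi> by unfold_locales
  interpret \<Psi>: group_hom "ext_tutte_group M" U \<Psi> using \<Psi> by unfold_locales
  assume eq: "\<forall>t\<in>carrier (tutte_group M). \<Phi> t = \<Psi> t"
  obtain w where w: "w \<in> hom (degree_group M) (ext_tutte_group M)"
    "\<And>x. x \<in> ground M \<Longrightarrow> w (frag_of (Inl x)) = \<one>\<^bsub>ext_tutte_group M\<^esub>"
    "\<And>t. t \<in> carrier (ext_tutte_group M) \<Longrightarrow> tutte_shift M w t \<in> carrier (tutte_group M)"
    using tutte_group_shift[OF ne] by metis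
  let ?\<chi> = "\<lambda>d. \<Psi> (w d) \<otimes>\<^bsub>U\<^esub> inv\<^bsub>U\<^esub> \<Phi> (w d)"
  have "?\<chi> \<in> hom (degree_group M) U"
    "\<forall>t\<in>carrier (ext_tutte_group M). \<Phi> t = \<Psi> t \<otimes>\<^bsub>U\<^esub> ?\<chi> (tutte_degree t)"
    using hom_differ_by_degree[OF U \<Phi> \<Psi> w(1)] eq w(3) by blast+
  moreover have "\<forall>x\<in>ground M. ?\<chi> (frag_of (Inl x)) = \<one>\<^bsub>U\<^esub>"
    using w(2) by simp
  ultimately show ?R by (intro bexI[of _ ?\<chi>]) blast+
next
  interpret U: comm_group U by fact
  assume ?R
  then obtain \<chi> where \<chi>: "\<chi> \<in> hom (degree_group M) U" "\<And>x. x \<in> ground M \<Longrightarrow> \<chi> (frag_of (Inl x)) = \<one>\<^bsub>U\<^esub>"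
    "\<And>t. t \<in> carrier (ext_tutte_group M) \<Longrightarrow> \<Phi> t = \<Psi> t \<otimes>\<^bsub>U\<^esub> \<chi> (tutte_degree t)" by blast
  show "\<forall>t\<in>carrier (tutte_group M). \<Phi> t = \<Psi> t"
    using subgroup.subset[OF subgroup_tutte_group] hom_in_carrier[OF \<Psi>]
      hom_degree_trivial_on_tutte_group[OF U.is_group \<chi>(1,2)] \<chi>(3) by fastforce
qed

section \<open>Extending homomorphisms from the smaller groups by composing with a
  retraction\<close>

lemma extend_hom_from_tutte_group:
  assumes "{} \<notin> circuits M" "{} \<notin> cocircuits M" "\<phi> \<in> hom (tutte_group M) U"
  obtains \<Phi> where "\<Phi> \<in> hom (ext_tutte_group M) U" "\<And>t. t \<in> carrier (tutte_group M) \<Longrightarrow> \<Phi> t = \<phi> t"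
proof -
  obtain w where w: "w \<in> hom (degree_group M) (ext_tutte_group M)"
    "\<And>x. x \<in> ground M \<Longrightarrow> w (frag_of (Inl x)) = \<one>\<^bsub>ext_tutte_group M\<^esub>"
    "\<And>t. t \<in> carrier (ext_tutte_group M) \<Longrightarrow> tutte_shift M w t \<in> carrier (tutte_group M)"
    using tutte_group_shift[OF assms(1,2)] by metis
  have "tutte_shift M w \<in> hom (ext_tutte_group M) (tutte_group M)"
    using tutte_shift_hom[OF w(1)] w(3) by (auto simp: hom_def tutte_group_def)
  from hom_compose[OF this assms(3)] show ?thesis
    by (rule that) (simp add: tutte_shift_tutte_group[OF w(1,2)])
qed

lemma extend_hom_from_inner_tutte_group:
  assumes "{} \<notin> circuits M" "{} \<notin> cocircuits M" "\<phi> \<in> hom (inner_tutte_group M) U"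
  obtains \<Phi> where "\<Phi> \<in> hom (ext_tutte_group M) U"
    "\<And>t. t \<in> carrier (inner_tutte_group M) \<Longrightarrow> \<Phi> t = \<phi> t"
proof -
  obtain w where w: "w \<in> hom (degree_group M) (ext_tutte_group M)"
    "\<And>t. t \<in> carrier (ext_tutte_group M) \<Longrightarrow> tutte_shift M w t \<in> carrier (inner_tutte_group M)"
    using inner_tutte_group_shift[OF assms(1,2)] by metis
  have "tutte_shift M w \<in> hom (ext_tutte_group M) (inner_tutte_group M)"
    using tutte_shift_hom[OF w(1)] w(2) by (auto simp: hom_def inner_tutte_group_def)
  from hom_compose[OF this assms(3)] show ?thesis
    by (rule that) (simp add: tutte_shift_inner[OF w(1)])
qed

section \<open>Circuits and cocircuits\<close>

context matroid
begin

lemma finite_indep: "indep M X \<Longrightarrow> finite X"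
  using finite_subset[OF indep_subset_ground ground_finite] .

lemma card_indep_le_basis:
  assumes "indep M X" "B \<in> bases M"
  shows "card X \<le> card B"
proof (rule ccontr)
  assume "\<not> card X \<le> card B"
  then obtain y where "y \<notin> B" "indep M (insert y B)"
    using indep_augment[of B X] assms by (auto simp: bases_def)
  then show False using assms(2) by (auto simp: bases_def)
qed

lemma bases_nonempty: "bases M \<noteq> {}"
proof -
  have "\<exists>B. indep M B \<and> (\<forall>X. indep M X \<longrightarrow> card X \<le> card B)"
    by (rule ex_has_greatest_nat[where k = "{}" and b = "Suc (card (ground M))"])
      (auto intro!: indep_empty card_mono ground_finite dest: indep_subset_ground simp: less_Suc_eq_le)
  then obtain B where B: "indep M B" "\<And>X. indep M X \<Longrightarrow> card X \<le> card B" by auto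
  have "X = B" if "indep M X" "B \<subseteq> X" for X
    using card_seteq[OF finite_indep[OF that(1)] that(2)] B(2)[OF that(1)] by simp
  then show ?thesis using B(1) by (auto simp: bases_def)
qed

text \<open>The bound \<open>B' \<subseteq> I \<union> B\<close> is the point: it controls how the
  new basis can meet a cocircuit. A largest independent set between \<open>I\<close> and
  \<open>I \<union> B\<close> cannot be smaller than \<open>B\<close>, as augmenting it from
  \<open>B\<close> would stay in that range; having the size of a basis, it is maximal among all
  independent sets.\<close>

lemma extend_to_basis:
  assumes "indep M I" "B \<in> bases M"
  obtains B' where "B' \<in> bases M" "I \<subseteq> B'" "B' \<subseteq> I \<union> B"
proof -
  define \<F> where "\<F> = {X. indep M X \<and> I \<subseteq> X \<and> X \<subseteq> I \<union> B}"
  have "\<exists>X. X \<in> \<F> \<and> (\<forall>Y. Y \<in> \<F> \<longrightarrow> card Y \<le> card X)"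
    by (rule ex_has_greatest_nat[where k = I and b = "Suc (card (ground M))"])
      (auto simp: \<F>_def assms(1) less_Suc_eq_le intro!: card_mono ground_finite dest: indep_subset_ground)
  then obtain X where X: "X \<in> \<F>" "\<And>Y. Y \<in> \<F> \<Longrightarrow> card Y \<le> card X" by auto
  have "card B \<le> card X"
  proof (rule ccontr)
    assume "\<not> card B \<le> card X"
    then obtain y where y: "y \<in> B - X" "indep M (insert y X)"
      using indep_augment[of X B] X(1) assms(2) by (auto simp: \<F>_def bases_def)
    then have "insert y X \<in> \<F>" using X(1) by (auto simp: \<F>_def)
    from X(2)[OF this] y show False using finite_indep X(1) by (simp add: \<F>_def)
  qed
  then have "Y = X" if "indep M Y" "X \<subseteq> Y" for Y
    using card_seteq[OF finite_indep[OF that(1)] that(2)] card_indep_le_basis[OF that(1) assms(2)] by simp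
  then have "X \<in> bases M" using X(1) by (auto simp: \<F>_def bases_def)
  then show ?thesis using that X(1) by (auto simp: \<F>_def)
qed

lemma dependent_contains_circuit:
  assumes "X \<subseteq> ground M" "\<not> indep M X"
  obtains C where "C \<in> circuits M" "C \<subseteq> X"
proof -
  have "finite X" using assms(1) ground_finite finite_subset by blast
  from this assms have "\<exists>C\<in>circuits M. C \<subseteq> X"
  proof (induction X rule: finite_psubset_induct)
    case (psubset X)
    show ?case
    proof (cases "\<exists>Y. Y \<subset> X \<and> \<not> indep M Y")
      case True
      then obtain Y where Y: "Y \<subset> X" "\<not> indep M Y" by blast
      with psubset.prems(1) have "Y \<subseteq> ground M" by blast
      then show ?thesis using psubset.IH[OF Y(1) _ Y(2)] Y(1) by blast
    next
      case False
      then have "X \<in> circuits M" using psubset.prems by (auto simp: circuits_def)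
      then show ?thesis by blast
    qed
  qed
  then show ?thesis using that by blast
qed

lemma empty_not_circuit: "{} \<notin> circuits M"
  using indep_empty by (simp add: circuits_def)

text \<open>In the language of clutters, the cocircuits are the blocker of the bases. Dual
  independence means missing some basis, and subsets of \<open>D\<close> inherit the inclusion in
  the ground set.\<close>

lemma cocircuit_iff:
  "D \<in> cocircuits M \<longleftrightarrow> D \<subseteq> ground M \<and> (\<forall>B\<in>bases M. D \<inter> B \<noteq> {}) \<and>
     (\<forall>X. X \<subset> D \<longrightarrow> (\<exists>B\<in>bases M. X \<inter> B = {}))"
proof -
  have "D \<in> cocircuits M \<longleftrightarrow> D \<subseteq> ground M \<and> \<not> (D \<subseteq> ground M \<and> (\<exists>B\<in>bases M. D \<inter> B = {})) \<and>
      (\<forall>X. X \<subset> D \<longrightarrow> X \<subseteq> ground M \<and> (\<exists>B\<in>bases M. X \<inter> B = {}))"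
    by (simp add: cocircuits_def circuits_def dual_matroid_def)
  moreover have "X \<subseteq> ground M" if "X \<subset> D" "D \<subseteq> ground M" for X
    using that by (meson order.trans psubset_imp_subset)
  ultimately show ?thesis by metis
qed

lemma cocircuit_meets_basis: "D \<in> cocircuits M \<Longrightarrow> B \<in> bases M \<Longrightarrow> D \<inter> B \<noteq> {}"
  using cocircuit_iff by blast

lemma empty_not_cocircuit: "{} \<notin> cocircuits M"
  using bases_nonempty cocircuit_meets_basis by blast

text \<open>By minimality \<open>D - {e}\<close> misses some basis, and that basis can then meet
  \<open>D\<close> only in \<open>e\<close>.\<close>

lemma cocircuit_basis:
  assumes "D \<in> cocircuits M" "e \<in> D"
  obtains B where "B \<in> bases M" "B \<inter> D = {e}"
proof -
  have "D - {e} \<subset> D" using assms(2) by blast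
  then obtain B where B: "B \<in> bases M" "(D - {e}) \<inter> B = {}"
    using assms(1) cocircuit_iff by metis
  have "D \<inter> B \<noteq> {}" using cocircuit_meets_basis[OF assms(1) B(1)] .
  then have "B \<inter> D = {e}" using B(2) by blast
  then show ?thesis using that B(1) by blast
qed

text \<open>Complete \<open>C - {e}\<close> to a basis using only elements of a basis
  \<open>B\<close> that meets \<open>D\<close> in \<open>e\<close> alone. The result can meet
  \<open>D\<close> only in \<open>e\<close>, yet must meet it, so it contains \<open>e\<close> and
  with it all of \<open>C\<close>. For signatures, an intersection of size one would be fatal, since
  a single unit never sums to zero.\<close>

lemma circuit_cocircuit_not_singleton:
  assumes "C \<in> circuits M" "D \<in> cocircuits M"
  shows "C \<inter> D \<noteq> {e}"
proof
  assume e: "C \<inter> D = {e}"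
  then have "e \<in> C" "e \<in> D" by auto
  then have "C - {e} \<subset> C" by blast
  then have ind: "indep M (C - {e})" using assms(1) by (simp add: circuits_def)
  obtain B where basis: "B \<in> bases M" and B: "B \<inter> D = {e}"
    by (rule cocircuit_basis[OF assms(2) \<open>e \<in> D\<close>])
  obtain B' where B': "B' \<in> bases M" "C - {e} \<subseteq> B'" "B' \<subseteq> (C - {e}) \<union> B"
    by (rule extend_to_basis[OF ind basis])
  have "D \<inter> B' \<noteq> {}" using cocircuit_meets_basis[OF assms(2) B'(1)] .
  moreover have "D \<inter> B' \<subseteq> (C \<inter> D) \<union> (B \<inter> D)" using B'(3) by blast
  then have "D \<inter> B' \<subseteq> {e}" by (simp add: e B)
  ultimately have "e \<in> B'" by blast
  then have "C \<subseteq> B'" using B'(2) by blast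
  then have "indep M C" using B'(1) indep_subset[of B' C] by (simp add: bases_def)
  then show False using assms(1) by (simp add: circuits_def)
qed

text \<open>Supplies the auxiliary circuits in \<open>tutte_condition\<close>. Take a basis
  \<open>B\<close> with \<open>B \<inter> D = {x}\<close> and a circuit in
  \<open>insert y B\<close>: it must use \<open>y\<close>, it meets \<open>D\<close> within
  \<open>{x, y}\<close>, and it cannot meet \<open>D\<close> in \<open>y\<close> alone.\<close>

lemma circuit_through_two_cocircuit_elements:
  assumes "D \<in> cocircuits M" "x \<in> D" "y \<in> D" "x \<noteq> y"
  obtains C where "C \<in> circuits M" "C \<inter> D = {x, y}"
proof -
  obtain B where B: "B \<in> bases M" "B \<inter> D = {x}"
    by (rule cocircuit_basis[OF assms(1,2)])
  then have "y \<notin> B" using assms(3,4) by auto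
  then have "\<not> indep M (insert y B)" using B(1) by (auto simp: bases_def)
  moreover have "insert y B \<subseteq> ground M"
    using assms(3) cocircuits_subset_ground[OF assms(1)] B(1) indep_subset_ground[of B]
    by (auto simp: bases_def)
  ultimately obtain C where C: "C \<in> circuits M" "C \<subseteq> insert y B"
    by (elim dependent_contains_circuit[rotated])
  have "\<not> C \<subseteq> B"
    using C(1) B(1) indep_subset[of B C] by (auto simp: circuits_def bases_def)
  then have "y \<in> C" using C(2) by blast
  then have "{y} \<subseteq> C \<inter> D" using assms(3) by simp
  moreover have "C \<inter> D \<subseteq> insert y (B \<inter> D)" using C(2) by blast
  then have "C \<inter> D \<subseteq> {x, y}" unfolding B(2) by blast
  ultimately have "C \<inter> D = {x, y}"
    using circuit_cocircuit_not_singleton[OF C(1) assms(1), of y] by blast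
  then show ?thesis by (rule that[OF C(1)])
qed

end

section \<open>Hypersums\<close>

lemma hunits_simps [simp]:
  "carrier (hunits H) = carrier H - {hzero H}" "x \<otimes>\<^bsub>hunits H\<^esub> y = x \<otimes>\<^bsub>H\<^esub> y" "\<one>\<^bsub>hunits H\<^esub> = \<one>\<^bsub>H\<^esub>"
  by (simp_all add: hunits_def)

context hyperfield
begin

lemma hzero_mult_right: "a \<in> carrier H \<Longrightarrow> a \<otimes> hzero H = hzero H"
  using hzero_mult hzero_closed m_comm by metis

lemma comm_group_hunits: "comm_group (hunits H)"
  by (rule group.group_comm_groupI[OF hunits_group]) (simp add: m_comm)

lemma hneg_eqI:
  assumes "a \<in> carrier H" "b \<in> carrier H" "hzero H \<in> hplus H a b"
  shows "hneg H a = b"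
  unfolding hneg_def using assms by (intro the1_equality hneg_ex1) auto

lemma hneg_closed: "a \<in> carrier H \<Longrightarrow> hneg H a \<in> carrier H"
  and hneg_cancel: "a \<in> carrier H \<Longrightarrow> hzero H \<in> hplus H a (hneg H a)"
  using theI'[OF hneg_ex1, of a] by (auto simp: hneg_def)

lemma hneg_eq_mult:
  assumes "a \<in> carrier H"
  shows "hneg H a = hneg H \<one> \<otimes> a"
proof (rule hneg_eqI)
  have "(\<lambda>z. a \<otimes> z) (hzero H) \<in> (\<lambda>z. a \<otimes> z) ` hplus H \<one> (hneg H \<one>)"
    using hneg_cancel by (intro imageI) simp
  then show "hzero H \<in> hplus H a (hneg H \<one> \<otimes> a)"
    using assms by (simp add: hplus_distrib hneg_closed hzero_mult_right m_comm)
qed (use assms hneg_closed in auto)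

lemma hneg_hneg: "a \<in> carrier H \<Longrightarrow> hneg H (hneg H a) = a"
  using hneg_cancel hneg_closed hplus_comm by (intro hneg_eqI) auto

text \<open>Needed for sending \<epsilon> to -1: the value respects the relation that \<epsilon>
  squares to one.\<close>

lemma hneg_one_square: "hneg H \<one> \<otimes> hneg H \<one> = \<one>"
  using hneg_hneg[of \<one>] hneg_eq_mult[of "hneg H \<one>"] hneg_closed by simp

lemma hneg_one_unit: "hneg H \<one> \<in> carrier (hunits H)"
  using hneg_one_square hneg_closed[of \<one>] hzero_not_one hzero_mult_right by fastforce

lemma zero_in_hplus_iff:
  assumes "a \<in> carrier H" "b \<in> carrier H"
  shows "hzero H \<in> hplus H a b \<longleftrightarrow> b = hneg H \<one> \<otimes> a"
  using hneg_eqI[OF assms] hneg_cancel[OF assms(1)] hneg_eq_mult[OF assms(1)] by auto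

section \<open>Finite hypersums and their behaviour under scaling\<close>

lemma hsum_empty [simp]: "hsum H f {} = {hzero H}"
  using comm_monoid.finprod_empty[OF comm_monoid_hsum_monoid] by (simp add: hsum_def hsum_monoid_def)

lemma hsum_insert:
  assumes "finite I" "i \<notin> I" "f \<in> insert i I \<rightarrow> carrier H"
  shows "hsum H f (insert i I) = (\<Union>z\<in>hsum H f I. hplus H (f i) z)"
proof -
  interpret S: comm_monoid "hsum_monoid H" by (rule comm_monoid_hsum_monoid)
  have "(\<lambda>i. {f i}) \<in> I \<rightarrow> carrier (hsum_monoid H)" "{f i} \<in> carrier (hsum_monoid H)"
    using assms(3) by (auto simp: hsum_monoid_def)
  then have "hsum H f (insert i I) = {f i} \<otimes>\<^bsub>hsum_monoid H\<^esub> hsum H f I"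
    unfolding hsum_def using assms(1,2) by (intro S.finprod_insert)
  then show ?thesis by (simp add: hsum_monoid_def set_hplus_def)
qed

lemma hsum_closed: "f \<in> I \<rightarrow> carrier H \<Longrightarrow> hsum H f I \<subseteq> carrier H"
  using comm_monoid.finprod_closed[OF comm_monoid_hsum_monoid, of "\<lambda>i. {f i}" I]
  by (auto simp: hsum_def hsum_monoid_def)

lemma hsum_cong:
  assumes "I = J" "g \<in> J \<rightarrow> carrier H" "\<And>i. i \<in> J \<Longrightarrow> f i = g i"
  shows "hsum H f I = hsum H g J"
  unfolding hsum_def using assms
  by (intro comm_monoid.finprod_cong'[OF comm_monoid_hsum_monoid]) (auto simp: hsum_monoid_def)

lemma hsum_reindex:
  assumes "f \<in> h ` I \<rightarrow> carrier H" "inj_on h I"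
  shows "hsum H f (h ` I) = hsum H (\<lambda>i. f (h i)) I"
  unfolding hsum_def using assms
  by (intro comm_monoid.finprod_reindex[OF comm_monoid_hsum_monoid]) (auto simp: hsum_monoid_def)

lemma hsum_singleton: "f i \<in> carrier H \<Longrightarrow> hsum H f {i} = {f i}"
  using hsum_insert[of "{}" i f] hplus_zero hplus_comm hzero_closed by simp

lemma hsum_mult:
  assumes "finite I" "a \<in> carrier H" "f \<in> I \<rightarrow> carrier H"
  shows "(\<lambda>z. a \<otimes> z) ` hsum H f I = hsum H (\<lambda>i. a \<otimes> f i) I"
  using assms(1,3)
proof (induction I)
  case empty
  then show ?case using assms(2) hzero_mult_right by simp
next
  case (insert i I)
  have "(\<lambda>z. a \<otimes> z) ` hsum H f (insert i I) = (\<Union>z\<in>hsum H f I. (\<lambda>z. a \<otimes> z) ` hplus H (f i) z)"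
    using insert by (simp add: hsum_insert image_UN)
  also have "\<dots> = (\<Union>z\<in>hsum H f I. hplus H (a \<otimes> f i) (a \<otimes> z))"
    using insert.prems assms(2) hsum_closed[of f I] by (intro SUP_cong refl hplus_distrib) auto
  also have "\<dots> = (\<Union>z\<in>(\<lambda>z. a \<otimes> z) ` hsum H f I. hplus H (a \<otimes> f i) z)"
    by simp
  also have "\<dots> = hsum H (\<lambda>i. a \<otimes> f i) (insert i I)"
    using insert assms(2) by (subst hsum_insert) (auto simp: Pi_iff)
  finally show ?case .
qed

text \<open>Negatives are unique, so a partial sum \<open>z\<close> can cancel \<open>f i\<close>
  only if it equals the negative of \<open>f i\<close>.\<close>

lemma zero_in_hsum_insert_iff:
  assumes "finite I" "i \<notin> I" "f \<in> insert i I \<rightarrow> carrier H"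
  shows "hzero H \<in> hsum H f (insert i I) \<longleftrightarrow> hneg H \<one> \<otimes> f i \<in> hsum H f I"
proof -
  have "hzero H \<in> hplus H (f i) z \<longleftrightarrow> z = hneg H \<one> \<otimes> f i" if "z \<in> hsum H f I" for z
    using that hsum_closed[of f I] assms(3) by (intro zero_in_hplus_iff) auto
  then show ?thesis using assms by (auto simp: hsum_insert)
qed

text \<open>Scaling by \<open>?a\<close>, which is -1 divided by \<open>f i\<close>, commutes with
  hypersums by distributivity and is injective, being inverted by the negative of
  \<open>f i\<close>. It carries that negative to one.\<close>

lemma zero_in_hsum_insert_iff_one:
  assumes "finite I" "i \<notin> I" "f \<in> insert i I \<rightarrow> carrier (hunits H)"
  shows "hzero H \<in> hsum H f (insert i I) \<longleftrightarrow>
    \<one> \<in> hsum H (\<lambda>j. hneg H \<one> \<otimes> f j \<otimes> inv\<^bsub>hunits H\<^esub> f i) I"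
proof -
  interpret U: comm_group "hunits H" by (rule comm_group_hunits)
  let ?a = "hneg H \<one> \<otimes> inv\<^bsub>hunits H\<^esub> f i"
  have fi: "f i \<in> carrier (hunits H)" and f: "f \<in> insert i I \<rightarrow> carrier H" using assms(3) by auto
  have inv: "inv\<^bsub>hunits H\<^esub> f i \<in> carrier (hunits H)" using fi by (rule U.inv_closed)
  have a: "?a \<in> carrier (hunits H)"
    using U.m_closed[OF hneg_one_unit inv] by simp
  have aH: "?a \<in> carrier H" using a by simp
  have ab: "?a \<otimes> (hneg H \<one> \<otimes> f i) = \<one>"
  proof -
    have "?a \<otimes> (hneg H \<one> \<otimes> f i) = (hneg H \<one> \<otimes> hneg H \<one>) \<otimes> (inv\<^bsub>hunits H\<^esub> f i \<otimes> f i)"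
      using fi inv hneg_closed[of \<one>] by (simp add: m_ac)
    then show ?thesis using U.l_inv[OF fi] hneg_one_square by simp
  qed
  have inj: "inj_on (\<lambda>z. ?a \<otimes> z) (carrier H)"
  proof (rule inj_onI)
    fix y z
    assume yz: "y \<in> carrier H" "z \<in> carrier H" "?a \<otimes> y = ?a \<otimes> z"
    let ?b = "hneg H \<one> \<otimes> f i"
    have "?b \<in> carrier H" using U.m_closed[OF hneg_one_unit fi] by simp
    then have "?b \<otimes> (?a \<otimes> v) = v" if "v \<in> carrier H" for v
      using ab that aH by (metis l_one m_assoc m_comm)
    then show "y = z" using yz by metis
  qed
  have "hneg H \<one> \<otimes> f i \<in> carrier H" using U.m_closed[OF hneg_one_unit fi] by simp
  moreover have "hsum H f I \<subseteq> carrier H" using f by (intro hsum_closed) auto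
  ultimately have "hneg H \<one> \<otimes> f i \<in> hsum H f I \<longleftrightarrow>
      ?a \<otimes> (hneg H \<one> \<otimes> f i) \<in> (\<lambda>z. ?a \<otimes> z) ` hsum H f I"
    using inj_on_image_mem_iff[OF inj] by metis
  also have "(\<lambda>z. ?a \<otimes> z) ` hsum H f I = hsum H (\<lambda>j. ?a \<otimes> f j) I"
    using assms(1) f aH by (intro hsum_mult) auto
  also have "\<dots> = hsum H (\<lambda>j. hneg H \<one> \<otimes> f j \<otimes> inv\<^bsub>hunits H\<^esub> f i) I"
  proof (rule hsum_cong)
    show "(\<lambda>j. hneg H \<one> \<otimes> f j \<otimes> inv\<^bsub>hunits H\<^esub> f i) \<in> I \<rightarrow> carrier H"
      using f inv hneg_closed[of \<one>] by auto
    show "?a \<otimes> f j = hneg H \<one> \<otimes> f j \<otimes> inv\<^bsub>hunits H\<^esub> f i" if "j \<in> I" for j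
      using that f inv hneg_closed[of \<one>] by (simp add: m_ac Pi_iff)
  qed simp
  finally show ?thesis
    unfolding ab zero_in_hsum_insert_iff[OF assms(1,2) f] .
qed

lemma zero_in_hsum_pair_iff:
  assumes "x \<noteq> y" "f x \<in> carrier H" "f y \<in> carrier H"
  shows "hzero H \<in> hsum H f {x, y} \<longleftrightarrow> f x = hneg H \<one> \<otimes> f y"
proof -
  have "hzero H \<in> hsum H f {x, y} \<longleftrightarrow> hneg H \<one> \<otimes> f x = f y"
    using assms zero_in_hsum_insert_iff[of "{y}" x f] by (simp add: hsum_singleton)
  also have "\<dots> \<longleftrightarrow> f x = hneg H \<one> \<otimes> f y"
    using assms hneg_hneg hneg_eq_mult hneg_closed by metis
  finally show ?thesis .
qed

end

context hyperfield_involution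
begin

lemma inv_unit: "a \<in> carrier (hunits H) \<Longrightarrow> \<tau> a \<in> carrier (hunits H)"
  using inv_closed[of a] inv_inv[of a] inv_zero by auto

end

section \<open>Orthogonal signatures and homomorphisms\<close>

text \<open>Here \<open>c0\<close>, \<open>c1\<close> stand for a circuit \<open>C\<close> at two
  elements x0 and xj, \<open>d0\<close>, \<open>d1\<close> for a cocircuit \<open>D\<close> there,
  \<open>a0\<close>, \<open>a1\<close> for an auxiliary circuit meeting \<open>D\<close> in exactly
  these two elements, and \<open>e\<close> for \<epsilon>. The relation between the auxiliary
  circuit and \<open>D\<close> turns a ratio of auxiliary values into one of cocircuit
  values.\<close>

lemma (in comm_group) cross_ratio_identity:
  assumes "e \<in> carrier G" "c0 \<in> carrier G" "c1 \<in> carrier G" "d0 \<in> carrier G" "d1 \<in> carrier G"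
    "a0 \<in> carrier G" "a1 \<in> carrier G" and rel: "a0 \<otimes> d0 = e \<otimes> a1 \<otimes> d1"
  shows "(c1 \<otimes> a0) \<otimes> inv (c0 \<otimes> a1) = e \<otimes> (c1 \<otimes> d1) \<otimes> inv (c0 \<otimes> d0)"
proof -
  have "(c1 \<otimes> a0) \<otimes> (c0 \<otimes> d0) = (c1 \<otimes> c0) \<otimes> (a0 \<otimes> d0)"
    using assms(1-7) by (simp add: m_ac)
  also have "\<dots> = e \<otimes> (c1 \<otimes> d1) \<otimes> (c0 \<otimes> a1)"
    unfolding rel using assms by (simp add: m_ac)
  finally have eq: "(c1 \<otimes> a0) \<otimes> (c0 \<otimes> d0) = e \<otimes> (c1 \<otimes> d1) \<otimes> (c0 \<otimes> a1)" .
  let ?x = "e \<otimes> (c1 \<otimes> d1) \<otimes> inv (c0 \<otimes> d0)"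
  have "c1 \<otimes> a0 = (c1 \<otimes> a0) \<otimes> (c0 \<otimes> d0) \<otimes> inv (c0 \<otimes> d0)"
    using assms by (simp add: m_assoc del: inv_mult)
  also have "\<dots> = ?x \<otimes> (c0 \<otimes> a1)"
    unfolding eq using assms(1-7) by (simp add: m_ac)
  finally have "(c1 \<otimes> a0) \<otimes> inv (c0 \<otimes> a1) = ?x \<otimes> ((c0 \<otimes> a1) \<otimes> inv (c0 \<otimes> a1))"
    using m_assoc[of ?x "c0 \<otimes> a1" "inv (c0 \<otimes> a1)"] assms(1-7) by simp
  also have "\<dots> = ?x"
    using r_inv[of "c0 \<otimes> a1"] assms(1-7) by simp
  finally show ?thesis .
qed

context hyperfield
begin

text \<open>The condition evaluates its argument only at cross ratios, all of which lie in the inner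
  Tutte group. This carries it between homomorphisms on different Tutte groups.\<close>

lemma tutte_condition_cong:
  fixes M :: "'e indep_system"
  assumes eq: "\<And>t. t \<in> carrier (inner_tutte_group M) \<Longrightarrow> \<Phi> t = \<Psi> t"
    and closed: "\<And>t. t \<in> carrier (inner_tutte_group M) \<Longrightarrow> \<Psi> t \<in> carrier H"
    and \<Psi>: "tutte_condition M H s \<Psi>"
  shows "tutte_condition M H s \<Phi>"
  unfolding tutte_condition_def
proof (intro ballI allI impI)
  let ?T = "ext_tutte_group M"
  fix C D k and x :: "nat \<Rightarrow> 'e" and Cs
  let ?t = "\<lambda>j. (t_circ M C (x j) \<otimes>\<^bsub>?T\<^esub> t_circ M (Cs j) (x 0)) \<otimes>\<^bsub>?T\<^esub>
    inv\<^bsub>?T\<^esub> (t_circ M C (x 0) \<otimes>\<^bsub>?T\<^esub> t_circ M (Cs j) (x j))"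
  assume C: "C \<in> circuits M" and D: "D \<in> cocircuits M"
    and hyps: "2 \<le> k \<and> (s = Weak \<longrightarrow> k \<le> 2) \<and> inj_on x {0..k} \<and> C \<inter> D = x ` {0..k} \<and>
      (\<forall>j\<in>{1..k}. Cs j \<in> circuits M \<and> Cs j \<inter> D = {x 0, x j})"
  have inner: "?t j \<in> carrier (inner_tutte_group M)" if j: "j \<in> {1..k}" for j
  proof (rule cross_ratio_inner)
    have "x 0 \<in> C \<inter> D" "x j \<in> C \<inter> D" "Cs j \<inter> D = {x 0, x j}" using hyps j by auto
    then show "x j \<in> C \<inter> Cs j" "x 0 \<in> C \<inter> Cs j" by auto
  qed (use C hyps j in auto)
  have "\<one> \<in> hsum H (\<lambda>j. \<Psi> (?t j)) {1..k}"
    using \<Psi>[unfolded tutte_condition_def, rule_format, OF C D, of k x Cs] hyps by blast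
  also have "hsum H (\<lambda>j. \<Psi> (?t j)) {1..k} = hsum H (\<lambda>j. \<Phi> (?t j)) {1..k}"
    using inner eq closed by (intro hsum_cong) auto
  finally show "\<one> \<in> hsum H (\<lambda>j. \<Phi> (?t j)) {1..k}" .
qed

lemma tutte_hom_cong:
  assumes S: "subgroup S (ext_tutte_group M)" "carrier (inner_tutte_group M) \<subseteq> S"
    and eq: "\<And>t. t \<in> S \<Longrightarrow> \<Phi> t = \<Psi> t"
    and \<Psi>: "tutte_hom M H s ((ext_tutte_group M)\<lparr>carrier := S\<rparr>) \<Psi>"
  shows "tutte_hom M H s ((ext_tutte_group M)\<lparr>carrier := S\<rparr>) \<Phi>"
proof -
  have hom: "\<Psi> \<in> hom ((ext_tutte_group M)\<lparr>carrier := S\<rparr>) (hunits H)"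
    using \<Psi> by (simp add: tutte_hom_def)
  have "tutte_condition M H s \<Phi>"
  proof (rule tutte_condition_cong)
    show "tutte_condition M H s \<Psi>" using \<Psi> by (simp add: tutte_hom_def)
    show "\<Psi> t \<in> carrier H" if "t \<in> carrier (inner_tutte_group M)" for t
      using hom_in_carrier[OF hom, of t] that S(2) by auto
  qed (use S(2) eq in blast)
  moreover have "\<Phi> (t_eps M) = \<Psi> (t_eps M)"
    using eq t_eps_inner S(2) by blast
  moreover have "\<Phi> \<in> hom ((ext_tutte_group M)\<lparr>carrier := S\<rparr>) (hunits H)"
    using hom eq subgroup.m_closed[OF S(1)] unfolding hom_def by (auto simp: Pi_iff)
  ultimately show ?thesis using \<Psi> by (simp add: tutte_hom_def)
qed

lemma tutte_hom_subgroup: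
  assumes S: "subgroup S (ext_tutte_group M)" and "tutte_hom M H s (ext_tutte_group M) \<Phi>"
  shows "tutte_hom M H s ((ext_tutte_group M)\<lparr>carrier := S\<rparr>) \<Phi>"
  using assms subgroup.subset[OF S] unfolding tutte_hom_def hom_def by auto

text \<open>An extension of an admissible homomorphism on \<open>S\<close> is again admissible,
  because \<epsilon> and all cross ratios already lie in \<open>S\<close>. Hence extending plain
  group homomorphisms is enough for surjectivity.\<close>

lemma restrict_tutte_homs:
  assumes S: "subgroup S (ext_tutte_group M)" "carrier (inner_tutte_group M) \<subseteq> S"
    and ext: "\<And>\<phi>. \<phi> \<in> hom ((ext_tutte_group M)\<lparr>carrier := S\<rparr>) (hunits H) \<Longrightarrow>
      \<exists>\<Phi>\<in>hom (ext_tutte_group M) (hunits H). \<forall>t\<in>S. \<Phi> t = \<phi> t"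
  shows "(\<lambda>\<Phi>. restrict \<Phi> S) ` tutte_homs M H s (ext_tutte_group M)
    = tutte_homs M H s ((ext_tutte_group M)\<lparr>carrier := S\<rparr>)" (is "?r ` ?A = ?B")
proof
  show "?r ` ?A \<subseteq> ?B"
  proof (clarsimp simp: tutte_homs_def)
    fix \<Phi>
    assume "tutte_hom M H s (ext_tutte_group M) \<Phi>"
    then show "tutte_hom M H s ((ext_tutte_group M)\<lparr>carrier := S\<rparr>) (restrict \<Phi> S)"
      by (intro tutte_hom_cong[OF S _ tutte_hom_subgroup[OF S(1)]]) auto
  qed
  show "?B \<subseteq> ?r ` ?A"
  proof
    fix \<phi>
    assume "\<phi> \<in> ?B"
    then have \<phi>: "\<phi> \<in> extensional S" "tutte_hom M H s ((ext_tutte_group M)\<lparr>carrier := S\<rparr>) \<phi>"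
      by (auto simp: tutte_homs_def)
    then obtain \<Psi> where \<Psi>: "\<Psi> \<in> hom (ext_tutte_group M) (hunits H)" "\<And>t. t \<in> S \<Longrightarrow> \<Psi> t = \<phi> t"
      using ext[of \<phi>] by (auto simp: tutte_hom_def)
    \<comment> \<open>Cutting off outside the extended Tutte group yields the extensional
      representative that \<open>tutte_homs\<close> counts.\<close>
    define \<Phi> where "\<Phi> = restrict \<Psi> (carrier (ext_tutte_group M))"
    have \<Phi>_eq: "\<Phi> t = \<phi> t" if "t \<in> S" for t
      using that \<Psi>(2) subgroup.subset[OF S(1)] by (auto simp: \<Phi>_def)
    interpret T: comm_group "ext_tutte_group M" by (rule comm_group_ext_tutte_group)
    have "\<Phi> \<in> hom (ext_tutte_group M) (hunits H)"
      using \<Psi>(1) by (auto simp: \<Phi>_def hom_def)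
    moreover have "tutte_condition M H s \<Phi>"
    proof (rule tutte_condition_cong)
      show "tutte_condition M H s \<phi>" using \<phi>(2) by (simp add: tutte_hom_def)
      show "\<phi> t \<in> carrier H" if "t \<in> carrier (inner_tutte_group M)" for t
        using \<phi>(2) that S(2) by (auto simp: tutte_hom_def hom_def)
    qed (use \<Phi>_eq S(2) in blast)
    moreover have "\<Phi> (t_eps M) = hneg H \<one>\<^bsub>H\<^esub>"
      using \<phi>(2) \<Phi>_eq[OF subsetD[OF S(2) t_eps_inner]] by (simp add: tutte_hom_def)
    ultimately have "\<Phi> \<in> ?A"
      by (simp add: tutte_homs_def tutte_hom_def) (simp add: \<Phi>_def)
    moreover have "restrict \<Phi> S = \<phi>"
      using \<Phi>_eq \<phi>(1) by (intro extensionalityI[of _ S]) auto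
    ultimately show "\<phi> \<in> ?r ` ?A" by blast
  qed
qed

end

section \<open>Pairs of signatures versus homomorphisms on the extended Tutte group\<close>

locale hyperfield_matroid_setting = matroid M + hyperfield_involution H \<tau>
  for M :: "'e indep_system" and H :: "'h hyperstructure" and \<tau> :: "'h \<Rightarrow> 'h"
begin

abbreviation "T \<equiv> ext_tutte_group M"
abbreviation "U \<equiv> hunits H"

sublocale T: comm_group T by (rule comm_group_ext_tutte_group)
sublocale U: comm_group U by (rule comm_group_hunits)

lemmas nonempty = empty_not_circuit empty_not_cocircuit

text \<open>The left side mentions neither the enumeration \<open>x\<close> nor the auxiliary
  circuits \<open>Cs\<close>. So the sum of cross ratios contains one for every admissible choice as
  soon as it does for a single choice.\<close>

lemma zero_in_hsum_iff_cross_ratio: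
  fixes x :: "nat \<Rightarrow> 'e"
  assumes \<Phi>: "\<Phi> \<in> hom T U" "\<Phi> (t_eps M) = hneg H \<one>\<^bsub>H\<^esub>"
    and CD: "C \<in> circuits M" "D \<in> cocircuits M" "inj_on x {0..k}" "C \<inter> D = x ` {0..k}"
    and Cs: "\<And>j. j \<in> {1..k} \<Longrightarrow> Cs j \<in> circuits M \<and> Cs j \<inter> D = {x 0, x j}"
  shows "hzero H \<in> hsum H (\<lambda>x. \<Phi> (t_circ M C x) \<otimes>\<^bsub>H\<^esub> \<Phi> (t_cocirc M D x)) (C \<inter> D) \<longleftrightarrow>
    \<one>\<^bsub>H\<^esub> \<in> hsum H (\<lambda>j. \<Phi> ((t_circ M C (x j) \<otimes>\<^bsub>T\<^esub> t_circ M (Cs j) (x 0)) \<otimes>\<^bsub>T\<^esub>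
      inv\<^bsub>T\<^esub> (t_circ M C (x 0) \<otimes>\<^bsub>T\<^esub> t_circ M (Cs j) (x j)))) {1..k}"
proof -
  interpret \<Phi>: group_hom T U \<Phi> using \<Phi>(1) by unfold_locales
  let ?f = "\<lambda>x. \<Phi> (t_circ M C x) \<otimes>\<^bsub>H\<^esub> \<Phi> (t_cocirc M D x)"
  have f_eq: "?f z = \<Phi> (t_circ M C z \<otimes>\<^bsub>T\<^esub> t_cocirc M D z)" if "z \<in> C \<inter> D" for z
    using that CD(1,2) by (simp add: tutte_closed)
  have f_unit: "?f z \<in> carrier U" if "z \<in> C \<inter> D" for z
    unfolding f_eq[OF that] using that CD(1,2) by (intro \<Phi>.hom_closed) (simp add: tutte_closed)
  have mem: "x j \<in> C \<inter> D" if "j \<in> {0..k}" for j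
    using that CD(4) by blast
  have split: "C \<inter> D = insert (x 0) (x ` {1..k})"
    unfolding CD(4) image_insert[symmetric] by (rule arg_cong[of _ _ "image x"]) auto
  have new: "x 0 \<notin> x ` {1..k}"
    using inj_onD[OF CD(3), of 0] by fastforce
  have inj: "inj_on x {1..k}" using CD(3) by (rule inj_on_subset) auto
  have "hzero H \<in> hsum H ?f (C \<inter> D) \<longleftrightarrow>
      \<one>\<^bsub>H\<^esub> \<in> hsum H (\<lambda>z. hneg H \<one>\<^bsub>H\<^esub> \<otimes>\<^bsub>H\<^esub> ?f z \<otimes>\<^bsub>H\<^esub> inv\<^bsub>U\<^esub> ?f (x 0)) (x ` {1..k})"
    unfolding split by (rule zero_in_hsum_insert_iff_one) (use new f_unit split in auto)
  also have "hsum H (\<lambda>z. hneg H \<one>\<^bsub>H\<^esub> \<otimes>\<^bsub>H\<^esub> ?f z \<otimes>\<^bsub>H\<^esub> inv\<^bsub>U\<^esub> ?f (x 0)) (x ` {1..k})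
      = hsum H (\<lambda>j. hneg H \<one>\<^bsub>H\<^esub> \<otimes>\<^bsub>H\<^esub> ?f (x j) \<otimes>\<^bsub>H\<^esub> inv\<^bsub>U\<^esub> ?f (x 0)) {1..k}"
  proof (rule hsum_reindex[OF _ inj])
    have "inv\<^bsub>U\<^esub> ?f (x 0) \<in> carrier H" using U.inv_closed[OF f_unit[OF mem[of 0]]] by simp
    moreover have "?f z \<in> carrier H" if "z \<in> x ` {1..k}" for z
      using f_unit[of z] that split by auto
    ultimately show "(\<lambda>z. hneg H \<one>\<^bsub>H\<^esub> \<otimes>\<^bsub>H\<^esub> ?f z \<otimes>\<^bsub>H\<^esub> inv\<^bsub>U\<^esub> ?f (x 0)) \<in> x ` {1..k} \<rightarrow> carrier H"
      using hneg_closed[of "\<one>\<^bsub>H\<^esub>"] by blast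
  qed
  also have "\<dots> = hsum H (\<lambda>j. \<Phi> ((t_circ M C (x j) \<otimes>\<^bsub>T\<^esub> t_circ M (Cs j) (x 0)) \<otimes>\<^bsub>T\<^esub>
      inv\<^bsub>T\<^esub> (t_circ M C (x 0) \<otimes>\<^bsub>T\<^esub> t_circ M (Cs j) (x j)))) {1..k}"
  proof (rule hsum_cong[OF refl])
    show "(\<lambda>j. \<Phi> ((t_circ M C (x j) \<otimes>\<^bsub>T\<^esub> t_circ M (Cs j) (x 0)) \<otimes>\<^bsub>T\<^esub>
      inv\<^bsub>T\<^esub> (t_circ M C (x 0) \<otimes>\<^bsub>T\<^esub> t_circ M (Cs j) (x j)))) \<in> {1..k} \<rightarrow> carrier H"
    proof
      fix j
      assume j: "j \<in> {1..k}"
      have "x j \<in> C \<inter> Cs j" "x 0 \<in> C \<inter> Cs j"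
        using mem[of 0] mem[of j] j Cs[OF j] by auto
      then have "(t_circ M C (x j) \<otimes>\<^bsub>T\<^esub> t_circ M (Cs j) (x 0)) \<otimes>\<^bsub>T\<^esub>
          inv\<^bsub>T\<^esub> (t_circ M C (x 0) \<otimes>\<^bsub>T\<^esub> t_circ M (Cs j) (x j)) \<in> carrier T"
        using cross_ratio_inner[OF CD(1), of "Cs j"] Cs[OF j] subgroup.subset[OF subgroup_inner_tutte_group]
        by blast
      from hom_in_carrier[OF \<Phi>(1) this]
      show "\<Phi> ((t_circ M C (x j) \<otimes>\<^bsub>T\<^esub> t_circ M (Cs j) (x 0)) \<otimes>\<^bsub>T\<^esub>
          inv\<^bsub>T\<^esub> (t_circ M C (x 0) \<otimes>\<^bsub>T\<^esub> t_circ M (Cs j) (x j))) \<in> carrier H" by simp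
    qed
  next
    fix j
    assume j: "j \<in> {1..k}"
    have "x j \<in> Cs j" "x 0 \<in> Cs j" using Cs[OF j] by auto
    then have closed: "t_circ M C (x j) \<in> carrier T" "t_circ M C (x 0) \<in> carrier T"
      "t_cocirc M D (x j) \<in> carrier T" "t_cocirc M D (x 0) \<in> carrier T"
      "t_circ M (Cs j) (x j) \<in> carrier T" "t_circ M (Cs j) (x 0) \<in> carrier T"
      using mem[of 0] mem[of j] j CD(1,2) Cs[OF j] by (auto simp: tutte_closed)
    have "x 0 \<noteq> x j" using new j by auto
    from tutte_relation[OF _ CD(2) _ this] Cs[OF j]
    have "t_circ M (Cs j) (x 0) \<otimes>\<^bsub>T\<^esub> t_cocirc M D (x 0)
        = t_eps M \<otimes>\<^bsub>T\<^esub> t_circ M (Cs j) (x j) \<otimes>\<^bsub>T\<^esub> t_cocirc M D (x j)" by blast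
    \<comment> \<open>The permutation of \<open>closed\<close> lists the values of \<open>C\<close>,
      of \<open>D\<close> and of \<open>Cs j\<close>, each at \<open>x 0\<close> before
      \<open>x j\<close>.\<close>
    from T.cross_ratio_identity[OF t_eps_closed closed(2,1,4,3,6,5) this]
    have "\<Phi> ((t_circ M C (x j) \<otimes>\<^bsub>T\<^esub> t_circ M (Cs j) (x 0)) \<otimes>\<^bsub>T\<^esub>
      inv\<^bsub>T\<^esub> (t_circ M C (x 0) \<otimes>\<^bsub>T\<^esub> t_circ M (Cs j) (x j)))
      = \<Phi> (t_eps M \<otimes>\<^bsub>T\<^esub> (t_circ M C (x j) \<otimes>\<^bsub>T\<^esub> t_cocirc M D (x j)) \<otimes>\<^bsub>T\<^esub>
        inv\<^bsub>T\<^esub> (t_circ M C (x 0) \<otimes>\<^bsub>T\<^esub> t_cocirc M D (x 0)))" by simp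
    also have "\<dots> = hneg H \<one>\<^bsub>H\<^esub> \<otimes>\<^bsub>H\<^esub> ?f (x j) \<otimes>\<^bsub>H\<^esub> inv\<^bsub>U\<^esub> ?f (x 0)"
      using closed t_eps_closed[of M] \<Phi>(2) f_eq[OF mem[of 0]]
      by (simp add: T.inv_mult del: T.inv_mult U.inv_mult)
    finally show "hneg H \<one>\<^bsub>H\<^esub> \<otimes>\<^bsub>H\<^esub> ?f (x j) \<otimes>\<^bsub>H\<^esub> inv\<^bsub>U\<^esub> ?f (x 0)
      = \<Phi> ((t_circ M C (x j) \<otimes>\<^bsub>T\<^esub> t_circ M (Cs j) (x 0)) \<otimes>\<^bsub>T\<^esub>
        inv\<^bsub>T\<^esub> (t_circ M C (x 0) \<otimes>\<^bsub>T\<^esub> t_circ M (Cs j) (x j)))" ..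
  qed
  finally show ?thesis .
qed

text \<open>The condition speaks only of intersections with at least three elements. The smaller
  ones take care of themselves: an empty hypersum is zero, a single element cannot occur, and for
  two elements the Tutte relation together with \<epsilon> going to -1 gives the
  cancellation.\<close>

lemma orthogonal_iff_tutte_condition:
  assumes \<Phi>: "\<Phi> \<in> hom T U" "\<Phi> (t_eps M) = hneg H \<one>\<^bsub>H\<^esub>"
  shows "(\<forall>C\<in>circuits M. \<forall>D\<in>cocircuits M. (s = Weak \<longrightarrow> card (C \<inter> D) \<le> 3) \<longrightarrow>
      hzero H \<in> hsum H (\<lambda>x. \<Phi> (t_circ M C x) \<otimes>\<^bsub>H\<^esub> \<Phi> (t_cocirc M D x)) (C \<inter> D))
    \<longleftrightarrow> tutte_condition M H s \<Phi>" (is "?L \<longleftrightarrow> _")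
proof
  assume ?L
  show "tutte_condition M H s \<Phi>"
    unfolding tutte_condition_def
  proof (intro ballI allI impI, elim conjE)
    fix C D k and x :: "nat \<Rightarrow> 'e" and Cs
    assume *: "C \<in> circuits M" "D \<in> cocircuits M" "s = Weak \<longrightarrow> k \<le> 2" "inj_on x {0..k}"
      "C \<inter> D = x ` {0..k}" "\<forall>j\<in>{1..k}. Cs j \<in> circuits M \<and> Cs j \<inter> D = {x 0, x j}"
    \<comment> \<open>The indices run from 0 to \<open>k\<close>, so the intersection has
      \<open>k + 1\<close> elements and the weak bounds 2 and 3 correspond.\<close>
    then have "s = Weak \<longrightarrow> card (C \<inter> D) \<le> 3" by (simp add: card_image)
    then have "hzero H \<in> hsum H (\<lambda>x. \<Phi> (t_circ M C x) \<otimes>\<^bsub>H\<^esub> \<Phi> (t_cocirc M D x)) (C \<inter> D)"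
      using \<open>?L\<close> *(1,2) by blast
    then show "\<one>\<^bsub>H\<^esub> \<in> hsum H (\<lambda>j. \<Phi> ((t_circ M C (x j) \<otimes>\<^bsub>T\<^esub> t_circ M (Cs j) (x 0)) \<otimes>\<^bsub>T\<^esub>
      inv\<^bsub>T\<^esub> (t_circ M C (x 0) \<otimes>\<^bsub>T\<^esub> t_circ M (Cs j) (x j)))) {1..k}"
      using zero_in_hsum_iff_cross_ratio[OF \<Phi> *(1,2,4,5), of Cs] *(6) by blast
  qed
next
  assume S: "tutte_condition M H s \<Phi>"
  show ?L
  proof (intro ballI impI)
    fix C D
    assume CD: "C \<in> circuits M" "D \<in> cocircuits M" and weak: "s = Weak \<longrightarrow> card (C \<inter> D) \<le> 3"
    let ?f = "\<lambda>x. \<Phi> (t_circ M C x) \<otimes>\<^bsub>H\<^esub> \<Phi> (t_cocirc M D x)"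
    have fin: "finite (C \<inter> D)"
      using circuits_subset_ground[OF CD(1)] ground_finite finite_subset by blast
    consider "card (C \<inter> D) = 0" | "card (C \<inter> D) = 1" | "card (C \<inter> D) = 2" | "card (C \<inter> D) \<ge> 3"
      by linarith
    then show "hzero H \<in> hsum H ?f (C \<inter> D)"
    proof cases
      case 1
      then show ?thesis using fin by simp
    next
      case 2
      then show ?thesis using circuit_cocircuit_not_singleton[OF CD] by (auto simp: card_1_singleton_iff)
    next
      case 3
      then obtain x y where xy: "C \<inter> D = {x, y}" "x \<noteq> y" by (auto simp: card_2_iff)
      then have mem: "x \<in> C" "y \<in> C" "x \<in> D" "y \<in> D" by auto
      then have closed: "t_circ M C x \<in> carrier T" "t_circ M C y \<in> carrier T"
        "t_cocirc M D x \<in> carrier T" "t_cocirc M D y \<in> carrier T"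
        using CD by (simp_all add: tutte_closed)
      then have units: "\<Phi> (t_circ M C x) \<in> carrier U" "\<Phi> (t_circ M C y) \<in> carrier U"
        "\<Phi> (t_cocirc M D x) \<in> carrier U" "\<Phi> (t_cocirc M D y) \<in> carrier U"
        by (simp_all only: hom_in_carrier[OF \<Phi>(1)])
      have "\<Phi> (t_circ M C x \<otimes>\<^bsub>T\<^esub> t_cocirc M D x)
          = \<Phi> (t_eps M \<otimes>\<^bsub>T\<^esub> t_circ M C y \<otimes>\<^bsub>T\<^esub> t_cocirc M D y)"
        using tutte_relation[OF CD xy] by simp
      then have "?f x = hneg H \<one>\<^bsub>H\<^esub> \<otimes>\<^bsub>H\<^esub> ?f y"
        using closed units t_eps_closed[of M] hneg_closed[of "\<one>\<^bsub>H\<^esub>"]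
        by (simp add: hom_mult[OF \<Phi>(1)] \<Phi>(2) m_assoc)
      moreover have "?f x \<in> carrier H" "?f y \<in> carrier H" using units by simp_all
      ultimately show ?thesis
        unfolding xy(1) using zero_in_hsum_pair_iff[OF xy(2), of ?f] by blast
    next
      case 4
      \<comment> \<open>One element serves as base point \<open>x 0\<close>, so size at least 3
        becomes \<open>k \<ge> 2\<close>, and size at most 3 becomes
        \<open>k \<le> 2\<close>.\<close>
      define k where "k = card (C \<inter> D) - 1"
      have "card {0..k} = card (C \<inter> D)" using 4 by (simp add: k_def)
      then obtain x where "bij_betw x {0..k} (C \<inter> D)"
        using fin finite_same_card_bij finite_atLeastAtMost by metis
      then have x: "inj_on x {0..k}" "C \<inter> D = x ` {0..k}" by (auto simp: bij_betw_def)
      have "\<exists>C'. C' \<in> circuits M \<and> C' \<inter> D = {x 0, x j}" if "j \<in> {1..k}" for j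
      proof -
        have "x 0 \<in> D" "x j \<in> D" using that x(2) by auto
        moreover have "x 0 \<noteq> x j" using that inj_onD[OF x(1), of 0 j] by auto
        ultimately show ?thesis using circuit_through_two_cocircuit_elements[OF CD(2)] by metis
      qed
      then obtain Cs where Cs: "\<And>j. j \<in> {1..k} \<Longrightarrow> Cs j \<in> circuits M \<and> Cs j \<inter> D = {x 0, x j}"
        by metis
      have k: "k \<ge> 2 \<and> (s = Weak \<longrightarrow> k \<le> 2)" using 4 weak by (auto simp: k_def)
      have "\<one>\<^bsub>H\<^esub> \<in> hsum H (\<lambda>j. \<Phi> ((t_circ M C (x j) \<otimes>\<^bsub>T\<^esub> t_circ M (Cs j) (x 0)) \<otimes>\<^bsub>T\<^esub>
          inv\<^bsub>T\<^esub> (t_circ M C (x 0) \<otimes>\<^bsub>T\<^esub> t_circ M (Cs j) (x j)))) {1..k}"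
        using S[unfolded tutte_condition_def, rule_format, OF CD, of k x Cs] k x Cs by blast
      then show ?thesis
        using zero_in_hsum_iff_cross_ratio[OF \<Phi> CD x, of Cs] Cs by blast
    qed
  qed
qed

text \<open>\<open>\<tau>\<close> is applied once in forming the cocircuit signature and once more
  in the orthogonality sum. As it is an involution the two cancel, and the sum contains only values
  of \<Phi>.\<close>

lemma pair_of_hom_orthogonal_iff:
  assumes \<Phi>: "\<Phi> \<in> hom T U" "\<Phi> (t_eps M) = hneg H \<one>\<^bsub>H\<^esub>"
  shows "pair_of_hom M \<tau> \<Phi> \<in> orthogonal_pairs M H \<tau> s \<longleftrightarrow> tutte_condition M H s \<Phi>"
proof -
  define \<gamma> where "\<gamma> = fst (pair_of_hom M \<tau> \<Phi>)"
  define \<delta> where "\<delta> = snd (pair_of_hom M \<tau> \<Phi>)"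
  have \<gamma>: "\<gamma> C x = \<Phi> (t_circ M C x)" "\<Phi> (t_circ M C x) \<in> carrier U"
    if "C \<in> circuits M" "x \<in> C" for C x
    using that hom_in_carrier[OF \<Phi>(1) t_circ_closed] by (auto simp: \<gamma>_def pair_of_hom_def)
  have \<delta>: "\<tau> (\<delta> D x) = \<Phi> (t_cocirc M D x)" "\<Phi> (t_cocirc M D x) \<in> carrier U"
    if "D \<in> cocircuits M" "x \<in> D" for D x
    using that hom_in_carrier[OF \<Phi>(1) t_cocirc_closed] inv_inv[of "\<Phi> (t_cocirc M D x)"]
    by (auto simp: \<delta>_def pair_of_hom_def)
  have "\<gamma> \<in> circuit_signatures M H"
    unfolding circuit_signatures_def \<gamma>_def pair_of_hom_def using \<gamma>(2)
    by (simp add: restrict_PiE_iff)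
  moreover have "\<delta> \<in> cocircuit_signatures M H"
    unfolding cocircuit_signatures_def \<delta>_def pair_of_hom_def using inv_unit \<delta>(2)
    by (simp add: restrict_PiE_iff)
  moreover have "hsum H (\<lambda>x. \<gamma> C x \<otimes>\<^bsub>H\<^esub> \<tau> (\<delta> D x)) (C \<inter> D)
      = hsum H (\<lambda>x. \<Phi> (t_circ M C x) \<otimes>\<^bsub>H\<^esub> \<Phi> (t_cocirc M D x)) (C \<inter> D)"
    if "C \<in> circuits M" "D \<in> cocircuits M" for C D
    using that \<gamma> \<delta> by (intro hsum_cong) auto
  ultimately have "(\<gamma>, \<delta>) \<in> orthogonal_pairs M H \<tau> s \<longleftrightarrow>
      (\<forall>C\<in>circuits M. \<forall>D\<in>cocircuits M. (s = Weak \<longrightarrow> card (C \<inter> D) \<le> 3) \<longrightarrow>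
        hzero H \<in> hsum H (\<lambda>x. \<Phi> (t_circ M C x) \<otimes>\<^bsub>H\<^esub> \<Phi> (t_cocirc M D x)) (C \<inter> D))"
    by (simp add: orthogonal_pairs_def)
  then show ?thesis
    unfolding orthogonal_iff_tutte_condition[OF \<Phi>] \<gamma>_def \<delta>_def by simp
qed

lemma pair_of_hom_orthogonal:
  "tutte_hom M H s T \<Phi> \<Longrightarrow> pair_of_hom M \<tau> \<Phi> \<in> orthogonal_pairs M H \<tau> s"
  using pair_of_hom_orthogonal_iff by (simp add: tutte_hom_def)

lemma orthogonal_pairs_signatures:
  assumes "(\<gamma>, \<delta>) \<in> orthogonal_pairs M H \<tau> s"
  shows "C \<in> circuits M \<Longrightarrow> x \<in> C \<Longrightarrow> \<gamma> C x \<in> carrier U"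
    "D \<in> cocircuits M \<Longrightarrow> y \<in> D \<Longrightarrow> \<delta> D y \<in> carrier U"
    "\<gamma> \<in> circuit_signatures M H" "\<delta> \<in> cocircuit_signatures M H"
proof -
  show sig: "\<gamma> \<in> circuit_signatures M H" "\<delta> \<in> cocircuit_signatures M H"
    using assms by (auto simp: orthogonal_pairs_def)
  show "C \<in> circuits M \<Longrightarrow> x \<in> C \<Longrightarrow> \<gamma> C x \<in> carrier U"
    using PiE_mem[OF PiE_mem[OF sig(1)[unfolded circuit_signatures_def]]] by blast
  show "D \<in> cocircuits M \<Longrightarrow> y \<in> D \<Longrightarrow> \<delta> D y \<in> carrier U"
    using PiE_mem[OF PiE_mem[OF sig(2)[unfolded cocircuit_signatures_def]]] by blast
qed

text \<open>Prescribe -1, \<gamma> and the \<tau>-image of \<delta> on the generators. The relations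
  concern intersections of exactly two elements, which weak orthogonality covers as well, so the
  universal property applies for both strengths.\<close>

lemma hom_of_orthogonal_pair:
  assumes orth: "(\<gamma>, \<delta>) \<in> orthogonal_pairs M H \<tau> s"
  obtains \<Phi> where "\<Phi> \<in> tutte_homs M H s T"
    "\<And>C x. C \<in> circuits M \<Longrightarrow> x \<in> C \<Longrightarrow> \<Phi> (t_circ M C x) = \<gamma> C x"
    "\<And>D y. D \<in> cocircuits M \<Longrightarrow> y \<in> D \<Longrightarrow> \<Phi> (t_cocirc M D y) = \<tau> (\<delta> D y)"
proof -
  note \<gamma> = orthogonal_pairs_signatures(1)[OF orth]
  note \<delta> = inv_unit[OF orthogonal_pairs_signatures(2)[OF orth]]
  have sum: "hzero H \<in> hsum H (\<lambda>x. \<gamma> C x \<otimes>\<^bsub>H\<^esub> \<tau> (\<delta> D x)) (C \<inter> D)"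
    if "C \<in> circuits M" "D \<in> cocircuits M" "s = Weak \<longrightarrow> card (C \<inter> D) \<le> 3" for C D
    using orth that by (auto simp: orthogonal_pairs_def)
  define f where "f = case_tutte_gen (hneg H \<one>\<^bsub>H\<^esub>) \<gamma> (\<lambda>D y. \<tau> (\<delta> D y))"
  have f_simps: "f Epsilon = hneg H \<one>\<^bsub>H\<^esub>" "f (Circ C x) = \<gamma> C x" "f (Cocirc D x) = \<tau> (\<delta> D x)" for C D x
    by (simp_all add: f_def)
  obtain \<phi> where \<phi>: "\<phi> \<in> hom T U" "\<And>g. g \<in> tutte_gens M \<Longrightarrow> \<phi> (tutte_class M g) = f g"
  proof (rule ext_tutte_group_universal[of U M f])
    show "comm_group U" by (rule U.comm_group_axioms)
    show "f g \<in> carrier U" if "g \<in> tutte_gens M" for g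
      using that hneg_one_unit \<gamma> \<delta> by (fastforce simp: tutte_gens_def f_simps simp del: hunits_simps)
    show "f Epsilon \<otimes>\<^bsub>U\<^esub> f Epsilon = \<one>\<^bsub>U\<^esub>"
      using hneg_one_square by (simp add: f_simps)
    fix C D x y
    assume CD: "C \<in> circuits M" "D \<in> cocircuits M" "C \<inter> D = {x, y}" "x \<noteq> y"
    then have mem: "x \<in> C" "y \<in> C" "x \<in> D" "y \<in> D" by auto
    have "card (C \<inter> D) \<le> 3" using CD(3,4) by simp
    then have "hzero H \<in> hsum H (\<lambda>x. \<gamma> C x \<otimes>\<^bsub>H\<^esub> \<tau> (\<delta> D x)) {x, y}"
      using sum[OF CD(1,2)] CD(3) by simp
    then have "\<gamma> C x \<otimes>\<^bsub>H\<^esub> \<tau> (\<delta> D x) = hneg H \<one>\<^bsub>H\<^esub> \<otimes>\<^bsub>H\<^esub> (\<gamma> C y \<otimes>\<^bsub>H\<^esub> \<tau> (\<delta> D y))"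
      using \<gamma>[OF CD(1)] \<delta>[OF CD(2)] mem by (subst (asm) zero_in_hsum_pair_iff[OF CD(4)]) auto
    then show "f (Circ C x) \<otimes>\<^bsub>U\<^esub> f (Cocirc D x) = f Epsilon \<otimes>\<^bsub>U\<^esub> f (Circ C y) \<otimes>\<^bsub>U\<^esub> f (Cocirc D y)"
      using \<gamma>[OF CD(1) mem(2)] \<delta>[OF CD(2) mem(4)] hneg_closed[of "\<one>\<^bsub>H\<^esub>"] by (simp add: f_simps m_assoc)
  qed blast
  define \<Phi> where "\<Phi> = restrict \<phi> (carrier T)"
  have eps: "\<Phi> (t_eps M) = hneg H \<one>\<^bsub>H\<^esub>"
    using \<phi>(2)[of Epsilon] t_eps_closed[of M] by (simp add: \<Phi>_def f_simps tutte_gens_def)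
  have circ: "\<Phi> (t_circ M C x) = \<gamma> C x" if "C \<in> circuits M" "x \<in> C" for C x
    using \<phi>(2)[of "Circ C x"] t_circ_closed[OF that] that by (simp add: \<Phi>_def f_simps tutte_gens_def)
  have cocirc: "\<Phi> (t_cocirc M D y) = \<tau> (\<delta> D y)" if "D \<in> cocircuits M" "y \<in> D" for D y
    using \<phi>(2)[of "Cocirc D y"] t_cocirc_closed[OF that] that by (simp add: \<Phi>_def f_simps tutte_gens_def)
  have hom: "\<Phi> \<in> hom T U"
    using \<phi>(1) by (auto simp: \<Phi>_def hom_def)
  have "hsum H (\<lambda>x. \<Phi> (t_circ M C x) \<otimes>\<^bsub>H\<^esub> \<Phi> (t_cocirc M D x)) (C \<inter> D)
      = hsum H (\<lambda>x. \<gamma> C x \<otimes>\<^bsub>H\<^esub> \<tau> (\<delta> D x)) (C \<inter> D)"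
    if "C \<in> circuits M" "D \<in> cocircuits M" for C D
    using that circ cocirc \<gamma>[OF that(1)] \<delta>[OF that(2)] by (intro hsum_cong) auto
  then have "tutte_condition M H s \<Phi>"
    unfolding orthogonal_iff_tutte_condition[OF hom eps, symmetric] using sum by simp
  then have "\<Phi> \<in> tutte_homs M H s T"
    using hom eps by (simp add: tutte_homs_def tutte_hom_def) (simp add: \<Phi>_def)
  then show ?thesis using that circ cocirc by blast
qed

lemma pair_of_hom_eqI:
  assumes orth: "(\<gamma>, \<delta>) \<in> orthogonal_pairs M H \<tau> s"
    and circ: "\<And>C x. C \<in> circuits M \<Longrightarrow> x \<in> C \<Longrightarrow> \<Phi> (t_circ M C x) = \<gamma> C x"
    and cocirc: "\<And>D y. D \<in> cocircuits M \<Longrightarrow> y \<in> D \<Longrightarrow> \<Phi> (t_cocirc M D y) = \<tau> (\<delta> D y)"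
  shows "pair_of_hom M \<tau> \<Phi> = (\<gamma>, \<delta>)"
proof -
  have "(\<lambda>C\<in>circuits M. \<lambda>x\<in>C. \<Phi> (t_circ M C x)) = \<gamma>"
  proof (rule extensionalityI)
    show "\<gamma> \<in> extensional (circuits M)"
      using orthogonal_pairs_signatures(3)[OF orth] by (simp add: circuit_signatures_def PiE_def)
    fix C
    assume C: "C \<in> circuits M"
    then have "\<gamma> C \<in> C \<rightarrow>\<^sub>E carrier U"
      using orthogonal_pairs_signatures(3)[OF orth] unfolding circuit_signatures_def by (rule PiE_mem[rotated])
    then show "(\<lambda>C\<in>circuits M. \<lambda>x\<in>C. \<Phi> (t_circ M C x)) C = \<gamma> C"
      using C circ[OF C] by (intro extensionalityI[of _ C]) (auto simp: PiE_def)
  qed simp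
  moreover have "(\<lambda>D\<in>cocircuits M. \<lambda>y\<in>D. \<tau> (\<Phi> (t_cocirc M D y))) = \<delta>"
  proof (rule extensionalityI)
    show "\<delta> \<in> extensional (cocircuits M)"
      using orthogonal_pairs_signatures(4)[OF orth] by (simp add: cocircuit_signatures_def PiE_def)
    fix D
    assume D: "D \<in> cocircuits M"
    then have \<delta>D: "\<delta> D \<in> D \<rightarrow>\<^sub>E carrier U"
      using orthogonal_pairs_signatures(4)[OF orth] unfolding cocircuit_signatures_def by (rule PiE_mem[rotated])
    have "\<tau> (\<Phi> (t_cocirc M D y)) = \<delta> D y" if "y \<in> D" for y
      using cocirc[OF D that] inv_inv[of "\<delta> D y"] orthogonal_pairs_signatures(2)[OF orth D that] by simp
    then show "(\<lambda>D\<in>cocircuits M. \<lambda>y\<in>D. \<tau> (\<Phi> (t_cocirc M D y))) D = \<delta> D"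
      using D \<delta>D by (intro extensionalityI[of _ D]) (auto simp: PiE_def)
  qed simp
  ultimately show ?thesis by (simp add: pair_of_hom_def)
qed

lemma tutte_homs_eqI:
  assumes "\<Phi> \<in> tutte_homs M H s T" "\<Psi> \<in> tutte_homs M H s T"
    and "\<And>C x. C \<in> circuits M \<Longrightarrow> x \<in> C \<Longrightarrow> \<Phi> (t_circ M C x) = \<Psi> (t_circ M C x)"
    and "\<And>D y. D \<in> cocircuits M \<Longrightarrow> y \<in> D \<Longrightarrow> \<Phi> (t_cocirc M D y) = \<Psi> (t_cocirc M D y)"
  shows "\<Phi> = \<Psi>"
proof (rule extensionalityI)
  show "\<Phi> \<in> extensional (carrier T)" "\<Psi> \<in> extensional (carrier T)"
    using assms(1,2) by (auto simp: tutte_homs_def)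
  show "\<Phi> t = \<Psi> t" if "t \<in> carrier T" for t
    by (rule ext_tutte_hom_eqI[OF U.is_group, of \<Phi> M \<Psi>])
      (use assms that in \<open>auto simp: tutte_homs_def tutte_hom_def\<close>)
qed

lemma pair_of_hom_apply:
  "C \<in> circuits M \<Longrightarrow> x \<in> C \<Longrightarrow> fst (pair_of_hom M \<tau> \<Phi>) C x = \<Phi> (t_circ M C x)"
  "D \<in> cocircuits M \<Longrightarrow> y \<in> D \<Longrightarrow> snd (pair_of_hom M \<tau> \<Phi>) D y = \<tau> (\<Phi> (t_cocirc M D y))"
  by (simp_all add: pair_of_hom_def)

lemma bij_betw_pair_of_hom:
  "bij_betw (pair_of_hom M \<tau>) (tutte_homs M H s T) (orthogonal_pairs M H \<tau> s)"
  unfolding bij_betw_def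
proof
  show "inj_on (pair_of_hom M \<tau>) (tutte_homs M H s T)"
  proof (rule inj_onI)
    fix \<Phi> \<Psi>
    assume homs: "\<Phi> \<in> tutte_homs M H s T" "\<Psi> \<in> tutte_homs M H s T"
      and eq: "pair_of_hom M \<tau> \<Phi> = pair_of_hom M \<tau> \<Psi>"
    show "\<Phi> = \<Psi>"
    proof (rule tutte_homs_eqI[OF homs])
      show "\<Phi> (t_circ M C x) = \<Psi> (t_circ M C x)" if "C \<in> circuits M" "x \<in> C" for C x
        using pair_of_hom_apply(1)[OF that] eq by metis
      show "\<Phi> (t_cocirc M D y) = \<Psi> (t_cocirc M D y)" if "D \<in> cocircuits M" "y \<in> D" for D y
      proof -
        have "\<tau> (\<Phi> (t_cocirc M D y)) = \<tau> (\<Psi> (t_cocirc M D y))"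
          using pair_of_hom_apply(2)[OF that] eq by metis
        moreover have "\<Phi> (t_cocirc M D y) \<in> carrier U" "\<Psi> (t_cocirc M D y) \<in> carrier U"
          using homs hom_in_carrier t_cocirc_closed[OF that] by (fastforce simp: tutte_homs_def tutte_hom_def simp del: hunits_simps)+
        ultimately show ?thesis using inv_inv by (metis DiffD1 hunits_simps(1))
      qed
    qed
  qed
  show "pair_of_hom M \<tau> ` tutte_homs M H s T = orthogonal_pairs M H \<tau> s"
  proof
    show "pair_of_hom M \<tau> ` tutte_homs M H s T \<subseteq> orthogonal_pairs M H \<tau> s"
      using pair_of_hom_orthogonal by (auto simp: tutte_homs_def)
    show "orthogonal_pairs M H \<tau> s \<subseteq> pair_of_hom M \<tau> ` tutte_homs M H s T"
    proof (clarify)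
      fix \<gamma> \<delta>
      assume orth: "(\<gamma>, \<delta>) \<in> orthogonal_pairs M H \<tau> s"
      then obtain \<Phi> where \<Phi>: "\<Phi> \<in> tutte_homs M H s T"
        "\<And>C x. C \<in> circuits M \<Longrightarrow> x \<in> C \<Longrightarrow> \<Phi> (t_circ M C x) = \<gamma> C x"
        "\<And>D y. D \<in> cocircuits M \<Longrightarrow> y \<in> D \<Longrightarrow> \<Phi> (t_cocirc M D y) = \<tau> (\<delta> D y)"
        using hom_of_orthogonal_pair by blast
      have "pair_of_hom M \<tau> \<Phi> = (\<gamma>, \<delta>)" by (rule pair_of_hom_eqI[OF orth \<Phi>(2,3)])
      then show "(\<gamma>, \<delta>) \<in> pair_of_hom M \<tau> ` tutte_homs M H s T" using \<Phi>(1) by (metis imageI)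
    qed
  qed
qed

section \<open>Hyperfield matroids and rescaling classes\<close>

abbreviation agree_on where
  "agree_on S \<Phi> \<Psi> \<equiv> \<forall>t\<in>carrier S. \<Phi> t = \<Psi> t"

text \<open>Both sides are homomorphisms, so generators suffice, and \<epsilon> has degree zero. The
  formulas at the generators are the degrees evaluated under \<chi>; they cover rescaling of
  circuits and cocircuits and rescaling of elements in one form.\<close>

lemma twisted_hom_eqI:
  assumes \<Phi>: "tutte_hom M H s T \<Phi>" and \<Psi>: "tutte_hom M H s' T \<Psi>" and \<chi>: "\<chi> \<in> hom (degree_group M) U"
    and circ: "\<And>C x. C \<in> circuits M \<Longrightarrow> x \<in> C \<Longrightarrow>
      \<Phi> (t_circ M C x) = \<chi> (frag_of (Inl x)) \<otimes>\<^bsub>H\<^esub> \<chi> (frag_of (Inr (Inl C))) \<otimes>\<^bsub>H\<^esub> \<Psi> (t_circ M C x)"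
    and cocirc: "\<And>D y. D \<in> cocircuits M \<Longrightarrow> y \<in> D \<Longrightarrow>
      \<Phi> (t_cocirc M D y) = inv\<^bsub>U\<^esub> \<chi> (frag_of (Inl y)) \<otimes>\<^bsub>H\<^esub> \<chi> (frag_of (Inr (Inr D))) \<otimes>\<^bsub>H\<^esub> \<Psi> (t_cocirc M D y)"
    and t: "t \<in> carrier T"
  shows "\<Phi> t = \<Psi> t \<otimes>\<^bsub>U\<^esub> \<chi> (tutte_degree t)"
proof (rule ext_tutte_hom_eqI[OF U.is_group, of \<Phi> M "\<lambda>t. \<Psi> t \<otimes>\<^bsub>U\<^esub> \<chi> (tutte_degree t)"])
  have hom: "\<Phi> \<in> hom T U" "\<Psi> \<in> hom T U" and eps: "\<Phi> (t_eps M) = \<Psi> (t_eps M)"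
    using \<Phi> \<Psi> by (simp_all add: tutte_hom_def)
  show "\<Phi> \<in> hom T U" by fact
  show "(\<lambda>t. \<Psi> t \<otimes>\<^bsub>U\<^esub> \<chi> (tutte_degree t)) \<in> hom T U"
    by (rule hom_mult_pointwise[OF U.comm_group_axioms hom(2) tutte_degree_pullback[OF \<chi>]])
  show "\<Phi> (t_eps M) = \<Psi> (t_eps M) \<otimes>\<^bsub>U\<^esub> \<chi> (tutte_degree (t_eps M))"
    using eps hom_in_carrier[OF hom(2) t_eps_closed] U.r_one hom_degree_zero[OF \<chi> U.is_group]
    by (simp add: tutte_degree_gen)
  fix A x
  assume "A \<in> circuits M" "x \<in> A"
  then show "\<Phi> (t_circ M A x) = \<Psi> (t_circ M A x) \<otimes>\<^bsub>U\<^esub> \<chi> (tutte_degree (t_circ M A x))"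
    using circ hom_degree_circ[OF \<chi>] hom_in_carrier[OF hom(2) t_circ_closed]
      hom_in_carrier[OF tutte_degree_pullback[OF \<chi>] t_circ_closed] by (simp add: m_comm)
next
  fix D y
  assume "D \<in> cocircuits M" "y \<in> D"
  then show "\<Phi> (t_cocirc M D y) = \<Psi> (t_cocirc M D y) \<otimes>\<^bsub>U\<^esub> \<chi> (tutte_degree (t_cocirc M D y))"
    using cocirc hom_degree_cocirc[OF \<chi> U.is_group] \<Psi> hom_in_carrier[OF _ t_cocirc_closed, of \<Psi> M U]
      hom_in_carrier[OF tutte_degree_pullback[OF \<chi>] t_cocirc_closed] by (simp add: m_comm tutte_hom_def)
qed (rule t)

text \<open>Translates scalars into \<chi>: \<open>b C\<close> is its value at the unit vector of
  \<open>C\<close>, and the \<tau>-image of \<open>l D\<close> its value at that of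
  \<open>D\<close>, since \<Phi> and \<delta> differ by \<open>\<tau>\<close> on cocircuits.
  Elements are not rescaled, which is the normalisation of \<chi> characterising agreement on the
  Tutte group.\<close>

lemma sim_rel_iff:
  assumes \<Phi>: "tutte_hom M H s T \<Phi>" and \<Psi>: "tutte_hom M H s T \<Psi>"
  shows "(pair_of_hom M \<tau> \<Phi>, pair_of_hom M \<tau> \<Psi>) \<in> sim_rel M H \<tau> s \<longleftrightarrow> agree_on (tutte_group M) \<Phi> \<Psi>"
proof
  have hom: "\<Phi> \<in> hom T U" "\<Psi> \<in> hom T U" using \<Phi> \<Psi> by (simp_all add: tutte_hom_def)
  note circ_in = hom_in_carrier[OF hom(1) t_circ_closed] hom_in_carrier[OF hom(2) t_circ_closed]
  note cocirc_in = hom_in_carrier[OF hom(1) t_cocirc_closed] hom_in_carrier[OF hom(2) t_cocirc_closed]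
  {
    assume "(pair_of_hom M \<tau> \<Phi>, pair_of_hom M \<tau> \<Psi>) \<in> sim_rel M H \<tau> s"
    then obtain b l where b: "b \<in> circuits M \<rightarrow> carrier U" and l: "l \<in> cocircuits M \<rightarrow> carrier U"
      and circ: "\<And>C x. C \<in> circuits M \<Longrightarrow> x \<in> C \<Longrightarrow> \<Phi> (t_circ M C x) = b C \<otimes>\<^bsub>H\<^esub> \<Psi> (t_circ M C x)"
      and cocirc: "\<And>D y. D \<in> cocircuits M \<Longrightarrow> y \<in> D \<Longrightarrow>
        \<tau> (\<Phi> (t_cocirc M D y)) = l D \<otimes>\<^bsub>H\<^esub> \<tau> (\<Psi> (t_cocirc M D y))"
      by (auto simp: sim_rel_def pair_of_hom_def simp del: hunits_simps)
    have b_in: "b C \<in> carrier U" if "C \<in> circuits M" for C using b that by blast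
    have l_in: "\<tau> (l D) \<in> carrier U" "l D \<in> carrier U" if "D \<in> cocircuits M" for D
      using l that inv_unit by blast+
    obtain \<chi> where \<chi>: "\<chi> \<in> hom (degree_group M) U"
      "\<And>x. x \<in> ground M \<Longrightarrow> \<chi> (frag_of (Inl x)) = \<one>\<^bsub>U\<^esub>"
      "\<And>C. C \<in> circuits M \<Longrightarrow> \<chi> (frag_of (Inr (Inl C))) = b C"
      "\<And>D. D \<in> cocircuits M \<Longrightarrow> \<chi> (frag_of (Inr (Inr D))) = \<tau> (l D)"
      using degree_group_universal[OF U.comm_group_axioms, of M "\<lambda>_. \<one>\<^bsub>U\<^esub>" b "\<lambda>D. \<tau> (l D)"]
        U.one_closed b_in l_in by metis
    have "\<forall>t\<in>carrier T. \<Phi> t = \<Psi> t \<otimes>\<^bsub>U\<^esub> \<chi> (tutte_degree t)"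
    proof (intro ballI twisted_hom_eqI[OF \<Phi> \<Psi> \<chi>(1)])
      fix C x
      assume "C \<in> circuits M" "x \<in> C"
      moreover from this have "x \<in> ground M" using circuits_subset_ground by blast
      ultimately show "\<Phi> (t_circ M C x)
          = \<chi> (frag_of (Inl x)) \<otimes>\<^bsub>H\<^esub> \<chi> (frag_of (Inr (Inl C))) \<otimes>\<^bsub>H\<^esub> \<Psi> (t_circ M C x)"
        using circ b_in \<chi> by simp
    next
      fix D y
      assume D: "D \<in> cocircuits M" "y \<in> D"
      then have "y \<in> ground M" using cocircuits_subset_ground by blast
      moreover have "\<Phi> (t_cocirc M D y) = \<tau> (l D) \<otimes>\<^bsub>H\<^esub> \<Psi> (t_cocirc M D y)"
      proof -
        have "\<Phi> (t_cocirc M D y) = \<tau> (\<tau> (\<Phi> (t_cocirc M D y)))"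
          using cocirc_in(1)[OF D] by (simp add: inv_inv)
        also have "\<dots> = \<tau> (l D) \<otimes>\<^bsub>H\<^esub> \<Psi> (t_cocirc M D y)"
          using cocirc_in(2)[OF D] l_in(2)[OF D(1)] cocirc[OF D] by (simp add: inv_inv inv_mult inv_closed)
        finally show ?thesis .
      qed
      ultimately show "\<Phi> (t_cocirc M D y)
          = inv\<^bsub>U\<^esub> \<chi> (frag_of (Inl y)) \<otimes>\<^bsub>H\<^esub> \<chi> (frag_of (Inr (Inr D))) \<otimes>\<^bsub>H\<^esub> \<Psi> (t_cocirc M D y)"
        using l_in[OF D(1)] \<chi>(2,4) D(1) U.inv_one by simp
    qed
    then show "agree_on (tutte_group M) \<Phi> \<Psi>"
      unfolding agree_on_tutte_group_iff[OF nonempty U.comm_group_axioms hom] using \<chi>(1,2) by blast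
  }
  assume "agree_on (tutte_group M) \<Phi> \<Psi>"
  then obtain \<chi> where \<chi>: "\<chi> \<in> hom (degree_group M) U" "\<And>x. x \<in> ground M \<Longrightarrow> \<chi> (frag_of (Inl x)) = \<one>\<^bsub>U\<^esub>"
    "\<And>t. t \<in> carrier T \<Longrightarrow> \<Phi> t = \<Psi> t \<otimes>\<^bsub>U\<^esub> \<chi> (tutte_degree t)"
    unfolding agree_on_tutte_group_iff[OF nonempty U.comm_group_axioms hom] by blast
  define b where "b C = \<chi> (frag_of (Inr (Inl C)))" for C
  define l where "l D = \<tau> (\<chi> (frag_of (Inr (Inr D))))" for D
  have b: "b \<in> circuits M \<rightarrow> carrier U" and l: "l \<in> cocircuits M \<rightarrow> carrier U"
    using hom_degree_frag_closed[OF \<chi>(1)] inv_unit unfolding b_def l_def by blast+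
  have circ: "\<Phi> (t_circ M C x) = b C \<otimes>\<^bsub>H\<^esub> \<Psi> (t_circ M C x)" if C: "C \<in> circuits M" "x \<in> C" for C x
  proof -
    have "x \<in> ground M" using C circuits_subset_ground by blast
    then show ?thesis
      using \<chi>(3)[OF t_circ_closed[OF C]] hom_degree_circ[OF \<chi>(1) C] \<chi>(2)
        hom_degree_frag_closed(2)[OF \<chi>(1) C(1)] circ_in(2)[OF C] by (simp add: b_def m_comm)
  qed
  have cocirc: "\<tau> (\<Phi> (t_cocirc M D y)) = l D \<otimes>\<^bsub>H\<^esub> \<tau> (\<Psi> (t_cocirc M D y))"
    if D: "D \<in> cocircuits M" "y \<in> D" for D y
  proof -
    have "y \<in> ground M" using D cocircuits_subset_ground by blast
    then have "\<Phi> (t_cocirc M D y) = \<chi> (frag_of (Inr (Inr D))) \<otimes>\<^bsub>H\<^esub> \<Psi> (t_cocirc M D y)"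
      using \<chi>(3)[OF t_cocirc_closed[OF D]] hom_degree_cocirc[OF \<chi>(1) U.is_group D] \<chi>(2)
        hom_degree_frag_closed(3)[OF \<chi>(1) D(1)] cocirc_in(2)[OF D] U.inv_one by (simp add: m_comm)
    then show ?thesis
      using hom_degree_frag_closed(3)[OF \<chi>(1) D(1)] cocirc_in(2)[OF D] by (simp add: l_def inv_mult)
  qed
  show "(pair_of_hom M \<tau> \<Phi>, pair_of_hom M \<tau> \<Psi>) \<in> sim_rel M H \<tau> s"
    using pair_of_hom_orthogonal[OF \<Phi>] pair_of_hom_orthogonal[OF \<Psi>] b l circ cocirc
    by (auto simp: sim_rel_def pair_of_hom_def simp del: hunits_simps)
qed

text \<open>Here \<chi> takes the value \<open>h x\<close> at elements and one at circuits and
  cocircuits. The inverse in the rescaling of cocircuits matches the sign -1 of elements in their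
  degrees, and its \<open>\<tau>\<close> disappears on passing from \<delta> back to \<Phi>.\<close>

lemma approx_rel_imp_agree:
  assumes \<Phi>: "tutte_hom M H s T \<Phi>" and \<Psi>: "tutte_hom M H s T \<Psi>"
    and approx: "(pair_of_hom M \<tau> \<Phi>, pair_of_hom M \<tau> \<Psi>) \<in> approx_rel M H \<tau> s"
  shows "agree_on (inner_tutte_group M) \<Phi> \<Psi>"
proof -
  have hom: "\<Phi> \<in> hom T U" "\<Psi> \<in> hom T U" using \<Phi> \<Psi> by (simp_all add: tutte_hom_def)
  note circ_in = hom_in_carrier[OF hom(2) t_circ_closed]
  note cocirc_in = hom_in_carrier[OF hom(1) t_cocirc_closed] hom_in_carrier[OF hom(2) t_cocirc_closed]
  from approx obtain h where h: "h \<in> ground M \<rightarrow> carrier U"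
    and circ: "\<And>C x. C \<in> circuits M \<Longrightarrow> x \<in> C \<Longrightarrow> \<Phi> (t_circ M C x) = h x \<otimes>\<^bsub>H\<^esub> \<Psi> (t_circ M C x)"
    and cocirc: "\<And>D y. D \<in> cocircuits M \<Longrightarrow> y \<in> D \<Longrightarrow>
      \<tau> (\<Phi> (t_cocirc M D y)) = \<tau> (inv\<^bsub>U\<^esub> (h y)) \<otimes>\<^bsub>H\<^esub> \<tau> (\<Psi> (t_cocirc M D y))"
    by (auto simp: approx_rel_def pair_of_hom_def simp del: hunits_simps)
  have h_in: "h x \<in> carrier U" if "x \<in> ground M" for x using h that by blast
  obtain \<chi> where \<chi>: "\<chi> \<in> hom (degree_group M) U"
    "\<And>x. x \<in> ground M \<Longrightarrow> \<chi> (frag_of (Inl x)) = h x"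
    "\<And>C. C \<in> circuits M \<Longrightarrow> \<chi> (frag_of (Inr (Inl C))) = \<one>\<^bsub>U\<^esub>"
    "\<And>D. D \<in> cocircuits M \<Longrightarrow> \<chi> (frag_of (Inr (Inr D))) = \<one>\<^bsub>U\<^esub>"
    using degree_group_universal[OF U.comm_group_axioms, of M h "\<lambda>_. \<one>\<^bsub>U\<^esub>" "\<lambda>_. \<one>\<^bsub>U\<^esub>"]
      U.one_closed h_in by metis
  have "\<forall>t\<in>carrier T. \<Phi> t = \<Psi> t \<otimes>\<^bsub>U\<^esub> \<chi> (tutte_degree t)"
  proof (intro ballI twisted_hom_eqI[OF \<Phi> \<Psi> \<chi>(1)])
    fix C x
    assume "C \<in> circuits M" "x \<in> C"
    moreover from this have "x \<in> ground M" using circuits_subset_ground by blast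
    ultimately show "\<Phi> (t_circ M C x)
        = \<chi> (frag_of (Inl x)) \<otimes>\<^bsub>H\<^esub> \<chi> (frag_of (Inr (Inl C))) \<otimes>\<^bsub>H\<^esub> \<Psi> (t_circ M C x)"
      using circ h_in[of x] \<chi> by simp
  next
    fix D y
    assume D: "D \<in> cocircuits M" "y \<in> D"
    then have y: "y \<in> ground M" using cocircuits_subset_ground by blast
    have hy: "inv\<^bsub>U\<^esub> (h y) \<in> carrier U" using h_in[OF y] by (rule U.inv_closed)
    have "\<Phi> (t_cocirc M D y) = \<tau> (\<tau> (\<Phi> (t_cocirc M D y)))"
      using cocirc_in(1)[OF D] by (simp add: inv_inv)
    also have "\<dots> = inv\<^bsub>U\<^esub> (h y) \<otimes>\<^bsub>H\<^esub> \<Psi> (t_cocirc M D y)"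
      using cocirc_in(2)[OF D] hy cocirc[OF D] by (simp add: inv_inv inv_mult inv_closed)
    finally show "\<Phi> (t_cocirc M D y)
        = inv\<^bsub>U\<^esub> \<chi> (frag_of (Inl y)) \<otimes>\<^bsub>H\<^esub> \<chi> (frag_of (Inr (Inr D))) \<otimes>\<^bsub>H\<^esub> \<Psi> (t_cocirc M D y)"
      using hy \<chi>(2,4) D(1) y by simp
  qed
  then show ?thesis
    unfolding agree_on_inner_iff[OF nonempty U.comm_group_axioms hom] using \<chi>(1) by blast
qed

text \<open>The homomorphism \<chi> relating \<Phi> to \<Psi> is factored into \<eta>, which keeps
  only its values at elements, and a quotient trivial on elements. Twisting \<Psi> by \<eta> alone
  gives the intermediate \<open>\<Phi>'\<close>: it differs from \<Psi> by rescaling elements and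
  from \<Phi> by scaling circuits and cocircuits. It still satisfies the cross ratio condition
  because it equals \<Psi> on the inner Tutte group.\<close>

lemma agree_imp_sim_approx:
  assumes \<Phi>: "tutte_hom M H s T \<Phi>" and \<Psi>: "tutte_hom M H s T \<Psi>"
    and agree: "agree_on (inner_tutte_group M) \<Phi> \<Psi>"
  obtains \<Phi>' where "tutte_hom M H s T \<Phi>'"
    "(pair_of_hom M \<tau> \<Phi>, pair_of_hom M \<tau> \<Phi>') \<in> sim_rel M H \<tau> s"
    "(pair_of_hom M \<tau> \<Phi>', pair_of_hom M \<tau> \<Psi>) \<in> approx_rel M H \<tau> s"
proof -
  have hom: "\<Phi> \<in> hom T U" "\<Psi> \<in> hom T U" using \<Phi> \<Psi> by (simp_all add: tutte_hom_def)
  obtain \<chi> where \<chi>: "\<chi> \<in> hom (degree_group M) U"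
    "\<And>t. t \<in> carrier T \<Longrightarrow> \<Phi> t = \<Psi> t \<otimes>\<^bsub>U\<^esub> \<chi> (tutte_degree t)"
    using agree unfolding agree_on_inner_iff[OF nonempty U.comm_group_axioms hom] by blast
  note \<chi>_in = hom_degree_frag_closed[OF \<chi>(1)]
  obtain \<eta> where \<eta>: "\<eta> \<in> hom (degree_group M) U"
    "\<And>x. x \<in> ground M \<Longrightarrow> \<eta> (frag_of (Inl x)) = \<chi> (frag_of (Inl x))"
    "\<And>C. C \<in> circuits M \<Longrightarrow> \<eta> (frag_of (Inr (Inl C))) = \<one>\<^bsub>U\<^esub>"
    "\<And>D. D \<in> cocircuits M \<Longrightarrow> \<eta> (frag_of (Inr (Inr D))) = \<one>\<^bsub>U\<^esub>"
    using degree_group_universal[OF U.comm_group_axioms, of M "\<lambda>x. \<chi> (frag_of (Inl x))"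
        "\<lambda>_. \<one>\<^bsub>U\<^esub>" "\<lambda>_. \<one>\<^bsub>U\<^esub>"] U.one_closed \<chi>_in(1) by metis
  define \<Phi>' where "\<Phi>' t = \<Psi> t \<otimes>\<^bsub>U\<^esub> \<eta> (tutte_degree t)" for t
  have hom': "\<Phi>' \<in> hom T U"
    unfolding \<Phi>'_def[abs_def]
    by (rule hom_mult_pointwise[OF U.comm_group_axioms hom(2) tutte_degree_pullback[OF \<eta>(1)]])
  have agree': "agree_on (inner_tutte_group M) \<Phi>' \<Psi>"
    unfolding agree_on_inner_iff[OF nonempty U.comm_group_axioms hom' hom(2)]
    using \<eta>(1) by (intro bexI[of _ \<eta>]) (simp_all add: \<Phi>'_def)
  have \<Phi>': "tutte_hom M H s T \<Phi>'"
  proof -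
    have "tutte_condition M H s \<Phi>'"
    proof (rule tutte_condition_cong)
      show "\<Phi>' t = \<Psi> t" if "t \<in> carrier (inner_tutte_group M)" for t
        using agree' that by blast
      show "\<Psi> t \<in> carrier H" if "t \<in> carrier (inner_tutte_group M)" for t
        using hom_in_carrier[OF hom(2), of t] that by (simp add: carrier_inner_tutte_group)
      show "tutte_condition M H s \<Psi>" using \<Psi> by (simp add: tutte_hom_def)
    qed
    then show ?thesis
      using hom' agree' t_eps_inner[of M] \<Psi> by (simp add: tutte_hom_def)
  qed
  have "agree_on (tutte_group M) \<Phi> \<Phi>'"
    unfolding agree_on_tutte_group_iff[OF nonempty U.comm_group_axioms hom(1) hom']
  proof (intro bexI conjI ballI)
    let ?\<zeta> = "\<lambda>d. \<chi> d \<otimes>\<^bsub>U\<^esub> inv\<^bsub>U\<^esub> \<eta> d"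
    show "?\<zeta> \<in> hom (degree_group M) U"
      by (intro hom_mult_pointwise hom_inv_pointwise U.comm_group_axioms \<chi>(1) \<eta>(1))
    show "?\<zeta> (frag_of (Inl x)) = \<one>\<^bsub>U\<^esub>" if "x \<in> ground M" for x
      unfolding \<eta>(2)[OF that] by (rule U.r_inv[OF \<chi>_in(1)[OF that]])
    show "\<Phi> t = \<Phi>' t \<otimes>\<^bsub>U\<^esub> ?\<zeta> (tutte_degree t)" if t: "t \<in> carrier T" for t
    proof -
      let ?a = "\<Psi> t" and ?c = "\<chi> (tutte_degree t)" and ?e = "\<eta> (tutte_degree t)"
      have in_U: "?a \<in> carrier U" "?c \<in> carrier U" "?e \<in> carrier U"
        using hom_in_carrier[OF hom(2) t] hom_in_carrier[OF tutte_degree_pullback[OF \<chi>(1)] t]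
          hom_in_carrier[OF tutte_degree_pullback[OF \<eta>(1)] t] by blast+
      have "(?a \<otimes>\<^bsub>U\<^esub> ?e) \<otimes>\<^bsub>U\<^esub> (?c \<otimes>\<^bsub>U\<^esub> inv\<^bsub>U\<^esub> ?e) = (?a \<otimes>\<^bsub>U\<^esub> ?c) \<otimes>\<^bsub>U\<^esub> (?e \<otimes>\<^bsub>U\<^esub> inv\<^bsub>U\<^esub> ?e)"
        using in_U U.inv_closed[OF in_U(3)] by (simp only: U.m_ac U.m_closed)
      also have "\<dots> = ?a \<otimes>\<^bsub>U\<^esub> ?c"
        using in_U by (simp only: U.r_inv U.r_one U.m_closed)
      finally show ?thesis
        unfolding \<chi>(2)[OF t] \<Phi>'_def ..
    qed
  qed
  then have sim: "(pair_of_hom M \<tau> \<Phi>, pair_of_hom M \<tau> \<Phi>') \<in> sim_rel M H \<tau> s"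
    using sim_rel_iff[OF \<Phi> \<Phi>'] by blast
  define h where "h x = \<chi> (frag_of (Inl x))" for x
  have h: "h \<in> ground M \<rightarrow> carrier U" using \<chi>_in(1) unfolding h_def by blast
  have circ: "\<Phi>' (t_circ M C x) = h x \<otimes>\<^bsub>H\<^esub> \<Psi> (t_circ M C x)" if C: "C \<in> circuits M" "x \<in> C" for C x
  proof -
    have "x \<in> ground M" using C circuits_subset_ground by blast
    then show ?thesis
      using \<eta> C hom_degree_circ[OF \<eta>(1) C] \<chi>_in(1)[of x] hom_in_carrier[OF hom(2) t_circ_closed[OF C]]
      by (simp add: \<Phi>'_def h_def m_comm)
  qed
  have cocirc: "\<tau> (\<Phi>' (t_cocirc M D y)) = \<tau> (inv\<^bsub>U\<^esub> (h y)) \<otimes>\<^bsub>H\<^esub> \<tau> (\<Psi> (t_cocirc M D y))"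
    if D: "D \<in> cocircuits M" "y \<in> D" for D y
  proof -
    have y: "y \<in> ground M" using D cocircuits_subset_ground by blast
    have hy: "inv\<^bsub>U\<^esub> (h y) \<in> carrier U" using \<chi>_in(1)[OF y] unfolding h_def by (rule U.inv_closed)
    have "\<Phi>' (t_cocirc M D y) = inv\<^bsub>U\<^esub> (h y) \<otimes>\<^bsub>H\<^esub> \<Psi> (t_cocirc M D y)"
      using hy \<eta> D y hom_degree_cocirc[OF \<eta>(1) U.is_group D] hom_in_carrier[OF hom(2) t_cocirc_closed[OF D]]
      by (simp add: \<Phi>'_def h_def m_comm)
    then show ?thesis
      using hy hom_in_carrier[OF hom(2) t_cocirc_closed[OF D]] by (simp add: inv_mult)
  qed
  have "(pair_of_hom M \<tau> \<Phi>', pair_of_hom M \<tau> \<Psi>) \<in> approx_rel M H \<tau> s"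
    using pair_of_hom_orthogonal[OF \<Phi>'] pair_of_hom_orthogonal[OF \<Psi>] h circ cocirc
    by (auto simp: approx_rel_def pair_of_hom_def simp del: hunits_simps)
  with \<Phi>' sim show ?thesis by (rule that)
qed

text \<open>Every pair in the class comes from a homomorphism because \<open>pair_of_hom\<close> is
  onto the orthogonal pairs. In this form symmetry and transitivity are those of equality of values
  on the Tutte group.\<close>

lemma matroid_of_pair_of_hom:
  assumes "tutte_hom M H s T \<Phi>"
  shows "matroid_of_pair M H \<tau> s (pair_of_hom M \<tau> \<Phi>)
    = pair_of_hom M \<tau> ` {\<Psi> \<in> tutte_homs M H s T. agree_on (tutte_group M) \<Phi> \<Psi>}"
proof -
  have "sim_rel M H \<tau> s `` {p} \<subseteq> orthogonal_pairs M H \<tau> s" for p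
    by (auto simp: sim_rel_def)
  then have "sim_rel M H \<tau> s `` {p} \<subseteq> pair_of_hom M \<tau> ` tutte_homs M H s T" for p
    using bij_betw_pair_of_hom by (simp add: bij_betw_def)
  then show ?thesis
    using sim_rel_iff[OF assms] unfolding matroid_of_pair_def tutte_homs_def by blast
qed

lemma matroid_of_pair_in: "p \<in> orthogonal_pairs M H \<tau> s \<Longrightarrow> matroid_of_pair M H \<tau> s p \<in> hyperfield_matroids M H \<tau> s"
  by (simp add: matroid_of_pair_def hyperfield_matroids_def quotientI)

lemma hyperfield_matroids_eq:
  "hyperfield_matroids M H \<tau> s
    = (\<lambda>\<Phi>. matroid_of_pair M H \<tau> s (pair_of_hom M \<tau> \<Phi>)) ` tutte_homs M H s T"
proof -
  have "hyperfield_matroids M H \<tau> s = matroid_of_pair M H \<tau> s ` orthogonal_pairs M H \<tau> s"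
    by (auto simp: hyperfield_matroids_def matroid_of_pair_def quotient_def)
  also have "orthogonal_pairs M H \<tau> s = pair_of_hom M \<tau> ` tutte_homs M H s T"
    using bij_betw_pair_of_hom[of s] by (simp add: bij_betw_def)
  finally show ?thesis unfolding image_image .
qed

lemma matroid_of_pair_eq_iff:
  assumes "tutte_hom M H s T \<Phi>" "tutte_hom M H s T \<Psi>"
  shows "matroid_of_pair M H \<tau> s (pair_of_hom M \<tau> \<Phi>) = matroid_of_pair M H \<tau> s (pair_of_hom M \<tau> \<Psi>)
    \<longleftrightarrow> agree_on (tutte_group M) \<Phi> \<Psi>"
proof
  assume eq: "matroid_of_pair M H \<tau> s (pair_of_hom M \<tau> \<Phi>) = matroid_of_pair M H \<tau> s (pair_of_hom M \<tau> \<Psi>)"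
  have "(pair_of_hom M \<tau> \<Psi>, pair_of_hom M \<tau> \<Psi>) \<in> sim_rel M H \<tau> s"
    using sim_rel_iff[OF assms(2,2)] by blast
  then have "(pair_of_hom M \<tau> \<Phi>, pair_of_hom M \<tau> \<Psi>) \<in> sim_rel M H \<tau> s"
    using eq by (auto simp: matroid_of_pair_def)
  then show "agree_on (tutte_group M) \<Phi> \<Psi>"
    using sim_rel_iff[OF assms] by blast
next
  assume "agree_on (tutte_group M) \<Phi> \<Psi>"
  then have "{\<Xi> \<in> tutte_homs M H s T. agree_on (tutte_group M) \<Phi> \<Xi>}
      = {\<Xi> \<in> tutte_homs M H s T. agree_on (tutte_group M) \<Psi> \<Xi>}"
    by auto
  then show "matroid_of_pair M H \<tau> s (pair_of_hom M \<tau> \<Phi>) = matroid_of_pair M H \<tau> s (pair_of_hom M \<tau> \<Psi>)"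
    unfolding matroid_of_pair_of_hom[OF assms(1)] matroid_of_pair_of_hom[OF assms(2)] by (rule arg_cong)
qed

text \<open>Representatives may be replaced on both sides, but that only changes the homomorphisms
  off the Tutte group, which contains the inner one. Conversely it suffices to move the first
  representative: the intermediate homomorphism stands for \<Phi>, while \<Psi> represents
  itself.\<close>

lemma cong_rel_iff:
  assumes \<Phi>: "tutte_hom M H s T \<Phi>" and \<Psi>: "tutte_hom M H s T \<Psi>"
  shows "(matroid_of_pair M H \<tau> s (pair_of_hom M \<tau> \<Phi>), matroid_of_pair M H \<tau> s (pair_of_hom M \<tau> \<Psi>))
      \<in> cong_rel M H \<tau> s \<longleftrightarrow> agree_on (inner_tutte_group M) \<Phi> \<Psi>"
proof
  note inner_sub = subsetD[OF inner_subset_tutte_group[OF nonempty]]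
  assume "(matroid_of_pair M H \<tau> s (pair_of_hom M \<tau> \<Phi>), matroid_of_pair M H \<tau> s (pair_of_hom M \<tau> \<Psi>))
      \<in> cong_rel M H \<tau> s"
  then obtain p q where "p \<in> matroid_of_pair M H \<tau> s (pair_of_hom M \<tau> \<Phi>)"
    "q \<in> matroid_of_pair M H \<tau> s (pair_of_hom M \<tau> \<Psi>)" "(p, q) \<in> approx_rel M H \<tau> s"
    by (auto simp: cong_rel_def)
  then obtain \<Phi>' \<Psi>' where "tutte_hom M H s T \<Phi>'" "agree_on (tutte_group M) \<Phi> \<Phi>'"
    "tutte_hom M H s T \<Psi>'" "agree_on (tutte_group M) \<Psi> \<Psi>'"
    "(pair_of_hom M \<tau> \<Phi>', pair_of_hom M \<tau> \<Psi>') \<in> approx_rel M H \<tau> s"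
    unfolding matroid_of_pair_of_hom[OF \<Phi>] matroid_of_pair_of_hom[OF \<Psi>] by (auto simp: tutte_homs_def)
  then show "agree_on (inner_tutte_group M) \<Phi> \<Psi>"
    using approx_rel_imp_agree inner_sub by metis
next
  assume "agree_on (inner_tutte_group M) \<Phi> \<Psi>"
  then obtain \<Phi>' where \<Phi>': "tutte_hom M H s T \<Phi>'"
    "(pair_of_hom M \<tau> \<Phi>, pair_of_hom M \<tau> \<Phi>') \<in> sim_rel M H \<tau> s"
    "(pair_of_hom M \<tau> \<Phi>', pair_of_hom M \<tau> \<Psi>) \<in> approx_rel M H \<tau> s"
    using agree_imp_sim_approx[OF \<Phi> \<Psi>] by blast
  have "(pair_of_hom M \<tau> \<Psi>, pair_of_hom M \<tau> \<Psi>) \<in> sim_rel M H \<tau> s"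
    using sim_rel_iff[OF \<Psi> \<Psi>] by blast
  then have "pair_of_hom M \<tau> \<Psi> \<in> matroid_of_pair M H \<tau> s (pair_of_hom M \<tau> \<Psi>)"
    "pair_of_hom M \<tau> \<Phi>' \<in> matroid_of_pair M H \<tau> s (pair_of_hom M \<tau> \<Phi>)"
    using \<Phi>'(2) by (simp_all add: matroid_of_pair_def)
  then show "(matroid_of_pair M H \<tau> s (pair_of_hom M \<tau> \<Phi>), matroid_of_pair M H \<tau> s (pair_of_hom M \<tau> \<Psi>))
      \<in> cong_rel M H \<tau> s"
    unfolding cong_rel_def
    using \<Phi>'(3) matroid_of_pair_in[OF pair_of_hom_orthogonal[OF \<Phi>]]
      matroid_of_pair_in[OF pair_of_hom_orthogonal[OF \<Psi>]] by blast
qed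

lemma rescaling_class_of_pair_of_hom:
  assumes "tutte_hom M H s T \<Phi>"
  shows "rescaling_class_of_pair M H \<tau> s (pair_of_hom M \<tau> \<Phi>)
    = (\<lambda>\<Psi>. matroid_of_pair M H \<tau> s (pair_of_hom M \<tau> \<Psi>)) `
        {\<Psi> \<in> tutte_homs M H s T. agree_on (inner_tutte_group M) \<Phi> \<Psi>}"
proof -
  have "cong_rel M H \<tau> s `` {X} \<subseteq> hyperfield_matroids M H \<tau> s" for X
    by (auto simp: cong_rel_def)
  then have "cong_rel M H \<tau> s `` {X}
      \<subseteq> (\<lambda>\<Psi>. matroid_of_pair M H \<tau> s (pair_of_hom M \<tau> \<Psi>)) ` tutte_homs M H s T" for X
    by (simp add: hyperfield_matroids_eq)
  then show ?thesis
    using cong_rel_iff[OF assms] unfolding rescaling_class_of_pair_def tutte_homs_def by blast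
qed

lemma rescaling_class_of_pair_eq_iff:
  assumes "tutte_hom M H s T \<Phi>" "tutte_hom M H s T \<Psi>"
  shows "rescaling_class_of_pair M H \<tau> s (pair_of_hom M \<tau> \<Phi>)
      = rescaling_class_of_pair M H \<tau> s (pair_of_hom M \<tau> \<Psi>)
    \<longleftrightarrow> agree_on (inner_tutte_group M) \<Phi> \<Psi>"
proof
  let ?cl = "\<lambda>\<Phi>. matroid_of_pair M H \<tau> s (pair_of_hom M \<tau> \<Phi>)"
  assume eq: "rescaling_class_of_pair M H \<tau> s (pair_of_hom M \<tau> \<Phi>)
      = rescaling_class_of_pair M H \<tau> s (pair_of_hom M \<tau> \<Psi>)"
  have "(?cl \<Psi>, ?cl \<Psi>) \<in> cong_rel M H \<tau> s"
    using cong_rel_iff[OF assms(2,2)] by blast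
  then have "(?cl \<Phi>, ?cl \<Psi>) \<in> cong_rel M H \<tau> s"
    using eq by (auto simp: rescaling_class_of_pair_def)
  then show "agree_on (inner_tutte_group M) \<Phi> \<Psi>"
    using cong_rel_iff[OF assms] by blast
next
  assume "agree_on (inner_tutte_group M) \<Phi> \<Psi>"
  then have "{\<Xi> \<in> tutte_homs M H s T. agree_on (inner_tutte_group M) \<Phi> \<Xi>}
      = {\<Xi> \<in> tutte_homs M H s T. agree_on (inner_tutte_group M) \<Psi> \<Xi>}"
    by auto
  then show "rescaling_class_of_pair M H \<tau> s (pair_of_hom M \<tau> \<Phi>)
      = rescaling_class_of_pair M H \<tau> s (pair_of_hom M \<tau> \<Psi>)"
    unfolding rescaling_class_of_pair_of_hom[OF assms(1)] rescaling_class_of_pair_of_hom[OF assms(2)]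
    by (rule arg_cong)
qed

lemma rescaling_classes_eq:
  "rescaling_classes M H \<tau> s
    = (\<lambda>\<Phi>. rescaling_class_of_pair M H \<tau> s (pair_of_hom M \<tau> \<Phi>)) ` tutte_homs M H s T"
  by (auto simp: rescaling_classes_def rescaling_class_of_pair_def quotient_def hyperfield_matroids_eq)

section \<open>The correspondences for homomorphisms on the two smaller groups\<close>

lemma ex_bij_hyperfield_matroids:
  "\<exists>\<beta>. bij_betw \<beta> (tutte_homs M H s (tutte_group M)) (hyperfield_matroids M H \<tau> s) \<and>
    (\<forall>\<Phi>\<in>tutte_homs M H s T. \<beta> (restrict \<Phi> (carrier (tutte_group M)))
      = matroid_of_pair M H \<tau> s (pair_of_hom M \<tau> \<Phi>))"
proof (rule ex_bij_betw_common_cover)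
  have T_eq: "T\<lparr>carrier := carrier (tutte_group M)\<rparr> = tutte_group M"
    by (simp add: tutte_group_def)
  show "(\<lambda>\<Phi>. restrict \<Phi> (carrier (tutte_group M))) ` tutte_homs M H s T
      = tutte_homs M H s (tutte_group M)"
  proof (rule restrict_tutte_homs[OF subgroup_tutte_group inner_subset_tutte_group[OF nonempty], where s = s, unfolded T_eq])
    show "\<exists>\<Phi>\<in>hom T U. \<forall>t\<in>carrier (tutte_group M). \<Phi> t = \<phi> t" if "\<phi> \<in> hom (tutte_group M) U" for \<phi>
      by (rule extend_hom_from_tutte_group[OF nonempty that]) (intro bexI ballI)
  qed
  show "restrict \<Phi> (carrier (tutte_group M)) = restrict \<Psi> (carrier (tutte_group M)) \<longleftrightarrow>
      matroid_of_pair M H \<tau> s (pair_of_hom M \<tau> \<Phi>) = matroid_of_pair M H \<tau> s (pair_of_hom M \<tau> \<Psi>)"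
    if "\<Phi> \<in> tutte_homs M H s T" "\<Psi> \<in> tutte_homs M H s T" for \<Phi> \<Psi>
    using that by (simp add: restrict_eq_iff matroid_of_pair_eq_iff tutte_homs_def)
qed (rule hyperfield_matroids_eq[symmetric])

lemma ex_bij_rescaling_classes:
  "\<exists>\<rho>. bij_betw \<rho> (tutte_homs M H s (inner_tutte_group M)) (rescaling_classes M H \<tau> s) \<and>
    (\<forall>\<Phi>\<in>tutte_homs M H s T. \<rho> (restrict \<Phi> (carrier (inner_tutte_group M)))
      = rescaling_class_of_pair M H \<tau> s (pair_of_hom M \<tau> \<Phi>))"
proof (rule ex_bij_betw_common_cover)
  have T_eq: "T\<lparr>carrier := carrier (inner_tutte_group M)\<rparr> = inner_tutte_group M"
    by (simp add: inner_tutte_group_def)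
  show "(\<lambda>\<Phi>. restrict \<Phi> (carrier (inner_tutte_group M))) ` tutte_homs M H s T
      = tutte_homs M H s (inner_tutte_group M)"
  proof (rule restrict_tutte_homs[OF subgroup_inner_tutte_group[of M] order.refl, where s = s, unfolded T_eq])
    show "\<exists>\<Phi>\<in>hom T U. \<forall>t\<in>carrier (inner_tutte_group M). \<Phi> t = \<phi> t" if "\<phi> \<in> hom (inner_tutte_group M) U" for \<phi>
      by (rule extend_hom_from_inner_tutte_group[OF nonempty that]) (intro bexI ballI)
  qed
  show "restrict \<Phi> (carrier (inner_tutte_group M)) = restrict \<Psi> (carrier (inner_tutte_group M)) \<longleftrightarrow>
      rescaling_class_of_pair M H \<tau> s (pair_of_hom M \<tau> \<Phi>)
        = rescaling_class_of_pair M H \<tau> s (pair_of_hom M \<tau> \<Psi>)"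
    if "\<Phi> \<in> tutte_homs M H s T" "\<Psi> \<in> tutte_homs M H s T" for \<Phi> \<Psi>
    using that by (simp add: restrict_eq_iff rescaling_class_of_pair_eq_iff tutte_homs_def)
qed (rule rescaling_classes_eq[symmetric])

end

theorem theorem4p1:
  fixes M :: "'e indep_system" and H :: "'h hyperstructure"
    and \<tau> :: "'h \<Rightarrow> 'h" and s :: strength
  assumes "matroid M" and "hyperfield H" and "hyperfield_involution H \<tau>"
  shows
    \<comment> \<open>(1)\<close>
    "(\<forall>(\<gamma>, \<delta>) \<in> orthogonal_pairs M H \<tau> s.
        \<exists>!\<Phi>. \<Phi> \<in> tutte_homs M H s (ext_tutte_group M) \<and>
          (\<forall>C\<in>circuits M. \<forall>x\<in>C. \<Phi> (t_circ M C x) = \<gamma> C x) \<and>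
          (\<forall>D\<in>cocircuits M. \<forall>y\<in>D. \<Phi> (t_cocirc M D y) = \<tau> (\<delta> D y)))
    \<and>
    \<comment> \<open>(2)\<close>
    (\<forall>\<Phi>. tutte_hom M H s (ext_tutte_group M) \<Phi> \<longrightarrow>
        pair_of_hom M \<tau> \<Phi> \<in> orthogonal_pairs M H \<tau> s)
    \<and>
    \<comment> \<open>(3)\<close>
    (\<forall>\<Phi> \<Psi>. tutte_hom M H s (ext_tutte_group M) \<Phi> \<and> tutte_hom M H s (ext_tutte_group M) \<Psi> \<longrightarrow>
        (matroid_of_pair M H \<tau> s (pair_of_hom M \<tau> \<Phi>) = matroid_of_pair M H \<tau> s (pair_of_hom M \<tau> \<Psi>)
           \<longleftrightarrow> (\<forall>t\<in>carrier (tutte_group M). \<Phi> t = \<Psi> t)) \<and>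
        (rescaling_class_of_pair M H \<tau> s (pair_of_hom M \<tau> \<Phi>)
             = rescaling_class_of_pair M H \<tau> s (pair_of_hom M \<tau> \<Psi>)
           \<longleftrightarrow> (\<forall>t\<in>carrier (inner_tutte_group M). \<Phi> t = \<Psi> t)))
    \<and>
    \<comment> \<open>(4)\<close>
    bij_betw (pair_of_hom M \<tau>)
      (tutte_homs M H s (ext_tutte_group M)) (orthogonal_pairs M H \<tau> s)
    \<and>
    (\<exists>\<beta>. bij_betw \<beta> (tutte_homs M H s (tutte_group M)) (hyperfield_matroids M H \<tau> s) \<and>
        (\<forall>\<Phi> \<in> tutte_homs M H s (ext_tutte_group M).
           \<beta> (restrict \<Phi> (carrier (tutte_group M)))
             = matroid_of_pair M H \<tau> s (pair_of_hom M \<tau> \<Phi>)))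
    \<and>
    (\<exists>\<rho>. bij_betw \<rho> (tutte_homs M H s (inner_tutte_group M)) (rescaling_classes M H \<tau> s) \<and>
        (\<forall>\<Phi> \<in> tutte_homs M H s (ext_tutte_group M).
           \<rho> (restrict \<Phi> (carrier (inner_tutte_group M)))
             = rescaling_class_of_pair M H \<tau> s (pair_of_hom M \<tau> \<Phi>)))"
proof -
  interpret hyperfield_matroid_setting M H \<tau>
    using assms by (simp add: hyperfield_matroid_setting_def)
  have part1: "\<exists>!\<Phi>. \<Phi> \<in> tutte_homs M H s (ext_tutte_group M) \<and>
          (\<forall>C\<in>circuits M. \<forall>x\<in>C. \<Phi> (t_circ M C x) = \<gamma> C x) \<and>
          (\<forall>D\<in>cocircuits M. \<forall>y\<in>D. \<Phi> (t_cocirc M D y) = \<tau> (\<delta> D y))"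
    if orth: "(\<gamma>, \<delta>) \<in> orthogonal_pairs M H \<tau> s" for \<gamma> \<delta>
  proof -
    obtain \<Phi> where \<Phi>: "\<Phi> \<in> tutte_homs M H s (ext_tutte_group M)"
      "\<And>C x. C \<in> circuits M \<Longrightarrow> x \<in> C \<Longrightarrow> \<Phi> (t_circ M C x) = \<gamma> C x"
      "\<And>D y. D \<in> cocircuits M \<Longrightarrow> y \<in> D \<Longrightarrow> \<Phi> (t_cocirc M D y) = \<tau> (\<delta> D y)"
      using hom_of_orthogonal_pair[OF orth] by blast
    show ?thesis
    proof (rule ex1I[of _ \<Phi>])
      show "\<Psi> = \<Phi>" if "\<Psi> \<in> tutte_homs M H s (ext_tutte_group M) \<and>
          (\<forall>C\<in>circuits M. \<forall>x\<in>C. \<Psi> (t_circ M C x) = \<gamma> C x) \<and>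
          (\<forall>D\<in>cocircuits M. \<forall>y\<in>D. \<Psi> (t_cocirc M D y) = \<tau> (\<delta> D y))" for \<Psi>
        using that \<Phi> by (intro tutte_homs_eqI[of \<Psi> s \<Phi>]) simp_all
    qed (intro conjI ballI \<Phi>)
  qed
  show ?thesis
  proof (intro conjI allI impI, goal_cases)
    case 1
    show ?case
    proof
      fix p
      assume "p \<in> orthogonal_pairs M H \<tau> s"
      then show "case p of (\<gamma>, \<delta>) \<Rightarrow> \<exists>!\<Phi>. \<Phi> \<in> tutte_homs M H s (ext_tutte_group M) \<and>
          (\<forall>C\<in>circuits M. \<forall>x\<in>C. \<Phi> (t_circ M C x) = \<gamma> C x) \<and>
          (\<forall>D\<in>cocircuits M. \<forall>y\<in>D. \<Phi> (t_cocirc M D y) = \<tau> (\<delta> D y))"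
        using part1 by (cases p) simp
    qed
  next
    case (2 \<Phi>)
    then show ?case by (rule pair_of_hom_orthogonal)
  next
    case (3 \<Phi> \<Psi>)
    then show ?case by (elim conjE) (rule matroid_of_pair_eq_iff)
  next
    case (4 \<Phi> \<Psi>)
    then show ?case by (elim conjE) (rule rescaling_class_of_pair_eq_iff)
  next
    case 5
    show ?case by (rule bij_betw_pair_of_hom)
  next
    case 6
    show ?case by (rule ex_bij_hyperfield_matroids)
  next
    case 7
    show ?case by (rule ex_bij_rescaling_classes)
  qed
qed

end
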